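(* Let $X,Y,Z\subset\mathbb{R}$ be compact and let $\mu_X\in\mathcal{P}(X)$, $\mu_Y\in\mathcal{P}(Y)$, $\mu_Z\in\mathcal{P}(Z)$ satisfy $\mu_X\preceq_c\mu_Y\preceq_c\mu_Z$, where $\mu_X$ and $\mu_Y$ are discrete, supported on countable sets $\{x_i\}$ and $\{y_j\}$ respectively, and $\mu_Z$ is absolutely continuous with respect to Lebesgue measure. Let $c(x,y,z)$ be a bounded continuous cost function such that for any fixed pairs $(x_i,y_j)\neq(x_k,y_\ell)$, the function $z\mapsto c(x_i,y_j,z)-c(x_k,y_\ell,z)$ intersects any given line at most countably many times. Then the optimal measure $\pi$ for the martingale optimal transport problem $$\inf_{\pi\in\Pi_M(\mu_X,\mu_Y,\mu_Z)}\int c(x,y,z)\,d\pi$$ is unique.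
   Context: $\mathcal{P}(X)$ is the set of Borel probability measures on $X$. Convex order: $\mu\preceq_c\nu$ means $\int\varphi\,d\mu\le\int\varphi\,d\nu$ for all convex $\varphi:\mathbb{R}\to\mathbb{R}$. $\Pi_M(\mu_X,\mu_Y,\mu_Z)$ is the set of probability measures $\pi$ on $X\times Y\times Z$ with marginals $\mu_X,\mu_Y,\mu_Z$ such that under $\pi$ the conditional mean of $y$ given $x$ is $x$, and the conditional mean of $z$ given $(x,y)$ is $y$, $\pi$-a.s. "Intersects any given line at most countably many times" means: for all $a,b\in\mathbb{R}$, the set of $z$ with $c(x_i,y_j,z)-c(x_k,y_\ell,z)=az+b$ is at most countable. *)

theory Defs
  imports "HOL-Probability.Probability"
begin

definition borel_probs :: "'a::topological_space set \<Rightarrow> 'a measure set" where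
  "borel_probs S = {\<mu>. prob_space \<mu> \<and> sets \<mu> = sets (restrict_space borel S)}"

text \<open>The Bochner integral is \<open>0\<close> on non-integrable functions, so this is the convex order only
  among measures that integrate every convex function, such as those in \<open>borel_probs S\<close> with \<open>S\<close>
  compact.\<close>

definition convex_order :: "real measure \<Rightarrow> real measure \<Rightarrow> bool" (infix "\<preceq>\<^sub>c" 50) where
  "\<mu> \<preceq>\<^sub>c \<nu> \<longleftrightarrow> (\<forall>\<phi> :: real \<Rightarrow> real. convex_on UNIV \<phi> \<longrightarrow> (\<integral>x. \<phi> x \<partial>\<mu>) \<le> (\<integral>x. \<phi> x \<partial>\<nu>))"

text \<open>The two conditional means are taken with respect to the \<open>\<sigma>\<close>-algebras on \<open>X \<times> Y \<times> Z\<close>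
  generated by the first coordinate and by the first two coordinates.\<close>

definition martingale_couplings ::
  "real set \<Rightarrow> real set \<Rightarrow> real set \<Rightarrow> real measure \<Rightarrow> real measure \<Rightarrow> real measure
    \<Rightarrow> (real \<times> real \<times> real) measure set" where
  "martingale_couplings X Y Z \<mu>X \<mu>Y \<mu>Z =
    {\<pi> \<in> borel_probs (X \<times> Y \<times> Z).
       distr \<pi> (restrict_space borel X) (\<lambda>(x, y, z). x) = \<mu>X \<and>
       distr \<pi> (restrict_space borel Y) (\<lambda>(x, y, z). y) = \<mu>Y \<and>
       distr \<pi> (restrict_space borel Z) (\<lambda>(x, y, z). z) = \<mu>Z \<and>
       (AE (x, y, z) in \<pi>.
          real_cond_exp \<pi> (vimage_algebra (X \<times> Y \<times> Z) (\<lambda>(x, y, z). x) borel)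
            (\<lambda>(x, y, z). y) (x, y, z) = x) \<and>
       (AE (x, y, z) in \<pi>.
          real_cond_exp \<pi> (vimage_algebra (X \<times> Y \<times> Z) (\<lambda>(x, y, z). (x, y)) borel)
            (\<lambda>(x, y, z). z) (x, y, z) = y)}"

definition optimal_martingale_coupling ::
  "(real \<Rightarrow> real \<Rightarrow> real \<Rightarrow> real) \<Rightarrow> real set \<Rightarrow> real set \<Rightarrow> real set
    \<Rightarrow> real measure \<Rightarrow> real measure \<Rightarrow> real measure \<Rightarrow> (real \<times> real \<times> real) measure \<Rightarrow> bool" where
  "optimal_martingale_coupling c X Y Z \<mu>X \<mu>Y \<mu>Z \<pi> \<longleftrightarrow>
    is_arg_min (\<lambda>\<pi>'. \<integral>(x, y, z). c x y z \<partial>\<pi>')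
      (\<lambda>\<pi>'. \<pi>' \<in> martingale_couplings X Y Z \<mu>X \<mu>Y \<mu>Z) \<pi>"

end

(*
  Uniqueness.  If two optimal couplings exist, their average is optimal.  Suppose that, over two
  different atoms (x, y) and (x', y'), the average has densities with respect to muZ with common
  part rho > 0.  Subtract from d(z) = c(x, y, z) - c(x', y', z) its regression on 1 and z in L2(rho);
  moving the signed mass proportional to the residual s from one atom to the other changes neither
  the marginals nor the conditional means, and it changes the cost by a negative multiple of the
  integral of s^2 rho.  So s = 0 rho-a.e., that is, d is affine rho-a.e., which the hypothesis on c
  forbids.  Hence the average is carried by a set that meets almost every line {z = const} in one
  point, and such a coupling is determined by muZ.

  Existence.  A coupling of muX and muY, and one of their joint law with muZ, come from extracting
  the atoms one by one: each atom takes the mass of the larger law on an interval with the right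
  mass and barycentre, and convex order survives.  Minimizing sequences of densities converge almost
  everywhere, after passing to convex combinations, because
  (e^-a + e^-b)/2 - e^-((a+b)/2) = (e^(-a/2) - e^(-b/2))^2 / 2 makes e^(-g/2) Cauchy in L2 along
  near-minimizers of the integral of e^-g.
*)

theory Submission
  imports Defs
begin

text \<open>\<open>\<mu>Y\<close> has atoms, so an interval of prescribed \<open>\<mu>Y\<close>-mass
  need not exist. The larger law is therefore always given as the image of an atomless measure
  \<open>N\<close> under a monotone \<open>Q\<close>: the quantile function for
  \<open>\<mu>Y\<close>, a clamp for \<open>\<mu>Z\<close>.

  Convex order survives an extraction because a test function may be replaced by its maximum with
  its chord over the extracted interval: there the maximum is the chord, whose integral depends only
  on mass and barycentre, and elsewhere nothing changes.

  Two objectives are at work in the existence proof. The transport cost only cuts out nested sets of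
  near-minimizers; the integral of e^-g then selects a sequence inside them. These sets are closed
  under midpoints, so no convex combinations have to be written down.

  Densities are taken with respect to the product \<open>\<kappa>\<close> of the marginals. They are
  uniformly integrable because all but little mass lies over finitely many pairs of atoms, and over
  a pair of weight w a set of \<open>\<kappa>\<close>-measure t has a section of
  \<open>\<mu>Z\<close>-mass at most t/w. This yields L1 convergence, under which all constraints,
  being integrals of bounded functions, persist.\<close>

lemmas lebesgue_cong = Bochner_Integration.integral_cong

section \<open>Convex functions and extraction of atoms\<close>

text \<open>The line is the chord through the two endpoints of the graph. In
  \<open>atom_extraction\<close> the maximum of \<open>\<phi>\<close> and this line serves as a test
  function that is affine over the interval and unchanged elsewhere.\<close>

lemma convex_chord_max:
  fixes \<phi> :: "real \<Rightarrow> real"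
  assumes \<phi>: "convex_on UNIV \<phi>" and ab: "a < b"
  obtains s t where "\<And>x. a \<le> x \<Longrightarrow> x \<le> b \<Longrightarrow> \<phi> x \<le> s * x + t"
    and "\<And>x. x \<le> a \<or> b \<le> x \<Longrightarrow> s * x + t \<le> \<phi> x"
proof -
  define s where "s = (\<phi> b - \<phi> a) / (b - a)"
  define t where "t = \<phi> a - s * a"
  have sa: "s * a + t = \<phi> a" by (simp add: t_def)
  have sb: "s * b + t = \<phi> b" 
  proof -
    have "s * (b - a) = \<phi> b - \<phi> a" using ab by (simp add: s_def)
    then show ?thesis by (simp add: t_def algebra_simps)
  qed
  have seg: "\<phi> ((1 - u) * x + u * y) \<le> (1 - u) * \<phi> x + u * \<phi> y" if "0 \<le> u" "u \<le> 1" for u x y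
    using convex_onD[OF \<phi>, of u x y] that by simp
  \<comment> \<open>The three-point inequality cleared of denominators. It is used below with the
    given point in the middle, on the left and on the right of \<open>a\<close> and
    \<open>b\<close>.\<close>
  have seg': "(y - x) * \<phi> z \<le> (y - z) * \<phi> x + (z - x) * \<phi> y" if "x \<le> z" "z \<le> y" "x < y" for x y z
  proof -
    define u where "u = (z - x) / (y - x)"
    have u: "0 \<le> u" "u \<le> 1" "u * (y - x) = z - x" using that by (auto simp: u_def)
    have z: "(1 - u) * x + u * y = z" using u(3) by (simp add: algebra_simps)
    have "(y - x) * \<phi> z \<le> (y - x) * ((1 - u) * \<phi> x + u * \<phi> y)"
      using seg[OF u(1,2), of x y] that unfolding z by (intro mult_left_mono) auto
    also have "\<dots> = ((y - x) - u * (y - x)) * \<phi> x + (u * (y - x)) * \<phi> y" by (simp add: algebra_simps)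
    finally show ?thesis by (simp add: u(3))
  qed
  show thesis
  proof (rule that[of s t])
    fix x assume x: "a \<le> x" "x \<le> b"
    have "(b - a) * \<phi> x \<le> (b - x) * (s * a + t) + (x - a) * (s * b + t)"
      using seg'[OF x ab] sa sb by simp
    also have "\<dots> = (b - a) * (s * x + t)" by (simp add: algebra_simps)
    finally show "\<phi> x \<le> s * x + t" using ab by simp
  next
    fix x assume "x \<le> a \<or> b \<le> x"
    then show "s * x + t \<le> \<phi> x"
    proof
      assume x: "x \<le> a"
      have "(b - x) * (s * a + t) \<le> (b - a) * \<phi> x + (a - x) * (s * b + t)"
        using seg'[of x a b] x ab sa sb by simp
      then have "(b - a) * (s * x + t) \<le> (b - a) * \<phi> x" by (simp add: algebra_simps)
      then show ?thesis using ab by simp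
    next
      assume x: "b \<le> x"
      have "(x - a) * (s * b + t) \<le> (x - b) * (s * a + t) + (b - a) * \<phi> x"
        using seg'[of a b x] x ab sa sb by simp
      then have "(b - a) * (s * x + t) \<le> (b - a) * \<phi> x" by (simp add: algebra_simps)
      then show ?thesis using ab by simp
    qed
  qed
qed

lemma convex_on_max_real:
  fixes f g :: "real \<Rightarrow> real"
  assumes f: "convex_on UNIV f" and g: "convex_on UNIV g"
  shows "convex_on UNIV (\<lambda>x. max (f x) (g x))"
proof (rule convex_onI)
  fix t x y :: real assume t: "0 < t" "t < 1"
  let ?z = "(1 - t) *\<^sub>R x + t *\<^sub>R y"
  have "f ?z \<le> (1 - t) * f x + t * f y" "g ?z \<le> (1 - t) * g x + t * g y"
    using convex_onD[OF f, of t x y] convex_onD[OF g, of t x y] t by auto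
  moreover have "(1 - t) * f x + t * f y \<le> (1 - t) * max (f x) (g x) + t * max (f y) (g y)"
    "(1 - t) * g x + t * g y \<le> (1 - t) * max (f x) (g x) + t * max (f y) (g y)"
    using t by (intro add_mono mult_left_mono; simp)+
  ultimately show "max (f ?z) (g ?z) \<le> (1 - t) * max (f x) (g x) + t * max (f y) (g y)"
    by linarith
qed simp

lemma convex_on_affine_real: "convex_on UNIV (\<lambda>x::real. s * x + t)"
proof (rule convex_onI)
  fix u x y :: real
  show "s * ((1 - u) *\<^sub>R x + u *\<^sub>R y) + t \<le> (1 - u) * (s * x + t) + u * (s * y + t)"
    by (simp add: algebra_simps)
qed simp

lemma convex_on_UNIV_continuous:
  fixes \<phi> :: "real \<Rightarrow> real"
  shows "convex_on UNIV \<phi> \<Longrightarrow> continuous_on UNIV \<phi>"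
  by (rule convex_on_continuous[OF open_UNIV])

lemma convex_on_UNIV_bounded_interval:
  fixes \<phi> :: "real \<Rightarrow> real" and C :: real
  assumes "convex_on UNIV \<phi>"
  obtains B where "\<And>x. \<bar>x\<bar> \<le> C \<Longrightarrow> \<bar>\<phi> x\<bar> \<le> B"
proof -
  have "compact (\<phi> ` {-C..C})"
    by (intro compact_continuous_image continuous_on_subset[OF convex_on_UNIV_continuous[OF assms]]) auto
  then obtain B where B: "\<And>x. x \<in> {-C..C} \<Longrightarrow> norm (\<phi> x) \<le> B"
    using compact_imp_bounded bounded_iff by (metis imageI)
  show thesis
  proof (rule that)
    show "\<bar>\<phi> x\<bar> \<le> B" if "\<bar>x\<bar> \<le> C" for x
      using B[of x] that by (auto simp: abs_le_iff)
  qed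
qed

lemma integrable_convex_comp:
  assumes fin: "finite_measure N" and \<phi>: "convex_on UNIV \<phi>"
    and Q: "Q \<in> borel_measurable N" and Qb: "\<And>u. u \<in> space N \<Longrightarrow> \<bar>Q u\<bar> \<le> (C::real)"
  shows "integrable N (\<lambda>u. \<phi> (Q u))"
proof -
  interpret finite_measure N by fact
  obtain B where "\<And>x. \<bar>x\<bar> \<le> C \<Longrightarrow> \<bar>\<phi> x\<bar> \<le> B"
    using convex_on_UNIV_bounded_interval[OF \<phi>, of C] by blast
  moreover have "\<phi> \<in> borel_measurable borel"
    by (rule borel_measurable_continuous_onI[OF convex_on_UNIV_continuous[OF \<phi>]])
  ultimately show ?thesis
    using Q Qb by (intro integrable_const_bound[of _ B]) auto
qed

text \<open>\<open>r\<close> stands for the part of the convex functional that belongs to the remaining atoms.\<close>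

lemma atom_extraction:
  fixes N :: "real measure" and Q :: "real \<Rightarrow> real" and r :: "(real \<Rightarrow> real) \<Rightarrow> real"
  assumes fin: "finite_measure N" and sN: "sets N = sets borel"
    and atomless: "\<And>x. measure N {x} = 0"
    and supp: "measure N (- {l..h}) = 0" and lh: "l \<le> h"
    and Q: "mono Q" and Qb: "\<And>u. \<bar>Q u\<bar> \<le> C"
    and p: "0 \<le> p"
    and r0: "\<And>\<phi>. convex_on UNIV \<phi> \<Longrightarrow> (\<And>x. 0 \<le> \<phi> x) \<Longrightarrow> 0 \<le> r \<phi>"
    and r_mono: "\<And>\<phi> \<psi>. convex_on UNIV \<phi> \<Longrightarrow> convex_on UNIV \<psi> \<Longrightarrow> (\<And>x. \<phi> x \<le> \<psi> x) \<Longrightarrow> r \<phi> \<le> r \<psi>"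
    and ord: "\<And>\<phi>. convex_on UNIV \<phi> \<Longrightarrow> p * \<phi> y + r \<phi> \<le> (\<integral>u. \<phi> (Q u) \<partial>N)"
  shows "\<exists>E\<in>sets borel. measure N E = p \<and> (\<integral>u. indicator E u * Q u \<partial>N) = p * y \<and>
    (\<forall>\<phi>. convex_on UNIV \<phi> \<longrightarrow> r \<phi> \<le> (\<integral>u. indicator (- E) u * \<phi> (Q u) \<partial>N))"
proof (cases "p = 0")
  case True
  then show ?thesis using ord by (intro bexI[of _ "{}"]) auto
next
  case False
  with p have p0: "0 < p" by simp
  interpret finite_measure N by fact
  have spN[simp]: "space N = UNIV" using sets_eq_imp_space_eq[OF sN] by simp
  note sN[measurable_cong]
  have Qm[measurable]: "Q \<in> borel_measurable borel" by (rule borel_measurable_mono[OF Q])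
  have QmN[measurable]: "Q \<in> borel_measurable N" by simp
  have Qi: "integrable N Q"
    by (intro integrable_const_bound[of _ C]) (use Qb in auto)
  have ind: "integrable N (\<lambda>u. indicator S u * f u)" if "S \<in> sets borel" "integrable N f" for S and f :: "real \<Rightarrow> real"
    using integrable_mult_indicator[of S N f] that sN by simp
  have ii[simp]: "integrable N (indicator S :: real \<Rightarrow> real)" if "S \<in> sets borel" for S
    using that sN by (intro integrable_real_indicator) (auto simp: emeasure_eq_measure)
  note ic = integrable_convex_comp[OF fin _ QmN Qb]
  define m where "m = measure N UNIV"
  define F where "F t = measure N {..t}" for t
  define G where "G t = (\<integral>u. indicator {..t} u * Q u \<partial>N)" for t
  have F_diff: "F b - F a = measure N {a<..b}" if "a \<le> b" for a b
  proof -
    have "{..b} = {..a} \<union> {a<..b}" using that by auto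
    then have "F b = F a + measure N {a<..b}"
      unfolding F_def using sN by (subst finite_measure_Union[symmetric]) auto
    then show ?thesis by simp
  qed
  have G_diff: "G b - G a = (\<integral>u. indicator {a<..b} u * Q u \<partial>N)" if "a \<le> b" for a b
  proof -
    have "G b - G a = (\<integral>u. indicator {..b} u * Q u - indicator {..a} u * Q u \<partial>N)"
      unfolding G_def using ind[OF _ Qi] by simp
    also have "\<dots> = (\<integral>u. indicator {a<..b} u * Q u \<partial>N)"
      using that by (intro lebesgue_cong) (auto simp: indicator_def)
    finally show ?thesis .
  qed
  have F_mono: "F a \<le> F b" if "a \<le> b" for a b
    using F_diff[OF that] measure_nonneg[of N "{a<..b}"] by linarith
  have C0: "0 \<le> C" using Qb[of 0] by simp
  have G_lip1: "\<bar>G b - G a\<bar> \<le> C * (F b - F a)" if "a \<le> b" for a b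
  proof -
    have "\<bar>G b - G a\<bar> \<le> (\<integral>u. \<bar>indicator {a<..b} u * Q u\<bar> \<partial>N)"
      unfolding G_diff[OF that] by (rule integral_abs_bound)
    also have "\<dots> \<le> (\<integral>u. C * indicator {a<..b} u \<partial>N)"
    proof (intro integral_mono integrable_abs ind Qi)
      show "integrable N (\<lambda>u. C * indicator {a<..b} u)"
        by (intro integrable_mult_right ii) simp
    qed (use Qb C0 in \<open>auto simp: indicator_def\<close>)
    also have "\<dots> = C * (F b - F a)"
      using sN by (simp add: F_diff[OF that])
    finally show ?thesis .
  qed
  have G_lip: "\<bar>G b - G a\<bar> \<le> C * \<bar>F b - F a\<bar>" for a b
  proof (cases "a \<le> b")
    case True then show ?thesis using G_lip1 F_mono[OF True] by simp
  next
    case False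
    then have "b \<le> a" by simp
    then show ?thesis using G_lip1[of b a] F_mono[of b a] by (simp add: abs_minus_commute)
  qed
  have Fl: "F l = 0"
  proof -
    have "F l \<le> measure N (- {l..h} \<union> {l})"
      unfolding F_def using sN by (intro finite_measure_mono) auto
    also have "\<dots> \<le> measure N (- {l..h}) + measure N {l}"
      using sN by (intro measure_Un_le) auto
    finally show ?thesis using supp atomless[of l] by (simp add: F_def measure_le_0_iff)
  qed
  have Fh: "F h = m"
  proof -
    have "m \<le> measure N (- {l..h} \<union> {..h})"
      unfolding m_def using sN lh by (intro finite_measure_mono) auto
    also have "\<dots> \<le> measure N (- {l..h}) + F h"
      unfolding F_def using sN by (intro measure_Un_le) auto
    moreover have "F h \<le> m" unfolding F_def m_def using sN by (intro finite_measure_mono) auto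
    ultimately show ?thesis using supp by simp
  qed
  have F_cont: "isCont F x" for x
  proof -
    have fb: "finite_borel_measure N"
      using sN by (simp add: finite_borel_measure_def finite_borel_measure_axioms_def fin)
    have "isCont (cdf N) x"
      using finite_borel_measure.isCont_cdf[OF fb, of x] atomless by simp
    then show ?thesis by (simp add: F_def[abs_def] cdf_def[abs_def])
  qed
  have "\<exists>t. l \<le> t \<and> t \<le> h \<and> F t = s" if "0 \<le> s" "s \<le> m" for s
    using IVT[of F l s h] that lh Fl Fh F_cont by auto
  \<comment> \<open>\<open>q\<close> is an arbitrary right inverse of \<open>F\<close> and may jump.
    Only \<open>G (q s)\<close> has to be continuous in \<open>s\<close>, and this follows from
    \<open>G_lip\<close>, since \<open>F (q s) = s\<close>.\<close>
  then obtain q where q: "\<And>s. 0 \<le> s \<Longrightarrow> s \<le> m \<Longrightarrow> l \<le> q s \<and> q s \<le> h \<and> F (q s) = s"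
    by metis
  have r_nn: "p * \<phi> y \<le> (\<integral>u. \<phi> (Q u) \<partial>N)" if "convex_on UNIV \<phi>" "\<And>x. 0 \<le> \<phi> x" for \<phi>
    using ord[OF that(1)] r0[OF that] by linarith
  have pm: "p \<le> m"
    using r_nn[of "\<lambda>_. 1"] convex_on_affine_real[of 0 1] by (simp add: m_def)
  \<comment> \<open>The integral of \<open>Q\<close> over the interval of mass \<open>p\<close> that
    begins at level \<open>s\<close>. Sliding \<open>s\<close> from \<open>0\<close> to
    \<open>m - p\<close> moves the barycentre from the smallest to the largest possible one, and the
    intermediate value theorem hits \<open>y\<close>.\<close>
  define M where "M s = G (q (s + p)) - G (q s)" for s
  have G_q: "\<bar>G (q s) - G (q s')\<bar> \<le> C * \<bar>s - s'\<bar>" if "s \<in> {0..m}" "s' \<in> {0..m}" for s s'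
    using G_lip[of "q s" "q s'"] q[of s] q[of s'] that by simp
  have M_cont: "continuous_on {0..m - p} M"
  proof -
    have gc: "continuous_on {0..m} (\<lambda>s. G (q s))"
    proof (rule continuous_onI)
      fix x e :: real assume x: "x \<in> {0..m}" and e: "0 < e"
      show "\<exists>d>0. \<forall>x'\<in>{0..m}. dist x' x < d \<longrightarrow> dist (G (q x')) (G (q x)) \<le> e"
      proof (intro exI[of _ "e / (C + 1)"] conjI ballI impI)
        show "0 < e / (C + 1)" using e C0 by simp
        fix x' assume x': "x' \<in> {0..m}" and d: "dist x' x < e / (C + 1)"
        have "\<bar>G (q x') - G (q x)\<bar> \<le> C * \<bar>x' - x\<bar>" by (rule G_q[OF x' x])
        also have "\<dots> \<le> (C + 1) * (e / (C + 1))"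
          using d C0 by (intro mult_mono) (auto simp: dist_real_def)
        also have "\<dots> = e" using C0 by simp
        finally show "dist (G (q x')) (G (q x)) \<le> e" by (simp add: dist_real_def)
      qed
    qed
    have "continuous_on {0..m - p} (\<lambda>s. G (q (s + p)))"
      by (rule continuous_on_compose2[OF gc]) (use p0 in \<open>auto intro!: continuous_intros\<close>)
    moreover have "continuous_on {0..m - p} (\<lambda>s. G (q s))"
      by (rule continuous_on_subset[OF gc]) (use p0 in auto)
    ultimately show ?thesis unfolding M_def by (intro continuous_intros)
  qed
  have G_null: "G a = 0" if "F a = 0" for a
  proof -
    have "AE u in N. u \<notin> {..a}"
      using that sN by (intro AE_not_in) (auto simp: null_sets_def F_def emeasure_eq_measure)
    then have "AE u in N. indicator {..a} u * Q u = 0"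
      by eventually_elim auto
    then show ?thesis unfolding G_def by (rule integral_eq_zero_AE)
  qed
  \<comment> \<open>The test function is a hinge with its kink at the value of \<open>Q\<close> at
    the right end of the leftmost interval. By monotonicity of \<open>Q\<close> it integrates only
    that interval. \<open>M1\<close> is the mirror image.\<close>
  have M0: "M 0 \<le> p * y"
  proof -
    define b where "b = q p"
    have Fb: "F b = p" using q[of p] p0 pm by (simp add: b_def)
    define k where "k = Q b"
    have cv: "convex_on UNIV (\<lambda>x. max 0 (k - x))"
      using convex_on_max_real[OF convex_on_affine_real[of 0 0] convex_on_affine_real[of "-1" k]] by simp
    have "p * (k - y) \<le> p * max 0 (k - y)" using p0 by (intro mult_left_mono) auto
    also have "\<dots> \<le> (\<integral>u. max 0 (k - Q u) \<partial>N)" by (rule r_nn[OF cv]) simp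
    also have "\<dots> = (\<integral>u. k * indicator {..b} u - indicator {..b} u * Q u \<partial>N)"
    proof (intro lebesgue_cong refl)
      fix u show "max 0 (k - Q u) = k * indicator {..b} u - indicator {..b} u * Q u"
        using monoD[OF Q, of u b] monoD[OF Q, of b u] by (auto simp: k_def indicator_def)
    qed
    also have "\<dots> = k * p - G b"
      using Fb ind[OF _ Qi] sN by (simp add: G_def F_def)
    finally have "G b \<le> p * y" by (simp add: algebra_simps)
    moreover have "G (q 0) = 0" using q[of 0] pm p0 by (intro G_null) simp
    ultimately show ?thesis by (simp add: M_def b_def)
  qed
  have G_h: "G h = (\<integral>u. Q u \<partial>N)"
  proof -
    have "measure N {h<..} \<le> measure N (- {l..h})"
      using sN by (intro finite_measure_mono) auto
    then have "AE u in N. u \<notin> {h<..}"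
      using supp sN by (intro AE_not_in) (auto simp: null_sets_def emeasure_eq_measure measure_le_0_iff)
    then have "AE u in N. indicator {..h} u * Q u = Q u"
      by eventually_elim (auto simp: indicator_def)
    then show ?thesis unfolding G_def by (intro integral_cong_AE) auto
  qed
  \<comment> \<open>\<open>q m\<close> may lie to the left of \<open>h\<close>, but no mass
    separates the two points.\<close>
  have G_m: "G (q m) = (\<integral>u. Q u \<partial>N)"
  proof -
    have "\<bar>G h - G (q m)\<bar> \<le> C * \<bar>F h - F (q m)\<bar>" by (rule G_lip)
    then show ?thesis using q[of m] pm p0 Fh G_h by simp
  qed
  have M1: "p * y \<le> M (m - p)"
  proof -
    define a where "a = q (m - p)"
    have Fa: "F a = m - p" using q[of "m - p"] p0 pm by (simp add: a_def)
    define k where "k = Q a"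
    have cv: "convex_on UNIV (\<lambda>x. max 0 (x - k))"
      using convex_on_max_real[OF convex_on_affine_real[of 0 0] convex_on_affine_real[of "1" "-k"]] by simp
    have "p * (y - k) \<le> p * max 0 (y - k)" using p0 by (intro mult_left_mono) auto
    also have "\<dots> \<le> (\<integral>u. max 0 (Q u - k) \<partial>N)" by (rule r_nn[OF cv]) simp
    also have "\<dots> = (\<integral>u. (Q u - k) - (indicator {..a} u * Q u - k * indicator {..a} u) \<partial>N)"
    proof (intro lebesgue_cong refl)
      fix u show "max 0 (Q u - k) = (Q u - k) - (indicator {..a} u * Q u - k * indicator {..a} u)"
        using monoD[OF Q, of u a] monoD[OF Q, of a u] by (auto simp: k_def indicator_def)
    qed
    also have "\<dots> = ((\<integral>u. Q u \<partial>N) - k * m) - (G a - k * (m - p))"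
      using Fa ind[OF _ Qi] sN Qi by (simp add: G_def F_def m_def)
    finally have "p * y \<le> (\<integral>u. Q u \<partial>N) - G a" by (simp add: algebra_simps)
    then show ?thesis using G_m by (simp add: M_def a_def)
  qed
  obtain s where s: "0 \<le> s" "s \<le> m - p" "M s = p * y"
    using IVT'[of M 0 "p * y" "m - p"] M0 M1 M_cont pm by auto
  define a b where "a = q s" and "b = q (s + p)"
  have Fa: "F a = s" and Fb: "F b = s + p"
    using q[of s] q[of "s + p"] s p0 by (auto simp: a_def b_def)
  have ab: "a < b"
  proof (rule ccontr)
    assume "\<not> a < b" then have "F b \<le> F a" by (intro F_mono) simp
    then show False using Fa Fb p0 by simp
  qed
  define E where "E = {a<..b}"
  have E[measurable]: "E \<in> sets borel" by (simp add: E_def)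
  have mE: "measure N E = p" using F_diff[of a b] ab Fa Fb by (simp add: E_def)
  have iE: "(\<integral>u. indicator E u * Q u \<partial>N) = p * y"
    using G_diff[of a b] ab s(3) by (simp add: E_def M_def a_def b_def)
  have iEl: "(\<integral>u. indicator E u * (\<sigma> * Q u + \<tau>) \<partial>N) = p * (\<sigma> * y + \<tau>)" for \<sigma> \<tau>
  proof -
    have "(\<integral>u. indicator E u * (\<sigma> * Q u + \<tau>) \<partial>N) = (\<integral>u. \<sigma> * (indicator E u * Q u) + \<tau> * indicator E u \<partial>N)"
      by (intro lebesgue_cong) (auto simp: indicator_def)
    also have "\<dots> = \<sigma> * (p * y) + \<tau> * p"
      using ind[OF E Qi] E sN by (simp add: iE mE)
    finally show ?thesis by (simp add: algebra_simps)
  qed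
  have split: "(\<integral>u. f u \<partial>N) = (\<integral>u. indicator E u * f u \<partial>N) + (\<integral>u. indicator (- E) u * f u \<partial>N)"
    if "integrable N f" for f :: "real \<Rightarrow> real"
  proof -
    have "(\<integral>u. f u \<partial>N) = (\<integral>u. indicator E u * f u + indicator (- E) u * f u \<partial>N)"
      by (intro lebesgue_cong) (auto simp: indicator_def)
    then show ?thesis using ind[OF E that] ind[of "- E" f] that E by simp
  qed
  have "r \<phi> \<le> (\<integral>u. indicator (- E) u * \<phi> (Q u) \<partial>N)" if \<phi>: "convex_on UNIV \<phi>" for \<phi>
  proof -
    \<comment> \<open>The line is the chord over the range from \<open>Q a\<close> to
      \<open>Q b\<close>. If \<open>Q a = Q b\<close>, the chord degenerates, but then
      \<open>Q\<close> is constant on \<open>E\<close> and a supporting line at that value does the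
      same.\<close>
    obtain \<sigma> \<tau> where in_le: "\<And>u. u \<in> E \<Longrightarrow> \<phi> (Q u) \<le> \<sigma> * Q u + \<tau>"
      and out_le: "\<And>u. u \<notin> E \<Longrightarrow> \<sigma> * Q u + \<tau> \<le> \<phi> (Q u)"
    proof (cases "Q a = Q b")
      case True
      define k where "k = Q a"
      have "\<exists>\<sigma>. \<forall>x. \<sigma> * (x - k) + \<phi> k \<le> \<phi> x"
      proof (intro exI allI)
        fix x
        \<comment> \<open>The infimum of the slopes to the right of \<open>k\<close> is the right
          derivative, which is a subgradient.\<close>
        show "Inf ((\<lambda>t. (\<phi> k - \<phi> t) / (k - t)) ` ({k<..} \<inter> UNIV)) * (x - k) + \<phi> k \<le> \<phi> x"
          using convex_le_Inf_differential[OF \<phi>, of k x] by simp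
      qed
      then obtain \<sigma> where \<sigma>: "\<And>x. \<sigma> * (x - k) + \<phi> k \<le> \<phi> x" by blast
      show thesis
      proof (rule that[of \<sigma> "\<phi> k - \<sigma> * k"])
        fix u assume "u \<in> E"
        then have "Q u = k"
          using monoD[OF Q, of a u] monoD[OF Q, of u b] True by (auto simp: E_def k_def)
        then show "\<phi> (Q u) \<le> \<sigma> * Q u + (\<phi> k - \<sigma> * k)" by simp
      next
        fix u show "\<sigma> * Q u + (\<phi> k - \<sigma> * k) \<le> \<phi> (Q u)"
          using \<sigma>[of "Q u"] by (simp add: algebra_simps)
      qed
    next
      case False
      then have Qab: "Q a < Q b" using monoD[OF Q, of a b] ab by simp
      obtain \<sigma> \<tau> where st: "\<And>x. Q a \<le> x \<Longrightarrow> x \<le> Q b \<Longrightarrow> \<phi> x \<le> \<sigma> * x + \<tau>"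
        "\<And>x. x \<le> Q a \<or> Q b \<le> x \<Longrightarrow> \<sigma> * x + \<tau> \<le> \<phi> x"
        using convex_chord_max[OF \<phi> Qab] by blast
      show thesis
      proof (rule that[of \<sigma> \<tau>])
        fix u assume "u \<in> E"
        then show "\<phi> (Q u) \<le> \<sigma> * Q u + \<tau>"
          using monoD[OF Q, of a u] monoD[OF Q, of u b] by (intro st(1)) (auto simp: E_def)
      next
        fix u assume "u \<notin> E"
        then show "\<sigma> * Q u + \<tau> \<le> \<phi> (Q u)"
          using monoD[OF Q, of u a] monoD[OF Q, of b u] by (intro st(2)) (auto simp: E_def)
      qed
    qed
    \<comment> \<open>On \<open>E\<close> the function \<open>\<psi>\<close> is the line, so its
      integral there is \<open>p\<close> times the value of the line at the barycentre
      \<open>y\<close>, hence at most \<open>p * \<psi> y\<close>. Off \<open>E\<close> it is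
      \<open>\<phi>\<close>. Testing the order with \<open>\<psi>\<close> thus gives the order for
      what remains.\<close>
    define \<psi> where "\<psi> x = max (\<phi> x) (\<sigma> * x + \<tau>)" for x
    have \<psi>: "convex_on UNIV \<psi>"
      unfolding \<psi>_def by (rule convex_on_max_real[OF \<phi> convex_on_affine_real])
    have "r \<phi> \<le> r \<psi>" by (rule r_mono[OF \<phi> \<psi>]) (simp add: \<psi>_def)
    also have "\<dots> \<le> (\<integral>u. \<psi> (Q u) \<partial>N) - p * \<psi> y" using ord[OF \<psi>] by simp
    also have "\<dots> \<le> (\<integral>u. \<psi> (Q u) \<partial>N) - p * (\<sigma> * y + \<tau>)"
      using p0 by (simp add: \<psi>_def mult_left_mono)
    also have "\<dots> = (\<integral>u. indicator (- E) u * \<psi> (Q u) \<partial>N)"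
    proof -
      have "(\<integral>u. indicator E u * \<psi> (Q u) \<partial>N) = (\<integral>u. indicator E u * (\<sigma> * Q u + \<tau>) \<partial>N)"
        using in_le by (intro lebesgue_cong) (auto simp: indicator_def \<psi>_def)
      then show ?thesis using split[OF ic[OF \<psi>]] iEl by simp
    qed
    also have "\<dots> = (\<integral>u. indicator (- E) u * \<phi> (Q u) \<partial>N)"
      using out_le by (intro lebesgue_cong) (auto simp: indicator_def \<psi>_def intro!: max_absorb1)
    finally show ?thesis .
  qed
  then show ?thesis using mE iE E by blast
qed

section \<open>Simultaneous extraction of countably many atoms\<close>

lemma sums_integral_nat_fibres:
  fixes f :: "'a \<Rightarrow> real" and T :: "'a \<Rightarrow> nat"
  assumes f: "integrable M f" and T[measurable]: "T \<in> measurable M (count_space UNIV)"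
  shows "(\<lambda>n. \<integral>x. indicator {n} (T x) * f x \<partial>M) sums (\<integral>x. f x \<partial>M)"
proof -
  have "(\<lambda>n. \<integral>x. indicator {n} (T x) * f x \<partial>M) sums (\<integral>x. (\<Sum>n. indicator {n} (T x) * f x) \<partial>M)"
  proof (rule sums_integral)
    have [measurable]: "(\<lambda>x. indicator {n} (T x) :: real) \<in> borel_measurable M" for n
      by (rule measurable_compose[OF T]) simp
    have [measurable]: "f \<in> borel_measurable M" using f by auto
    show i: "integrable M (\<lambda>x. indicator {n} (T x) * f x)" for n
    proof (rule Bochner_Integration.integrable_bound[OF f])
      show "AE x in M. norm (indicator {n} (T x) * f x) \<le> norm (f x)" by (auto simp: indicator_def)
    qed measurable
    show "AE x in M. summable (\<lambda>n. norm (indicator {n} (T x) * f x))"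
    proof (rule AE_I2)
      fix x show "summable (\<lambda>n. norm (indicator {n} (T x) * f x))"
        by (rule summable_finite[of "{T x}"]) auto
    qed
    show "summable (\<lambda>n. \<integral>x. norm (indicator {n} (T x) * f x) \<partial>M)"
    proof (rule summableI_nonneg_bounded)
      fix k
      have "(\<Sum>n<k. \<integral>x. norm (indicator {n} (T x) * f x) \<partial>M) = (\<integral>x. (\<Sum>n<k. norm (indicator {n} (T x) * f x)) \<partial>M)"
        by (intro Bochner_Integration.integral_sum[symmetric] integrable_norm i)
      also have "\<dots> \<le> (\<integral>x. norm (f x) \<partial>M)"
      \<comment> \<open>At each point at most one term of the sum is nonzero, namely the one with
        index \<open>T x\<close>.\<close>
      proof (intro integral_mono Bochner_Integration.integrable_sum integrable_norm i f)
        fix x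
        have "(\<Sum>n<k. norm (indicator {n} (T x) * f x)) = (\<Sum>n\<in>{..<k} \<inter> {T x}. \<bar>f x\<bar>)"
          by (intro sum.mono_neutral_cong_right) (auto simp: indicator_def)
        also have "\<dots> \<le> norm (f x)" by (cases "T x < k") auto
        finally show "(\<Sum>n<k. norm (indicator {n} (T x) * f x)) \<le> norm (f x)" .
      qed
      finally show "(\<Sum>n<k. \<integral>x. norm (indicator {n} (T x) * f x) \<partial>M) \<le> (\<integral>x. norm (f x) \<partial>M)" .
    qed simp
  qed
  moreover have "(\<Sum>n. indicator {n} (T x) * f x) = f x" for x
  proof -
    have "(\<Sum>n. indicator {n} (T x) * f x) = (\<Sum>n\<in>{T x}. indicator {n} (T x) * f x)"
      by (rule suminf_finite) auto
    then show ?thesis by simp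
  qed
  ultimately show ?thesis by simp
qed

text \<open>Extraction is iterated by dependent choice. \<open>R k\<close> is what is left of the
  line after \<open>k\<close> steps; the invariant \<open>P\<close> keeps the atoms from index
  \<open>k\<close> on below the part of \<open>N\<close> on \<open>R k\<close> in convex order, so
  that \<open>atom_extraction\<close> applies to \<open>N\<close> restricted to \<open>R k\<close>.
  The pieces are successive differences of the \<open>R k\<close>, hence disjoint.\<close>

lemma barycentric_partition:
  fixes N :: "real measure" and Q :: "real \<Rightarrow> real" and p y :: "nat \<Rightarrow> real"
  assumes fin: "finite_measure N" and sN: "sets N = sets borel"
    and atomless: "\<And>x. measure N {x} = 0"
    and supp: "measure N (- {l..h}) = 0" and lh: "l \<le> h"
    and Q: "mono Q" and Qb: "\<And>u. \<bar>Q u\<bar> \<le> C"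
    and p: "\<And>n. 0 \<le> p n" and ps: "summable p" and yb: "\<And>n. \<bar>y n\<bar> \<le> C"
    and ord: "\<And>\<phi>. convex_on UNIV \<phi> \<Longrightarrow> (\<Sum>n. p n * \<phi> (y n)) \<le> (\<integral>u. \<phi> (Q u) \<partial>N)"
  shows "\<exists>E. (\<forall>n. E n \<in> sets borel) \<and> disjoint_family E \<and> (\<forall>n. measure N (E n) = p n) \<and>
    (\<forall>n. (\<integral>u. indicator (E n) u * Q u \<partial>N) = p n * y n)"
proof -
  interpret finite_measure N by fact
  have spN[simp]: "space N = UNIV" using sets_eq_imp_space_eq[OF sN] by simp
  note sN[measurable_cong]
  have Qm[measurable]: "Q \<in> borel_measurable borel" by (rule borel_measurable_mono[OF Q])
  have QmN[measurable]: "Q \<in> borel_measurable N" by simp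
  have cvm: "\<phi> \<in> borel_measurable borel" if "convex_on UNIV \<phi>" for \<phi> :: "real \<Rightarrow> real"
    by (rule borel_measurable_continuous_onI[OF convex_on_UNIV_continuous[OF that]])
  have smb: "summable (\<lambda>n. p (n + k) * \<phi> (y (n + k)))" if cv: "convex_on UNIV \<phi>" for \<phi> k
  proof -
    obtain B where B: "\<And>x. \<bar>x\<bar> \<le> C \<Longrightarrow> \<bar>\<phi> x\<bar> \<le> B"
      using convex_on_UNIV_bounded_interval[OF cv, of C] by blast
    have "summable (\<lambda>n. p n * \<phi> (y n))"
    proof (rule summable_comparison_test'[of "\<lambda>n. B * p n" 0])
      show "summable (\<lambda>n. B * p n)" by (intro summable_mult ps)
      fix n
      have "\<bar>\<phi> (y n)\<bar> * p n \<le> B * p n" using B[OF yb] p by (intro mult_right_mono)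
      then show "norm (p n * \<phi> (y n)) \<le> B * p n" using p[of n] by (simp add: abs_mult mult.commute)
    qed
    then show ?thesis by (rule summable_ignore_initial_segment)
  qed
  define P where "P k R \<longleftrightarrow> R \<in> sets borel \<and> (\<forall>\<phi>. convex_on UNIV \<phi> \<longrightarrow>
      (\<Sum>n. p (n + k) * \<phi> (y (n + k))) \<le> (\<integral>u. indicator R u * \<phi> (Q u) \<partial>N))" for k and R :: "real set"
  define S where "S k R R' \<longleftrightarrow> R' \<subseteq> R \<and> measure N (R - R') = p k \<and>
      (\<integral>u. indicator (R - R') u * Q u \<partial>N) = p k * y k" for k and R R' :: "real set"
  have "\<exists>R. \<forall>k. P k (R k) \<and> S k (R k) (R (Suc k))"
  proof (rule dependent_nat_choice)
    show "\<exists>R. P 0 R" using ord by (intro exI[of _ UNIV]) (auto simp: P_def)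
    fix R k assume PR: "P k R"
    then have R[measurable]: "R \<in> sets borel" by (simp add: P_def)
    define N' where "N' = density N (indicator R)"
    define r where "r \<phi> = (\<Sum>n. p (n + Suc k) * \<phi> (y (n + Suc k)))" for \<phi>
    have RN: "R \<in> sets N" using R sN by simp
    have mN': "measure N' A = measure N (R \<inter> A)" if "A \<in> sets borel" for A
      unfolding N'_def using measure_restricted[OF RN, of A] that sN by simp
    have N'_eq: "N' = density N (\<lambda>u. ennreal (indicator R u))"
      unfolding N'_def by (intro arg_cong[where f = "density N"]) (simp add: fun_eq_iff ennreal_indicator)
    have iN': "(\<integral>u. f u \<partial>N') = (\<integral>u. indicator R u * f u \<partial>N)" if [measurable]: "f \<in> borel_measurable borel" for f :: "real \<Rightarrow> real"
      unfolding N'_eq by (subst integral_density) auto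
    have zero: "measure N (R \<inter> A) = 0" if "A \<in> sets borel" "measure N A = 0" for A
    proof -
      have "measure N (R \<inter> A) \<le> measure N A" using that sN by (intro finite_measure_mono) auto
      then show ?thesis using that by (simp add: measure_le_0_iff)
    qed
    have split0: "(\<Sum>n. p (n + k) * \<phi> (y (n + k))) = p k * \<phi> (y k) + r \<phi>" if "convex_on UNIV \<phi>" for \<phi>
      unfolding r_def using suminf_split_head[OF smb[OF that, of k]] by simp
    have "\<exists>E\<in>sets borel. measure N' E = p k \<and> (\<integral>u. indicator E u * Q u \<partial>N') = p k * y k \<and>
      (\<forall>\<phi>. convex_on UNIV \<phi> \<longrightarrow> r \<phi> \<le> (\<integral>u. indicator (- E) u * \<phi> (Q u) \<partial>N'))"
    proof (rule atom_extraction[where l = l and h = h and C = C])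
      show "finite_measure N'" unfolding N'_def by (rule finite_measure_restricted[OF RN])
      show "sets N' = sets borel" by (simp add: N'_def sN)
      show "measure N' {x} = 0" for x using mN'[of "{x}"] zero[of "{x}"] atomless by simp
      show "measure N' (- {l..h}) = 0" using mN'[of "- {l..h}"] zero[of "- {l..h}"] supp by simp
      show "0 \<le> r \<phi>" if "convex_on UNIV \<phi>" "\<And>x. 0 \<le> \<phi> x" for \<phi>
        unfolding r_def using p that by (intro suminf_nonneg smb) auto
      show "r \<phi> \<le> r \<psi>" if "convex_on UNIV \<phi>" "convex_on UNIV \<psi>" "\<And>x. \<phi> x \<le> \<psi> x" for \<phi> \<psi>
        unfolding r_def using p that by (intro suminf_le smb mult_left_mono)
      show "p k * \<phi> (y k) + r \<phi> \<le> (\<integral>u. \<phi> (Q u) \<partial>N')" if "convex_on UNIV \<phi>" for \<phi>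
        using PR that cvm[OF that] by (subst iN') (auto simp: P_def split0)
    qed (use lh Q Qb p in auto)
    then obtain E where E[measurable]: "E \<in> sets borel" and mE: "measure N' E = p k"
      and iE: "(\<integral>u. indicator E u * Q u \<partial>N') = p k * y k"
      and rE: "\<And>\<phi>. convex_on UNIV \<phi> \<Longrightarrow> r \<phi> \<le> (\<integral>u. indicator (- E) u * \<phi> (Q u) \<partial>N')"
      by blast
    have RE: "R - (R - E) = R \<inter> E" by auto
    have "P (Suc k) (R - E)"
      unfolding P_def
    proof (intro conjI allI impI)
      fix \<phi> :: "real \<Rightarrow> real" assume cv: "convex_on UNIV \<phi>"
      have [measurable]: "\<phi> \<in> borel_measurable borel" by (rule cvm[OF cv])
      have "r \<phi> \<le> (\<integral>u. indicator R u * (indicator (- E) u * \<phi> (Q u)) \<partial>N)"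
        using rE[OF cv] by (subst (asm) iN') auto
      also have "\<dots> = (\<integral>u. indicator (R - E) u * \<phi> (Q u) \<partial>N)"
        by (intro lebesgue_cong) (auto simp: indicator_def)
      finally show "(\<Sum>n. p (n + Suc k) * \<phi> (y (n + Suc k))) \<le> (\<integral>u. indicator (R - E) u * \<phi> (Q u) \<partial>N)"
        by (simp add: r_def)
    qed simp
    moreover have "S k R (R - E)"
      unfolding S_def RE
    proof (intro conjI)
      show "measure N (R \<inter> E) = p k" using mE mN'[OF E] by simp
      have "(\<integral>u. indicator (R \<inter> E) u * Q u \<partial>N) = (\<integral>u. indicator R u * (indicator E u * Q u) \<partial>N)"
        by (intro lebesgue_cong) (auto simp: indicator_def)
      also have "\<dots> = p k * y k" using iE by (subst (asm) iN') auto
      finally show "(\<integral>u. indicator (R \<inter> E) u * Q u \<partial>N) = p k * y k" .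
    qed auto
    ultimately show "\<exists>R'. P (Suc k) R' \<and> S k R R'" by blast
  qed
  then obtain R where PR: "\<And>k. P k (R k)" and SR: "\<And>k. S k (R k) (R (Suc k))" by blast
  have sub: "R m \<subseteq> R n" if "n \<le> m" for n m
    using that by (induction rule: dec_induct) (use SR S_def in blast)+
  show ?thesis
  proof (intro exI[of _ "\<lambda>k. R k - R (Suc k)"] conjI allI)
    show "R n - R (Suc n) \<in> sets borel" for n using PR[of n] PR[of "Suc n"] unfolding P_def by blast
    show "measure N (R n - R (Suc n)) = p n"
      "(\<integral>u. indicator (R n - R (Suc n)) u * Q u \<partial>N) = p n * y n" for n
      using SR[of n] by (auto simp: S_def)
    have "(R m - R (Suc m)) \<inter> (R n - R (Suc n)) = {}" if "m < n" for m n
      using sub[of "Suc m" n] that by auto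
    then show "disjoint_family (\<lambda>k. R k - R (Suc k))"
      unfolding disjoint_family_on_def by (metis Int_commute linorder_neqE_nat)
  qed
qed

text \<open>The atomic case of Strassen's theorem on convex order.\<close>

proposition atomic_conditional_mean:
  fixes N :: "real measure" and Q :: "real \<Rightarrow> real" and y :: "nat \<Rightarrow> real" and \<xi> :: "'j \<Rightarrow> nat"
  assumes fin: "finite_measure N" and sN: "sets N = sets borel"
    and atomless: "\<And>x. measure N {x} = 0"
    and supp: "measure N (- {l..h}) = 0" and lh: "l \<le> h"
    and Q: "mono Q" and Qb: "\<And>u. \<bar>Q u\<bar> \<le> C"
    and J: "finite_measure J" and \<xi>[measurable]: "\<xi> \<in> measurable J (count_space UNIV)"
    and yb: "\<And>n. \<bar>y n\<bar> \<le> C"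
    and ord: "\<And>\<phi>. convex_on UNIV \<phi> \<Longrightarrow> (\<integral>\<omega>. \<phi> (y (\<xi> \<omega>)) \<partial>J) \<le> (\<integral>u. \<phi> (Q u) \<partial>N)"
  shows "\<exists>T\<in>measurable borel (count_space UNIV).
    distr N (count_space UNIV) T = distr J (count_space UNIV) \<xi> \<and>
    (\<forall>g B. (\<forall>n::nat. \<bar>g n\<bar> \<le> B) \<longrightarrow> (\<integral>u. g (T u) * (Q u - y (T u)) \<partial>N) = 0)"
proof -
  interpret N: finite_measure N by fact
  interpret J: finite_measure J by fact
  have spN[simp]: "space N = UNIV" using sets_eq_imp_space_eq[OF sN] by simp
  note sN[measurable_cong]
  have Qm[measurable]: "Q \<in> borel_measurable borel" by (rule borel_measurable_mono[OF Q])
  define p where "p n = measure J (\<xi> -` {n} \<inter> space J)" for n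
  have pg: "(\<lambda>n. p n * g n) sums (\<integral>\<omega>. g (\<xi> \<omega>) \<partial>J)" if g: "\<And>n. \<bar>g n\<bar> \<le> B" for g B
  proof -
    have "(\<lambda>n. \<integral>\<omega>. indicator {n} (\<xi> \<omega>) * g (\<xi> \<omega>) \<partial>J) sums (\<integral>\<omega>. g (\<xi> \<omega>) \<partial>J)"
      by (rule sums_integral_nat_fibres[OF J.integrable_const_bound[of _ B]]) (use g in auto)
    moreover have "(\<integral>\<omega>. indicator {n} (\<xi> \<omega>) * g (\<xi> \<omega>) \<partial>J) = p n * g n" for n
    proof -
      have "(\<integral>\<omega>. indicator {n} (\<xi> \<omega>) * g (\<xi> \<omega>) \<partial>J) = (\<integral>\<omega>. indicator (\<xi> -` {n} \<inter> space J) \<omega> * g n \<partial>J)"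
        by (intro lebesgue_cong) (auto simp: indicator_def)
      then show ?thesis by (simp add: p_def)
    qed
    ultimately show ?thesis by simp
  qed
  have p0: "0 \<le> p n" for n by (simp add: p_def)
  have ps: "p sums measure J (space J)" using pg[of "\<lambda>_. 1" 1] by simp
  have ord': "(\<Sum>n. p n * \<phi> (y n)) \<le> (\<integral>u. \<phi> (Q u) \<partial>N)" if cv: "convex_on UNIV \<phi>" for \<phi>
  proof -
    obtain B where B: "\<And>x. \<bar>x\<bar> \<le> C \<Longrightarrow> \<bar>\<phi> x\<bar> \<le> B"
      using convex_on_UNIV_bounded_interval[OF cv, of C] by blast
    show ?thesis using sums_unique[OF pg[of "\<lambda>n. \<phi> (y n)" B]] B yb ord[OF cv] by simp
  qed
  \<comment> \<open>The constants 1 and -1 are both convex, so the total masses agree. Consequently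
    the pieces exhaust \<open>N\<close> up to a null set.\<close>
  have mass: "measure J (space J) = measure N UNIV"
    using ord[OF convex_on_affine_real[of 0 1]] ord[OF convex_on_affine_real[of 0 "-1"]] by simp
  obtain E where E[measurable]: "\<And>n. E n \<in> sets borel" and disj: "disjoint_family E"
    and mE: "\<And>n. measure N (E n) = p n" and iE: "\<And>n. (\<integral>u. indicator (E n) u * Q u \<partial>N) = p n * y n"
    using barycentric_partition[OF fin sN atomless supp lh Q Qb p0 sums_summable[OF ps] yb ord'] by blast
  have "measure N (\<Union>n. E n) = (\<Sum>n. p n)"
    using N.finite_measure_UNION[of E] disj E sN mE by (simp add: sums_iff image_subset_iff)
  then have mU: "measure N (\<Union>n. E n) = measure N UNIV"
    using ps mass by (simp add: sums_iff)
  have null: "- (\<Union>n. E n) \<in> null_sets N"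
  proof -
    have "measure N (- (\<Union>n. E n)) = measure N UNIV - measure N (\<Union>n. E n)"
      using N.finite_measure_compl[of "\<Union>n. E n"] sN by (simp add: Compl_eq_Diff_UNIV)
    then show ?thesis using mU sN by (auto simp: null_sets_def N.emeasure_eq_measure)
  qed
  have AEU: "AE u in N. u \<in> (\<Union>n. E n)"
    using AE_not_in[OF null] by simp
  \<comment> \<open>\<open>T\<close> is the index of the piece that contains \<open>u\<close>. The
    default 0 is taken on a null set only.\<close>
  define T where "T u = (if u \<in> (\<Union>n. E n) then (THE n. u \<in> E n) else 0)" for u
  have T_eq: "T u = n" if "u \<in> E n" for u n
  proof -
    have "(THE n. u \<in> E n) = n"
      using that disj by (intro the_equality) (auto simp: disjoint_family_on_def)
    then show ?thesis using that by (auto simp: T_def)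
  qed
  have T_iff: "T u = n \<longleftrightarrow> u \<in> E n" if "u \<in> (\<Union>n. E n)" for u n
    using that T_eq by auto
  have T[measurable]: "T \<in> measurable borel (count_space UNIV)"
  proof (subst measurable_count_space_eq2_countable, intro conjI ballI)
    fix n
    have "T -` {n} \<inter> space borel = E n \<union> (if n = 0 then - (\<Union>n. E n) else {})"
      using T_eq by (auto simp: T_def split: if_splits) (metis T_eq)+
    then show "T -` {n} \<inter> space borel \<in> sets borel" by simp
  qed simp
  have TN[measurable]: "T \<in> measurable N (count_space UNIV)" by simp
  have mT: "measure N (T -` {n}) = p n" for n
  proof -
    have "measure N (T -` {n}) = measure N (E n)"
    proof (rule measure_eq_AE)
      show "AE u in N. u \<in> T -` {n} \<longleftrightarrow> u \<in> E n" using AEU by eventually_elim (use T_iff in auto)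
      show "T -` {n} \<in> sets N" using measurable_sets[OF TN, of "{n}"] by simp
    qed (use E sN in auto)
    then show ?thesis using mE by simp
  qed
  have d: "distr N (count_space UNIV) T = distr J (count_space UNIV) \<xi>"
  proof (rule measure_eqI_countable[of _ UNIV])
    fix n
    show "emeasure (distr N (count_space UNIV) T) {n} = emeasure (distr J (count_space UNIV) \<xi>) {n}"
      using mT[of n] by (simp add: emeasure_distr N.emeasure_eq_measure J.emeasure_eq_measure p_def)
  qed auto
  have "(\<integral>u. g (T u) * (Q u - y (T u)) \<partial>N) = 0" if g: "\<And>n. \<bar>g n\<bar> \<le> B" for g :: "nat \<Rightarrow> real" and B
  proof -
    let ?f = "\<lambda>u. g (T u) * (Q u - y (T u))"
    have [measurable]: "(\<lambda>u. k (T u)) \<in> borel_measurable N" for k :: "nat \<Rightarrow> real"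
      by (rule measurable_compose[OF TN]) simp
    have f: "integrable N ?f"
    proof (intro N.integrable_const_bound[of _ "B * (2 * C)"] AE_I2)
      fix u
      have "0 \<le> B" using g[of 0] by simp
      moreover have "\<bar>Q u - y (T u)\<bar> \<le> 2 * C" using Qb[of u] yb[of "T u"] by linarith
      ultimately show "norm (?f u) \<le> B * (2 * C)"
        using g by (auto simp: abs_mult intro!: mult_mono)
    qed simp
    have "(\<integral>u. indicator {n} (T u) * ?f u \<partial>N) = 0" for n
    proof -
      have "(\<integral>u. indicator {n} (T u) * ?f u \<partial>N) = (\<integral>u. g n * (indicator (E n) u * Q u - y n * indicator (E n) u) \<partial>N)"
      proof (rule integral_cong_AE)
        show "AE u in N. indicator {n} (T u) * ?f u = g n * (indicator (E n) u * Q u - y n * indicator (E n) u)"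
          using AEU by eventually_elim (use T_iff T_eq in \<open>auto simp: indicator_def algebra_simps\<close>)
      qed measurable
      also have "\<dots> = g n * (p n * y n - y n * p n)"
      proof -
        have "integrable N (\<lambda>u. indicator (E n) u * Q u)"
          by (intro N.integrable_const_bound[of _ C]) (use Qb Qb[of 0, THEN order_trans[OF abs_ge_zero]] in \<open>auto simp: indicator_def\<close>)
        moreover have "integrable N (indicator (E n) :: real \<Rightarrow> real)"
          using E sN by (intro integrable_real_indicator) (auto simp: N.emeasure_eq_measure)
        ultimately show ?thesis using iE mE by simp
      qed
      finally show ?thesis by simp
    qed
    then show ?thesis using sums_integral_nat_fibres[OF f TN] by (simp add: sums_iff)
  qed
  then show ?thesis using T d by blast
qed

section \<open>Minimizers of linear functionals over densities\<close>

lemma exp_midpoint_gap: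
  fixes a b :: real
  shows "(exp (- (a / 2)) - exp (- (b / 2)))\<^sup>2 = exp (- a) + exp (- b) - 2 * exp (- ((a + b) / 2))"
proof -
  have "exp (- (t / 2)) ^ 2 = exp (- t)" for t :: real
    by (simp add: power2_eq_square mult_exp_exp)
  moreover have "exp (- (a / 2)) * exp (- (b / 2)) = exp (- ((a + b) / 2))"
    by (simp add: mult_exp_exp add_divide_distrib)
  ultimately show ?thesis
    by (simp add: power2_diff)
qed

text \<open>A selection principle of Komlos type. The infima \<open>I n\<close> of the strictly
  convex functional \<open>J\<close> over decreasing sets increase and are bounded. Two
  near-minimizers taken from \<open>D n\<close> have their midpoint in \<open>D n\<close>, so
  \<open>exp_midpoint_gap\<close> bounds their distance by the increments of \<open>I\<close> and an
  error tending to zero.\<close>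

lemma convex_nested_selection:
  fixes D :: "nat \<Rightarrow> ('a \<Rightarrow> real) set"
  assumes fin: "finite_measure \<kappa>"
    and dec: "\<And>n. D (Suc n) \<subseteq> D n" and ne: "\<And>n. D n \<noteq> {}"
    and meas: "\<And>n f. f \<in> D n \<Longrightarrow> f \<in> borel_measurable \<kappa>"
    and nn: "\<And>n f x. f \<in> D n \<Longrightarrow> 0 \<le> f x"
    and mid: "\<And>n f g. f \<in> D n \<Longrightarrow> g \<in> D n \<Longrightarrow> (\<lambda>x. (f x + g x) / 2) \<in> D n"
  shows "\<exists>f. (\<forall>n. f n \<in> D n) \<and> (AE x in \<kappa>. Cauchy (\<lambda>n. exp (- (f n x / 2))))"
proof -
  interpret finite_measure \<kappa> by fact
  define J where "J f = (\<integral>x. exp (- f x) \<partial>\<kappa>)" for f :: "'a \<Rightarrow> real"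
  define I where "I n = Inf (J ` D n)" for n
  have sub: "D m \<subseteq> D n" if "n \<le> m" for n m
    using that by (induction rule: dec_induct) (use dec in auto)
  have int_exp: "integrable \<kappa> (\<lambda>x. exp (- (f x / t)))" if "f \<in> D n" "t > 0" for f n t
    using meas[OF that(1)] nn[OF that(1)] that(2)
    by (intro integrable_const_bound[of _ 1]) auto
  have int1: "integrable \<kappa> (\<lambda>x. exp (- f x))" if "f \<in> D n" for f n
    using int_exp[OF that, of 1] by simp
  have J0: "0 \<le> J f" for f
    unfolding J_def by (intro integral_nonneg_AE) auto
  have bdd: "bdd_below (J ` D n)" for n
    using J0 by (intro bdd_belowI[of _ 0]) auto
  have J1: "J f \<le> measure \<kappa> (space \<kappa>)" if "f \<in> D n" for f n
  proof -
    have "J f \<le> (\<integral>x. 1 \<partial>\<kappa>)"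
      unfolding J_def by (intro integral_mono int1[OF that]) (use nn[OF that] in auto)
    then show ?thesis by simp
  qed
  have I_le: "I n \<le> J f" if "f \<in> D n" for n f
    unfolding I_def using that bdd by (intro cInf_lower) auto
  have I_inc: "I n \<le> I m" if "n \<le> m" for n m
    unfolding I_def using sub[OF that] ne bdd by (intro cInf_superset_mono) auto
  have I_bd: "I n \<le> measure \<kappa> (space \<kappa>)" for n
  proof -
    obtain f where "f \<in> D n" using ne by blast
    then show ?thesis using I_le J1 order_trans by blast
  qed
  have "\<exists>f. f \<in> D n \<and> J f < I n + 1 / Suc n" for n
  proof -
    have "Inf (J ` D n) < I n + 1 / Suc n" unfolding I_def by simp
    then obtain y where "y \<in> J ` D n" "y < I n + 1 / Suc n"
      using cInf_lessD[of "J ` D n"] ne by (metis image_is_empty)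
    then show ?thesis by blast
  qed
  then obtain f where f: "\<And>n. f n \<in> D n" and Jf: "\<And>n. J (f n) < I n + 1 / Suc n" by metis
  define u where "u n x = exp (- (f n x / 2))" for n x
  have u_meas[measurable]: "u n \<in> borel_measurable \<kappa>" for n
    unfolding u_def using meas[OF f[of n]] by simp
  have u_int: "integrable \<kappa> (u n)" for n
    unfolding u_def using int_exp[OF f, of 2] by simp
  have u01: "0 \<le> u n x" "u n x \<le> 1" for n x
    unfolding u_def using nn[OF f] by auto
  have usq_int: "integrable \<kappa> (\<lambda>x. (u n x - u m x)\<^sup>2)" for n m
  proof (intro integrable_const_bound[of _ 1])
    show "AE x in \<kappa>. norm ((u n x - u m x)\<^sup>2) \<le> 1"
    proof (rule AE_I2)
      fix x
      have "\<bar>u n x - u m x\<bar> \<le> 1" using u01[of n x] u01[of m x] by linarith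
      then show "norm ((u n x - u m x)\<^sup>2) \<le> 1" by (simp add: abs_square_le_1)
    qed
  qed simp
  have gap: "(\<integral>x. (u n x - u m x)\<^sup>2 \<partial>\<kappa>) \<le> I m - I n + 2 / Suc n" if "n \<le> m" for n m
  proof -
    \<comment> \<open>The comparison takes place in the larger set \<open>D n\<close>: there the
      midpoint costs at least \<open>I n\<close>, while the later function costs at most slightly
      more than \<open>I m\<close>.\<close>
    have fm: "f m \<in> D n" using f sub[OF that] by auto
    have md: "(\<lambda>x. (f n x + f m x) / 2) \<in> D n" by (rule mid[OF f fm])
    have "(\<integral>x. (u n x - u m x)\<^sup>2 \<partial>\<kappa>)
        = (\<integral>x. exp (- f n x) + exp (- f m x) - 2 * exp (- ((f n x + f m x) / 2)) \<partial>\<kappa>)"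
      unfolding u_def by (simp add: exp_midpoint_gap)
    also have "\<dots> = J (f n) + J (f m) - 2 * J (\<lambda>x. (f n x + f m x) / 2)"
      unfolding J_def using int1[OF f] int1[OF md] by simp
    also have "\<dots> \<le> J (f n) + J (f m) - 2 * I n"
      using I_le[OF md] by simp
    also have "\<dots> \<le> I m - I n + 1 / Suc n + 1 / Suc m"
      using Jf[of n] Jf[of m] by simp
    also have "\<dots> \<le> I m - I n + 2 / Suc n"
    proof -
      have "1 / real (Suc m) \<le> 1 / real (Suc n)" using that by (simp add: frac_le)
      then show ?thesis by simp
    qed
    finally show ?thesis .
  qed
  have "incseq I" using I_inc by (simp add: incseq_def)
  then obtain L where L: "I \<longlonglongrightarrow> L" "\<And>n. I n \<le> L"
    using incseq_convergent[of I "measure \<kappa> (space \<kappa>)"] I_bd by metis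
  have "(\<lambda>n. L - I n + 2 / real (Suc n)) \<longlonglongrightarrow> L - L + 0"
    by (intro tendsto_intros L(1)) real_asymp
  then have lim0: "(\<lambda>n. L - I n + 2 / real (Suc n)) \<longlonglongrightarrow> 0" by simp
  define c where "c = measure \<kappa> (space \<kappa>)"
  have c0: "0 \<le> c" unfolding c_def by simp
  have L1c: "\<exists>N. \<forall>i\<ge>N. \<forall>j\<ge>N. (\<integral>x. norm (u i x - u j x) \<partial>\<kappa>) < e" if e: "e > 0" for e
  proof -
    \<comment> \<open>The mean-square bound is turned into an L1 bound by t <= \<eta>/2 +
      t^2/(2\<eta>). With a mean square of at most \<open>\<eta> * e\<close> the second term
      contributes at most e/2, and the first contributes less than e/2 because
      \<open>\<eta> * c < e\<close>. The 1 in the denominator covers total mass zero.\<close>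
    define \<eta> where "\<eta> = e / (c + 1)"
    have eta: "\<eta> > 0" unfolding \<eta>_def using e c0 by simp
    have "eventually (\<lambda>n. L - I n + 2 / real (Suc n) < \<eta> * e) sequentially"
      using order_tendstoD(2)[OF lim0, of "\<eta> * e"] eta e by simp
    then obtain N where N: "\<And>n. n \<ge> N \<Longrightarrow> L - I n + 2 / real (Suc n) < \<eta> * e"
      by (auto simp: eventually_sequentially)
    have main: "(\<integral>x. norm (u i x - u j x) \<partial>\<kappa>) < e" if "i \<ge> N" "i \<le> j" for i j
    proof -
      have pt: "norm (u i x - u j x) \<le> \<eta> / 2 + (u i x - u j x)\<^sup>2 / (2 * \<eta>)" for x
      proof -
        define t where "t = \<bar>u i x - u j x\<bar>"
        have "0 \<le> (t - \<eta>)\<^sup>2" by simp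
        then have "2 * \<eta> * t \<le> \<eta>\<^sup>2 + t\<^sup>2" by (simp add: power2_diff algebra_simps)
        then have "t \<le> \<eta> / 2 + t\<^sup>2 / (2 * \<eta>)"
          using eta by (simp add: field_simps power2_eq_square)
        then show ?thesis by (simp add: t_def)
      qed
      have "(\<integral>x. norm (u i x - u j x) \<partial>\<kappa>) \<le> (\<integral>x. \<eta> / 2 + (u i x - u j x)\<^sup>2 / (2 * \<eta>) \<partial>\<kappa>)"
        by (intro integral_mono pt) (use u_int usq_int in auto)
      also have "\<dots> = \<eta> / 2 * c + (\<integral>x. (u i x - u j x)\<^sup>2 \<partial>\<kappa>) / (2 * \<eta>)"
        using usq_int by (simp add: c_def mult.commute)
      also have "\<dots> \<le> \<eta> / 2 * c + (\<eta> * e) / (2 * \<eta>)"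
      proof -
        have "(\<integral>x. (u i x - u j x)\<^sup>2 \<partial>\<kappa>) \<le> \<eta> * e"
          using gap[OF that(2)] N[OF that(1)] L(2)[of j] by linarith
        then show ?thesis using eta by (intro add_left_mono divide_right_mono) auto
      qed
      also have "\<dots> = \<eta> / 2 * c + e / 2" using eta by simp
      also have "\<dots> < e"
        unfolding \<eta>_def using e c0 by (simp add: field_simps)
      finally show ?thesis .
    qed
    show ?thesis
    proof (intro exI[of _ N] allI impI)
      fix i j assume ij: "N \<le> i" "N \<le> j"
      show "(\<integral>x. norm (u i x - u j x) \<partial>\<kappa>) < e"
      proof (cases "i \<le> j")
        case True then show ?thesis using main ij by simp
      next
        case False
        then have "(\<integral>x. norm (u j x - u i x) \<partial>\<kappa>) < e" using main ij by simp
        then show ?thesis by (simp only: norm_minus_commute)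
      qed
    qed
  qed
  obtain r where r: "strict_mono r" "AE x in \<kappa>. Cauchy (\<lambda>i. u (r i) x)"
    using cauchy_L1_AE_cauchy_subseq[of \<kappa> u] u_int L1c by auto
  \<comment> \<open>Passing to a subsequence is harmless, since \<open>r n\<close> is at least
    \<open>n\<close> and the sets decrease.\<close>
  have "f (r n) \<in> D n" for n
    using f[of "r n"] sub[of n "r n"] seq_suble[OF r(1), of n] by auto
  then show ?thesis
    using r(2) by (intro exI[of _ "\<lambda>n. f (r n)"]) (simp add: u_def)
qed

text \<open>Vitali's theorem. Fatou's lemma carries integrability and the uniform bound on small
  sets over to the limit \<open>G\<close>. Dominated convergence of
  \<open>min 1 \<bar>g n x - G x\<bar>\<close> makes the set where \<open>g n\<close> and
  \<open>G\<close> differ noticeably small, and on it both functions have small integral.\<close>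

lemma vitali_convergence_L1:
  fixes g :: "nat \<Rightarrow> 'a \<Rightarrow> real"
  assumes fin: "finite_measure \<kappa>"
    and int: "\<And>n. integrable \<kappa> (g n)" and nn: "\<And>n x. 0 \<le> g n x"
    and bd: "\<And>n. (\<integral>x. g n x \<partial>\<kappa>) \<le> b"
    and G[measurable]: "G \<in> borel_measurable \<kappa>" and lim: "AE x in \<kappa>. (\<lambda>n. g n x) \<longlonglongrightarrow> G x"
    and ui: "\<And>\<epsilon>. \<epsilon> > 0 \<Longrightarrow> \<exists>\<delta>>0. \<forall>n. \<forall>S\<in>sets \<kappa>. measure \<kappa> S < \<delta> \<longrightarrow>
      (\<integral>x. indicator S x * g n x \<partial>\<kappa>) \<le> \<epsilon>"
  shows "integrable \<kappa> G" and "(\<lambda>n. \<integral>x. \<bar>g n x - G x\<bar> \<partial>\<kappa>) \<longlonglongrightarrow> 0"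
proof -
  interpret finite_measure \<kappa> by fact
  have gm[measurable]: "g n \<in> borel_measurable \<kappa>" for n using int by auto
  have Gnn: "AE x in \<kappa>. 0 \<le> G x"
    using lim by eventually_elim (rule LIMSEQ_le_const, use nn in auto)
  have fatou: "(\<integral>\<^sup>+x. ennreal (indicator S x * G x) \<partial>\<kappa>) \<le> ennreal B"
    if S[measurable]: "S \<in> sets \<kappa>" and B: "\<And>n. (\<integral>x. indicator S x * g n x \<partial>\<kappa>) \<le> B" for S B
  proof -
    have i: "integrable \<kappa> (\<lambda>x. indicator S x * g n x)" for n
      using integrable_mult_indicator[OF S int[of n]] by simp
    have "(\<integral>\<^sup>+x. ennreal (indicator S x * G x) \<partial>\<kappa>)
        = (\<integral>\<^sup>+x. liminf (\<lambda>n. ennreal (indicator S x * g n x)) \<partial>\<kappa>)"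
    proof (rule nn_integral_cong_AE, use lim in eventually_elim)
      fix x assume "(\<lambda>n. g n x) \<longlonglongrightarrow> G x"
      then have "(\<lambda>n. ennreal (indicator S x * g n x)) \<longlonglongrightarrow> ennreal (indicator S x * G x)"
        by (intro tendsto_intros)
      then show "ennreal (indicator S x * G x) = liminf (\<lambda>n. ennreal (indicator S x * g n x))"
        by (metis lim_imp_Liminf sequentially_bot)
    qed
    also have "\<dots> \<le> liminf (\<lambda>n. \<integral>\<^sup>+x. ennreal (indicator S x * g n x) \<partial>\<kappa>)"
      by (intro nn_integral_liminf) simp
    also have "\<dots> \<le> ennreal B"
    proof (rule order_trans[OF Liminf_le_Limsup])
      show "limsup (\<lambda>n. \<integral>\<^sup>+x. ennreal (indicator S x * g n x) \<partial>\<kappa>) \<le> ennreal B"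
      proof (intro Limsup_bounded always_eventually allI)
        fix n
        have "(\<integral>\<^sup>+x. ennreal (indicator S x * g n x) \<partial>\<kappa>) = ennreal (\<integral>x. indicator S x * g n x \<partial>\<kappa>)"
          by (intro nn_integral_eq_integral i) (use nn in auto)
        then show "(\<integral>\<^sup>+x. ennreal (indicator S x * g n x) \<partial>\<kappa>) \<le> ennreal B"
          using B[of n] by (simp add: ennreal_leI)
      qed
    qed simp
    finally show ?thesis .
  qed
  have "(\<integral>\<^sup>+x. ennreal (indicator (space \<kappa>) x * G x) \<partial>\<kappa>) \<le> ennreal b"
  proof (rule fatou)
    fix n
    have "(\<integral>x. indicator (space \<kappa>) x * g n x \<partial>\<kappa>) = (\<integral>x. g n x \<partial>\<kappa>)"
      by (intro lebesgue_cong) auto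
    then show "(\<integral>x. indicator (space \<kappa>) x * g n x \<partial>\<kappa>) \<le> b" using bd by simp
  qed simp
  also have "(\<integral>\<^sup>+x. ennreal (indicator (space \<kappa>) x * G x) \<partial>\<kappa>) = (\<integral>\<^sup>+x. ennreal (G x) \<partial>\<kappa>)"
    by (intro nn_integral_cong) auto
  finally have "(\<integral>\<^sup>+x. ennreal (G x) \<partial>\<kappa>) < \<infinity>" by (simp add: le_less_trans)
  then show Gi: "integrable \<kappa> G"
    using Gnn by (intro integrableI_nonneg) auto
  have fatou': "(\<integral>x. indicator S x * G x \<partial>\<kappa>) \<le> B"
    if S: "S \<in> sets \<kappa>" and B: "\<And>n. (\<integral>x. indicator S x * g n x \<partial>\<kappa>) \<le> B" and B0: "0 \<le> B" for S B
  proof -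
    have "integrable \<kappa> (\<lambda>x. indicator S x * G x)"
      using integrable_mult_indicator[OF S Gi] by simp
    then have "ennreal (\<integral>x. indicator S x * G x \<partial>\<kappa>) = (\<integral>\<^sup>+x. ennreal (indicator S x * G x) \<partial>\<kappa>)"
      using Gnn by (intro nn_integral_eq_integral[symmetric]) auto
    also have "\<dots> \<le> ennreal B" by (rule fatou[OF S B])
    finally show ?thesis using B0 by simp
  qed
  show "(\<lambda>n. \<integral>x. \<bar>g n x - G x\<bar> \<partial>\<kappa>) \<longlonglongrightarrow> 0"
  proof (rule LIMSEQ_I)
    fix e :: real assume e: "0 < e"
    define c where "c = measure \<kappa> (space \<kappa>)"
    \<comment> \<open>The bound 1 makes Markov's inequality valid for the truncated difference. The
      other bound gives \<open>\<eta> * c \<le> e / 4\<close>; with two further quarters from the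
      exceptional set the total stays below \<open>e\<close>.\<close>
    define \<eta> where "\<eta> = min 1 (e / (4 * (c + 1)))"
    have c0: "0 \<le> c" by (simp add: c_def)
    have eta: "0 < \<eta>" "\<eta> \<le> 1" "\<eta> * c \<le> e / 4"
    proof -
      show "0 < \<eta>" "\<eta> \<le> 1" unfolding \<eta>_def using e c0 by auto
      have "\<eta> * c \<le> e / (4 * (c + 1)) * c" unfolding \<eta>_def using c0 by (intro mult_right_mono) auto
      also have "\<dots> \<le> e / 4" using e c0 by (simp add: field_simps)
      finally show "\<eta> * c \<le> e / 4" .
    qed
    obtain \<delta> where d: "\<delta> > 0" and dS: "\<And>n S. S \<in> sets \<kappa> \<Longrightarrow> measure \<kappa> S < \<delta> \<Longrightarrow>
        (\<integral>x. indicator S x * g n x \<partial>\<kappa>) \<le> e / 4"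
      using ui[of "e / 4"] e by auto
    have "(\<lambda>n. \<integral>x. min 1 \<bar>g n x - G x\<bar> \<partial>\<kappa>) \<longlonglongrightarrow> (\<integral>x. 0 \<partial>\<kappa>)"
    proof (rule integral_dominated_convergence[where w = "\<lambda>_. 1"])
      show "AE x in \<kappa>. (\<lambda>n. min 1 \<bar>g n x - G x\<bar>) \<longlonglongrightarrow> 0"
        using lim
      proof eventually_elim
        fix x assume "(\<lambda>n. g n x) \<longlonglongrightarrow> G x"
        then have "(\<lambda>n. min 1 \<bar>g n x - G x\<bar>) \<longlonglongrightarrow> min 1 \<bar>G x - G x\<bar>"
          by (intro tendsto_intros)
        then show "(\<lambda>n. min 1 \<bar>g n x - G x\<bar>) \<longlonglongrightarrow> 0" by simp
      qed
    qed auto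
    then have "eventually (\<lambda>n. (\<integral>x. min 1 \<bar>g n x - G x\<bar> \<partial>\<kappa>) < \<eta> * \<delta>) sequentially"
      using eta d by (intro order_tendstoD) auto
    then obtain N where N: "\<And>n. n \<ge> N \<Longrightarrow> (\<integral>x. min 1 \<bar>g n x - G x\<bar> \<partial>\<kappa>) < \<eta> * \<delta>"
      by (auto simp: eventually_sequentially)
    have "norm ((\<integral>x. \<bar>g n x - G x\<bar> \<partial>\<kappa>) - 0) < e" if n: "n \<ge> N" for n
    proof -
      define S where "S = {x \<in> space \<kappa>. \<eta> \<le> \<bar>g n x - G x\<bar>}"
      have S[measurable]: "S \<in> sets \<kappa>" unfolding S_def by measurable
      have "\<eta> * measure \<kappa> S = (\<integral>x. \<eta> * indicator S x \<partial>\<kappa>)"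
        by simp
      also have "\<dots> \<le> (\<integral>x. min 1 \<bar>g n x - G x\<bar> \<partial>\<kappa>)"
      proof (intro integral_mono)
        show "integrable \<kappa> (\<lambda>x. min 1 \<bar>g n x - G x\<bar>)"
          by (intro integrable_const_bound[of _ 1]) auto
        show "integrable \<kappa> (\<lambda>x. \<eta> * indicator S x)"
          by (intro integrable_const_bound[of _ \<eta>]) (use eta S in \<open>auto simp: indicator_def\<close>)
      qed (use eta in \<open>auto simp: S_def indicator_def\<close>)
      also have "\<dots> < \<eta> * \<delta>" by (rule N[OF n])
      finally have Sd: "measure \<kappa> S < \<delta>" using eta by simp
      have iS: "integrable \<kappa> (\<lambda>x. indicator S x * g m x)" "integrable \<kappa> (\<lambda>x. indicator S x * G x)" for m
        using integrable_mult_indicator[OF S int[of m]] integrable_mult_indicator[OF S Gi] by auto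
      have "(\<integral>x. \<bar>g n x - G x\<bar> \<partial>\<kappa>) \<le> (\<integral>x. \<eta> + (indicator S x * g n x + indicator S x * G x) \<partial>\<kappa>)"
      proof (intro integral_mono_AE)
        show "AE x in \<kappa>. \<bar>g n x - G x\<bar> \<le> \<eta> + (indicator S x * g n x + indicator S x * G x)"
          using Gnn AE_space
        proof eventually_elim
          case (elim x)
          then show ?case using nn[of n x] eta by (auto simp: S_def indicator_def)
        qed
      qed (use iS int Gi in auto)
      also have "\<dots> = \<eta> * c + ((\<integral>x. indicator S x * g n x \<partial>\<kappa>) + (\<integral>x. indicator S x * G x \<partial>\<kappa>))"
        using iS by (simp add: c_def mult.commute)
      also have "\<dots> \<le> e / 4 + (e / 4 + e / 4)"
        using eta(3) dS[OF S Sd] fatou'[OF S dS[OF S Sd]] e by (intro add_mono) auto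
      also have "\<dots> < e" using e by simp
      finally have "(\<integral>x. \<bar>g n x - G x\<bar> \<partial>\<kappa>) < e" .
      moreover have "0 \<le> (\<integral>x. \<bar>g n x - G x\<bar> \<partial>\<kappa>)" by simp
      ultimately show ?thesis by simp
    qed
    then show "\<exists>no. \<forall>n\<ge>no. norm ((\<integral>x. \<bar>g n x - G x\<bar> \<partial>\<kappa>) - 0) < e" by blast
  qed
qed

text \<open>The exponentials converge almost everywhere, and taking logarithms is possible unless
  the limit is 0. Limit 0 means that \<open>g n x\<close> tends to infinity, which by Fatou's lemma
  and the bound on the integrals happens on a null set only.\<close>

lemma AE_convergent_of_exp_Cauchy:
  fixes g :: "nat \<Rightarrow> 'a \<Rightarrow> real"
  assumes int: "\<And>n. integrable \<kappa> (g n)" and nn: "\<And>n x. 0 \<le> g n x"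
    and bd: "\<And>n. (\<integral>x. g n x \<partial>\<kappa>) \<le> b"
    and cau: "AE x in \<kappa>. Cauchy (\<lambda>n. exp (- (g n x / 2)))"
  shows "AE x in \<kappa>. convergent (\<lambda>n. g n x)"
proof -
  have [measurable]: "g n \<in> borel_measurable \<kappa>" for n using int by auto
  have "(\<integral>\<^sup>+x. liminf (\<lambda>n. ennreal (g n x)) \<partial>\<kappa>) \<le> liminf (\<lambda>n. \<integral>\<^sup>+x. ennreal (g n x) \<partial>\<kappa>)"
    by (intro nn_integral_liminf) simp
  also have "\<dots> \<le> ennreal b"
  proof (rule order_trans[OF Liminf_le_Limsup])
    show "limsup (\<lambda>n. \<integral>\<^sup>+x. ennreal (g n x) \<partial>\<kappa>) \<le> ennreal b"
    proof (intro Limsup_bounded always_eventually allI)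
      fix n
      have "(\<integral>\<^sup>+x. ennreal (g n x) \<partial>\<kappa>) = ennreal (\<integral>x. g n x \<partial>\<kappa>)"
        by (intro nn_integral_eq_integral int) (use nn in auto)
      then show "(\<integral>\<^sup>+x. ennreal (g n x) \<partial>\<kappa>) \<le> ennreal b"
        using bd[of n] by (simp add: ennreal_leI)
    qed
  qed simp
  finally have "(\<integral>\<^sup>+x. liminf (\<lambda>n. ennreal (g n x)) \<partial>\<kappa>) \<noteq> \<infinity>"
    by (auto simp: top_unique)
  then have "AE x in \<kappa>. liminf (\<lambda>n. ennreal (g n x)) \<noteq> \<infinity>"
    by (intro nn_integral_PInf_AE) auto
  with cau show ?thesis
  proof eventually_elim
    fix x assume "Cauchy (\<lambda>n. exp (- (g n x / 2)))" and fin: "liminf (\<lambda>n. ennreal (g n x)) \<noteq> \<infinity>"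
    then obtain l where l: "(\<lambda>n. exp (- (g n x / 2))) \<longlonglongrightarrow> l"
      using real_Cauchy_convergent convergentD by blast
    have l0: "0 \<le> l" by (rule LIMSEQ_le_const[OF l]) auto
    have "l \<noteq> 0"
    proof
      assume "l = 0"
      then have "filterlim (\<lambda>n. exp (- (g n x / 2))) (at_right 0) sequentially"
        using l by (auto simp: filterlim_at)
      then have "filterlim (\<lambda>n. ln (exp (- (g n x / 2)))) at_bot sequentially"
        by (rule filterlim_compose[OF ln_at_0])
      then have "filterlim (\<lambda>n. g n x / 2) at_top sequentially"
        by (simp add: filterlim_uminus_at_bot)
      then have "filterlim (\<lambda>n. 2 * (g n x / 2)) at_top sequentially"
        by (intro filterlim_tendsto_pos_mult_at_top[OF tendsto_const]) auto
      then have "((\<lambda>n. ennreal (g n x)) \<longlongrightarrow> \<infinity>) sequentially"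
        by (simp add: ennreal_tendsto_top_eq_at_top)
      then have "liminf (\<lambda>n. ennreal (g n x)) = \<infinity>"
        by (rule lim_imp_Liminf[rotated]) simp
      with fin show False by simp
    qed
    then have "(\<lambda>n. ln (exp (- (g n x / 2)))) \<longlonglongrightarrow> ln l"
      by (intro tendsto_ln l)
    then have "(\<lambda>n. - 2 * (ln (exp (- (g n x / 2))))) \<longlonglongrightarrow> - 2 * ln l"
      by (rule tendsto_mult_left)
    then show "convergent (\<lambda>n. g n x)" by (auto simp: convergent_def)
  qed
qed

section \<open>Minimizing a linear cost under linear constraints\<close>

lemma integrable_mult_bounded:
  fixes f k :: "'a \<Rightarrow> real"
  assumes f: "integrable M f" and k: "k \<in> borel_measurable M"
    and kb: "\<And>x. x \<in> space M \<Longrightarrow> \<bar>k x\<bar> \<le> C"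
  shows "integrable M (\<lambda>x. f x * k x)"
proof (rule Bochner_Integration.integrable_bound[OF integrable_mult_right[OF integrable_abs[OF f], of C]])
  show "AE x in M. norm (f x * k x) \<le> norm (C * \<bar>f x\<bar>)"
  proof (rule AE_I2)
    fix x assume "x \<in> space M"
    then have "\<bar>k x\<bar> \<le> \<bar>C\<bar>" using kb[of x] by linarith
    then have "\<bar>k x\<bar> * \<bar>f x\<bar> \<le> \<bar>C\<bar> * \<bar>f x\<bar>" by (rule mult_right_mono) simp
    then show "norm (f x * k x) \<le> norm (C * \<bar>f x\<bar>)"
      by (simp add: abs_mult mult.commute)
  qed
qed (use f k in auto)

lemma linear_functional_tendsto_L1:
  fixes k :: "'a \<Rightarrow> real"
  assumes int: "\<And>n. integrable \<kappa> (g n)" "integrable \<kappa> G"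
    and L1: "(\<lambda>n. \<integral>x. \<bar>g n x - G x\<bar> \<partial>\<kappa>) \<longlonglongrightarrow> 0"
    and k[measurable]: "k \<in> borel_measurable \<kappa>" and kb: "\<And>x. x \<in> space \<kappa> \<Longrightarrow> \<bar>k x\<bar> \<le> C"
  shows "(\<lambda>n. \<integral>x. g n x * k x \<partial>\<kappa>) \<longlonglongrightarrow> (\<integral>x. G x * k x \<partial>\<kappa>)"
proof -
  note i = integrable_mult_bounded[OF _ k kb]
  have "norm ((\<integral>x. g n x * k x \<partial>\<kappa>) - (\<integral>x. G x * k x \<partial>\<kappa>)) \<le> C * (\<integral>x. \<bar>g n x - G x\<bar> \<partial>\<kappa>)" for n
  proof -
    have "(\<integral>x. g n x * k x \<partial>\<kappa>) - (\<integral>x. G x * k x \<partial>\<kappa>) = (\<integral>x. (g n x - G x) * k x \<partial>\<kappa>)"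
      using i int by (simp add: left_diff_distrib)
    also have "norm \<dots> \<le> (\<integral>x. norm ((g n x - G x) * k x) \<partial>\<kappa>)"
      by (rule integral_norm_bound)
    also have "\<dots> \<le> (\<integral>x. C * \<bar>g n x - G x\<bar> \<partial>\<kappa>)"
      using int i[of "\<lambda>x. g n x - G x"] integrable_abs[OF i[of "\<lambda>x. g n x - G x"]] kb
      by (intro integral_mono_AE) (auto simp: abs_mult mult.commute mult_right_mono)
    finally show ?thesis by simp
  qed
  then show ?thesis
    by (intro LIM_zero_cancel[OF Lim_null_comparison[OF _ tendsto_mult_right_zero[OF L1, of C]]])
      (auto intro!: always_eventually)
qed

text \<open>The direct method: sublevel sets of the cost in \<open>D\<close> are nested and closed
  under midpoints, so \<open>convex_nested_selection\<close> gives an almost everywhere convergent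
  minimizing sequence. Uniform integrability upgrades this to L1 convergence, which preserves every
  constraint and the cost.\<close>

proposition density_minimizer_exists:
  fixes K :: "(('a \<Rightarrow> real) \<times> real) set" and c :: "'a \<Rightarrow> real"
  assumes fin: "finite_measure \<kappa>"
    and K: "\<And>k v. (k, v) \<in> K \<Longrightarrow> k \<in> borel_measurable \<kappa> \<and> (\<exists>C. \<forall>x\<in>space \<kappa>. \<bar>k x\<bar> \<le> C)"
    and c[measurable]: "c \<in> borel_measurable \<kappa>" and cb: "\<And>x. x \<in> space \<kappa> \<Longrightarrow> \<bar>c x\<bar> \<le> C"
    and D: "\<And>g. g \<in> D \<longleftrightarrow> integrable \<kappa> g \<and> (\<forall>x. 0 \<le> g x) \<and> (\<integral>x. g x \<partial>\<kappa>) = 1 \<and>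
      (\<forall>(k, v)\<in>K. (\<integral>x. g x * k x \<partial>\<kappa>) = v)"
    and ui: "\<And>\<epsilon>. \<epsilon> > 0 \<Longrightarrow> \<exists>\<delta>>0. \<forall>g\<in>D. \<forall>S\<in>sets \<kappa>. measure \<kappa> S < \<delta> \<longrightarrow>
      (\<integral>x. indicator S x * g x \<partial>\<kappa>) \<le> \<epsilon>"
    and ne: "D \<noteq> {}"
  shows "\<exists>g\<in>D. \<forall>g'\<in>D. (\<integral>x. g x * c x \<partial>\<kappa>) \<le> (\<integral>x. g' x * c x \<partial>\<kappa>)"
proof -
  interpret finite_measure \<kappa> by fact
  define cost where "cost g = (\<integral>x. g x * c x \<partial>\<kappa>)" for g
  note i = integrable_mult_bounded
  have cost_lb: "- C \<le> cost g" if g: "g \<in> D" for g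
  proof -
    have gi: "integrable \<kappa> g" and g0: "\<And>x. 0 \<le> g x" and g1: "(\<integral>x. g x \<partial>\<kappa>) = 1"
      using g by (auto simp: D)
    have "(\<integral>x. g x * (- C) \<partial>\<kappa>) \<le> cost g"
      unfolding cost_def
    proof (intro integral_mono i[OF gi c cb])
      fix x assume "x \<in> space \<kappa>"
      then show "g x * - C \<le> g x * c x" using cb[of x] g0[of x] by (intro mult_left_mono) auto
    qed (use gi in auto)
    then show ?thesis using g1 gi by simp
  qed
  define V where "V = Inf (cost ` D)"
  have bdd: "bdd_below (cost ` D)" using cost_lb by (intro bdd_belowI[of _ "- C"]) auto
  have V_le: "V \<le> cost g" if "g \<in> D" for g
    unfolding V_def using that bdd by (intro cInf_lower) auto
  define DD where "DD n = {g \<in> D. cost g \<le> V + 1 / Suc n}" for n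
  have "\<exists>f. (\<forall>n. f n \<in> DD n) \<and> (AE x in \<kappa>. Cauchy (\<lambda>n. exp (- (f n x / 2))))"
  proof (rule convex_nested_selection[OF fin])
    fix n
    have "1 / real (Suc (Suc n)) \<le> 1 / real (Suc n)" by (simp add: frac_le)
    then show "DD (Suc n) \<subseteq> DD n" unfolding DD_def by fastforce
    have "Inf (cost ` D) < V + 1 / Suc n" unfolding V_def by simp
    then obtain y where "y \<in> cost ` D" "y < V + 1 / Suc n"
      using cInf_lessD[of "cost ` D"] ne by (metis image_is_empty)
    then show "DD n \<noteq> {}" unfolding DD_def by force
  next
    fix n f g assume f: "f \<in> DD n" and g: "g \<in> DD n"
    then have fD: "f \<in> D" and gD: "g \<in> D" by (auto simp: DD_def)
    then have fi: "integrable \<kappa> f" "integrable \<kappa> g" by (auto simp: D)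
    let ?h = "\<lambda>x. (f x + g x) / 2"
    have lin: "(\<integral>x. ?h x * k x \<partial>\<kappa>) = ((\<integral>x. f x * k x \<partial>\<kappa>) + (\<integral>x. g x * k x \<partial>\<kappa>)) / 2"
      if "k \<in> borel_measurable \<kappa>" "\<And>x. x \<in> space \<kappa> \<Longrightarrow> \<bar>k x\<bar> \<le> C" for k C
      using i[OF fi(1) that] i[OF fi(2) that]
      by (simp add: add_divide_distrib distrib_right)
    have "?h \<in> D"
      unfolding D
    proof (intro conjI allI ballI)
      show "integrable \<kappa> ?h" using fi by simp
      show "0 \<le> ?h x" for x using fD gD by (simp add: D)
      show "(\<integral>x. ?h x \<partial>\<kappa>) = 1" using fD gD fi by (simp add: D)
      fix kv assume kv: "kv \<in> K"
      obtain k v where kv': "kv = (k, v)" by force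
      then obtain B where "k \<in> borel_measurable \<kappa>" "\<And>x. x \<in> space \<kappa> \<Longrightarrow> \<bar>k x\<bar> \<le> B" using K kv by blast
      note lin[OF this]
      moreover have "(\<integral>x. f x * k x \<partial>\<kappa>) = v" "(\<integral>x. g x * k x \<partial>\<kappa>) = v"
        using fD gD kv kv' by (auto simp: D)
      ultimately show "case kv of (k, v) \<Rightarrow> (\<integral>x. ?h x * k x \<partial>\<kappa>) = v" using kv' by simp
    qed
    moreover have "cost ?h = (cost f + cost g) / 2"
      unfolding cost_def by (rule lin[OF c cb])
    ultimately show "?h \<in> DD n" using f g by (auto simp: DD_def)
  qed (auto simp: DD_def D)
  then obtain f where f: "\<And>n. f n \<in> DD n" and cau: "AE x in \<kappa>. Cauchy (\<lambda>n. exp (- (f n x / 2)))"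
    by blast
  then have fD: "f n \<in> D" for n by (auto simp: DD_def)
  then have fi: "integrable \<kappa> (f n)" and f0: "0 \<le> f n x" and f1: "(\<integral>x. f n x \<partial>\<kappa>) = 1" for n x
    by (auto simp: D)
  have [measurable]: "f n \<in> borel_measurable \<kappa>" for n using fi by auto
  have conv: "AE x in \<kappa>. convergent (\<lambda>n. f n x)"
    by (rule AE_convergent_of_exp_Cauchy[OF fi f0 _ cau, of 1]) (simp add: f1)
  \<comment> \<open>\<open>D\<close> asks for nonnegativity at every point, but \<open>lim\<close>
    has no prescribed sign where the sequence diverges. The truncation repairs this on a null
    set.\<close>
  define G where "G x = max 0 (lim (\<lambda>n. f n x))" for x
  have G[measurable]: "G \<in> borel_measurable \<kappa>" unfolding G_def by measurable
  have lim: "AE x in \<kappa>. (\<lambda>n. f n x) \<longlonglongrightarrow> G x"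
    using conv
  proof eventually_elim
    fix x assume "convergent (\<lambda>n. f n x)"
    then have l: "(\<lambda>n. f n x) \<longlonglongrightarrow> lim (\<lambda>n. f n x)" by (simp add: convergent_LIMSEQ_iff)
    moreover have "0 \<le> lim (\<lambda>n. f n x)" by (rule LIMSEQ_le_const[OF l]) (use f0 in auto)
    ultimately show "(\<lambda>n. f n x) \<longlonglongrightarrow> G x" by (simp add: G_def)
  qed
  have uif: "\<exists>\<delta>>0. \<forall>n. \<forall>S\<in>sets \<kappa>. measure \<kappa> S < \<delta> \<longrightarrow> (\<integral>x. indicator S x * f n x \<partial>\<kappa>) \<le> \<epsilon>"
    if "\<epsilon> > 0" for \<epsilon>
    using ui[OF that] fD by meson
  have f1': "(\<integral>x. f n x \<partial>\<kappa>) \<le> 1" for n using f1 by simp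
  note V = vitali_convergence_L1[OF fin fi f0 f1' G lim uif]
  have tend: "(\<lambda>n. \<integral>x. f n x * k x \<partial>\<kappa>) \<longlonglongrightarrow> (\<integral>x. G x * k x \<partial>\<kappa>)"
    if "k \<in> borel_measurable \<kappa>" "\<And>x. x \<in> space \<kappa> \<Longrightarrow> \<bar>k x\<bar> \<le> B" for k B
    by (rule linear_functional_tendsto_L1[OF fi V that])
  have GD: "G \<in> D"
    unfolding D
  proof (intro conjI allI ballI)
    show "integrable \<kappa> G" by (rule V)
    show "0 \<le> G x" for x by (simp add: G_def)
    have "(\<lambda>n. \<integral>x. f n x * 1 \<partial>\<kappa>) \<longlonglongrightarrow> (\<integral>x. G x * 1 \<partial>\<kappa>)" by (rule tend[of _ 1]) auto
    then show "(\<integral>x. G x \<partial>\<kappa>) = 1" by (simp add: f1 LIMSEQ_const_iff)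
    fix kv assume kv: "kv \<in> K"
    obtain k v where kv': "kv = (k, v)" by force
    then obtain B where "k \<in> borel_measurable \<kappa>" "\<And>x. x \<in> space \<kappa> \<Longrightarrow> \<bar>k x\<bar> \<le> B" using K kv by blast
    note tend[OF this]
    moreover have "(\<integral>x. f n x * k x \<partial>\<kappa>) = v" for n using fD[of n] kv kv' by (auto simp: D)
    ultimately show "case kv of (k, v) \<Rightarrow> (\<integral>x. G x * k x \<partial>\<kappa>) = v" using kv' by (simp add: LIMSEQ_const_iff)
  qed
  have "(\<lambda>n. cost (f n)) \<longlonglongrightarrow> cost G" unfolding cost_def by (rule tend[OF c cb])
  moreover have "(\<lambda>n. V + 1 / real (Suc n)) \<longlonglongrightarrow> V + 0"
    by (intro tendsto_intros) real_asymp
  moreover have "cost (f n) \<le> V + 1 / real (Suc n)" for n using f[of n] by (simp add: DD_def)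
  ultimately have "cost G \<le> V + 0" by (intro LIMSEQ_le) auto
  then show ?thesis using GD V_le unfolding cost_def by force
qed

section \<open>Martingale couplings as linear constraints\<close>

text \<open>The measurable sets of the restricted space are the traces \<open>S \<inter> X\<close>
  of Borel sets, so prescribing a marginal amounts to a family of equations that are linear in
  \<open>\<pi>\<close>.\<close>

lemma measure_eq_iff_integral_indicator:
  fixes \<mu> :: "'b::topological_space measure"
  assumes \<pi>: "prob_space \<pi>" and \<mu>: "\<mu> \<in> borel_probs X"
    and f: "f \<in> measurable \<pi> borel" and fX: "\<And>\<omega>. \<omega> \<in> space \<pi> \<Longrightarrow> f \<omega> \<in> X"
  shows "distr \<pi> (restrict_space borel X) f = \<mu> \<longleftrightarrow>
    (\<forall>S\<in>sets borel. (\<integral>\<omega>. indicator S (f \<omega>) \<partial>\<pi>) = measure \<mu> (S \<inter> X))"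
proof -
  interpret \<pi>: prob_space \<pi> by fact
  have \<mu>p: "prob_space \<mu>" and s\<mu>: "sets \<mu> = sets (restrict_space borel X)"
    using \<mu> by (auto simp: borel_probs_def)
  interpret \<mu>: prob_space \<mu> by fact
  have fr: "f \<in> measurable \<pi> (restrict_space borel X)"
    using f fX by (intro measurable_restrict_space2) auto
  let ?D = "distr \<pi> (restrict_space borel X) f"
  interpret D: prob_space ?D by (rule \<pi>.prob_space_distr[OF fr])
  have ind: "(\<integral>\<omega>. indicator S (f \<omega>) \<partial>\<pi>) = measure ?D (S \<inter> X)" if "S \<in> sets borel" for S
  proof -
    have SX: "S \<inter> X \<in> sets (restrict_space borel X)" using that by (auto simp: sets_restrict_space)
    have "(\<integral>\<omega>. indicator S (f \<omega>) \<partial>\<pi>) = (\<integral>\<omega>. indicator (f -` (S \<inter> X) \<inter> space \<pi>) \<omega> \<partial>\<pi>)"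
      using fX by (intro lebesgue_cong) (auto simp: indicator_def)
    also have "\<dots> = measure ?D (S \<inter> X)"
      using fr SX by (simp add: measure_distr)
    finally show ?thesis .
  qed
  show ?thesis
  proof
    assume "?D = \<mu>"
    then show "\<forall>S\<in>sets borel. (\<integral>\<omega>. indicator S (f \<omega>) \<partial>\<pi>) = measure \<mu> (S \<inter> X)" using ind by simp
  next
    assume *: "\<forall>S\<in>sets borel. (\<integral>\<omega>. indicator S (f \<omega>) \<partial>\<pi>) = measure \<mu> (S \<inter> X)"
    show "?D = \<mu>"
    proof (rule measure_eqI)
      show "sets ?D = sets \<mu>" by (simp add: s\<mu>)
      fix A assume "A \<in> sets ?D"
      then obtain S where "S \<in> sets borel" "A = S \<inter> X" by (auto simp: sets_restrict_space)
      then show "emeasure ?D A = emeasure \<mu> A"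
        using * ind by (simp add: D.emeasure_eq_measure \<mu>.emeasure_eq_measure)
    qed
  qed
qed

text \<open>The sets of the generated \<sigma>-algebra are the preimages of Borel sets under
  \<open>f\<close>. The characterization of conditional expectation by integrals over these sets
  thus becomes a family of equations that are linear in \<open>\<pi>\<close>.\<close>

lemma real_cond_exp_generated_iff:
  fixes f :: "'a \<Rightarrow> 'b::topological_space" and g :: "'a \<Rightarrow> real" and \<phi> :: "'b \<Rightarrow> real"
  assumes \<pi>: "prob_space \<pi>" and f[measurable]: "f \<in> measurable \<pi> borel"
    and g: "integrable \<pi> g" and \<phi>[measurable]: "\<phi> \<in> borel_measurable borel"
    and h: "integrable \<pi> (\<lambda>\<omega>. \<phi> (f \<omega>))"
  shows "(AE \<omega> in \<pi>. real_cond_exp \<pi> (vimage_algebra (space \<pi>) f borel) g \<omega> = \<phi> (f \<omega>)) \<longleftrightarrow>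
    (\<forall>S\<in>sets borel. (\<integral>\<omega>. indicator S (f \<omega>) * (g \<omega> - \<phi> (f \<omega>)) \<partial>\<pi>) = 0)"
proof -
  interpret \<pi>: prob_space \<pi> by fact
  let ?F = "vimage_algebra (space \<pi>) f borel"
  have setsF: "sets ?F = {f -` S \<inter> space \<pi> | S. S \<in> sets borel}"
    by (rule sets_vimage_algebra2) auto
  have fF: "f \<in> measurable ?F borel" by (rule measurable_vimage_algebra1) simp
  have sub: "subalgebra \<pi> ?F"
    using f by (auto simp: subalgebra_def setsF)
  interpret sub: finite_measure_subalgebra \<pi> ?F
    by unfold_locales (rule sub)
  have ind: "integrable \<pi> (\<lambda>\<omega>. indicator S (f \<omega>) * h \<omega>)" if "S \<in> sets borel" "integrable \<pi> h" for S and h :: "'a \<Rightarrow> real"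
  proof (rule Bochner_Integration.integrable_bound[OF that(2)])
    show "(\<lambda>\<omega>. indicator S (f \<omega>) * h \<omega>) \<in> borel_measurable \<pi>" using that by measurable
  qed (auto simp: indicator_def)
  have seteq: "(\<integral>\<omega>\<in>(f -` S \<inter> space \<pi>). h \<omega> \<partial>\<pi>) = (\<integral>\<omega>. indicator S (f \<omega>) * h \<omega> \<partial>\<pi>)" for S and h :: "'a \<Rightarrow> real"
    unfolding set_lebesgue_integral_def by (intro lebesgue_cong) (auto simp: indicator_def)
  have diff: "(\<integral>\<omega>. indicator S (f \<omega>) * (g \<omega> - \<phi> (f \<omega>)) \<partial>\<pi>)
      = (\<integral>\<omega>. indicator S (f \<omega>) * g \<omega> \<partial>\<pi>) - (\<integral>\<omega>. indicator S (f \<omega>) * \<phi> (f \<omega>) \<partial>\<pi>)"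
    if "S \<in> sets borel" for S
    using ind[OF that g] ind[OF that h] by (simp add: right_diff_distrib)
  show ?thesis
  proof
    assume ae: "AE \<omega> in \<pi>. real_cond_exp \<pi> ?F g \<omega> = \<phi> (f \<omega>)"
    show "\<forall>S\<in>sets borel. (\<integral>\<omega>. indicator S (f \<omega>) * (g \<omega> - \<phi> (f \<omega>)) \<partial>\<pi>) = 0"
    proof
      fix S :: "'b set" assume S: "S \<in> sets borel"
      have "(\<integral>\<omega>. indicator S (f \<omega>) * g \<omega> \<partial>\<pi>) = (\<integral>\<omega>. indicator S (f \<omega>) * real_cond_exp \<pi> ?F g \<omega> \<partial>\<pi>)"
        using sub.real_cond_exp_intA[OF g, of "f -` S \<inter> space \<pi>"] S unfolding seteq setsF by blast
      also have "\<dots> = (\<integral>\<omega>. indicator S (f \<omega>) * \<phi> (f \<omega>) \<partial>\<pi>)"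
        using ae S by (intro integral_cong_AE) auto
      finally show "(\<integral>\<omega>. indicator S (f \<omega>) * (g \<omega> - \<phi> (f \<omega>)) \<partial>\<pi>) = 0" using diff[OF S] by simp
    qed
  next
    assume *: "\<forall>S\<in>sets borel. (\<integral>\<omega>. indicator S (f \<omega>) * (g \<omega> - \<phi> (f \<omega>)) \<partial>\<pi>) = 0"
    show "AE \<omega> in \<pi>. real_cond_exp \<pi> ?F g \<omega> = \<phi> (f \<omega>)"
    proof (rule sub.real_cond_exp_charact[OF _ g h])
      show "(\<lambda>\<omega>. \<phi> (f \<omega>)) \<in> borel_measurable ?F" by (rule measurable_compose[OF fF \<phi>])
      fix A assume "A \<in> sets ?F"
      then obtain S where S: "S \<in> sets borel" "A = f -` S \<inter> space \<pi>" unfolding setsF by blast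
      show "(\<integral>\<omega>\<in>A. g \<omega> \<partial>\<pi>) = (\<integral>\<omega>\<in>A. \<phi> (f \<omega>) \<partial>\<pi>)"
        unfolding S(2) seteq using * S(1) diff[OF S(1)] by simp
    qed
  qed
qed

text \<open>Each pair is a test function with its prescribed integral: three families fix the
  marginals, two express the conditional means. In this linear form the conditions are visibly
  stable under averages, L1 limits and exchanges of mass. The test functions are Borel on the whole
  space, so no restriction enters their measurability.\<close>

definition coupling_constraints ::
  "real set \<Rightarrow> real set \<Rightarrow> real set \<Rightarrow> real measure \<Rightarrow> real measure \<Rightarrow> real measure
    \<Rightarrow> ((real \<times> real \<times> real \<Rightarrow> real) \<times> real) set" where
  "coupling_constraints X Y Z \<mu>X \<mu>Y \<mu>Z =
     (\<lambda>S. (\<lambda>\<omega>. indicator S (fst \<omega>), measure \<mu>X (S \<inter> X))) ` sets borel \<union>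
     (\<lambda>S. (\<lambda>\<omega>. indicator S (fst (snd \<omega>)), measure \<mu>Y (S \<inter> Y))) ` sets borel \<union>
     (\<lambda>S. (\<lambda>\<omega>. indicator S (snd (snd \<omega>)), measure \<mu>Z (S \<inter> Z))) ` sets borel \<union>
     (\<lambda>S. (\<lambda>\<omega>. indicator S (fst \<omega>) * (fst (snd \<omega>) - fst \<omega>), 0)) ` sets borel \<union>
     (\<lambda>S. (\<lambda>\<omega>. indicator S (fst \<omega>, fst (snd \<omega>)) * (snd (snd \<omega>) - fst (snd \<omega>)), 0)) ` sets borel"

lemma borel_measurable_fst_real [measurable]: "fst \<in> borel_measurable (borel :: (real \<times> 'b::topological_space) measure)"
  by (intro borel_measurable_continuous_onI continuous_intros)

lemma borel_measurable_snd_real [measurable]: "snd \<in> borel_measurable (borel :: (real \<times> real) measure)"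
  by (intro borel_measurable_continuous_onI continuous_intros)

lemma borel_measurable_coordinates [measurable]:
  "(\<lambda>\<omega>. fst (snd \<omega>)) \<in> borel_measurable (borel :: (real \<times> real \<times> real) measure)"
  "(\<lambda>\<omega>. snd (snd \<omega>)) \<in> borel_measurable (borel :: (real \<times> real \<times> real) measure)"
  "(\<lambda>\<omega>. (fst \<omega>, fst (snd \<omega>))) \<in> borel_measurable (borel :: (real \<times> real \<times> real) measure)"
  by (intro borel_measurable_continuous_onI continuous_intros)+

lemma constraint_functions_measurable:
  fixes S :: "real set" and S2 :: "(real \<times> real) set"
  assumes S[measurable]: "S \<in> sets borel" and S2: "S2 \<in> sets borel"
  shows "(\<lambda>\<omega>. indicator S (fst \<omega>)) \<in> borel_measurable (borel :: (real \<times> real \<times> real) measure)"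
    and "(\<lambda>\<omega>. indicator S (fst (snd \<omega>))) \<in> borel_measurable (borel :: (real \<times> real \<times> real) measure)"
    and "(\<lambda>\<omega>. indicator S (snd (snd \<omega>))) \<in> borel_measurable (borel :: (real \<times> real \<times> real) measure)"
    and "(\<lambda>\<omega>. indicator S (fst \<omega>) * (fst (snd \<omega>) - fst \<omega>)) \<in> borel_measurable (borel :: (real \<times> real \<times> real) measure)"
    and "(\<lambda>\<omega>. indicator S2 (fst \<omega>, fst (snd \<omega>)) * (snd (snd \<omega>) - fst (snd \<omega>))) \<in> borel_measurable (borel :: (real \<times> real \<times> real) measure)"
    (is "?f \<in> _")
proof -
  have "(\<lambda>\<omega>. indicator S2 (fst \<omega>, fst (snd \<omega>)) :: real) \<in> borel_measurable (borel :: (real \<times> real \<times> real) measure)"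
    by (rule measurable_compose[OF borel_measurable_coordinates(3) borel_measurable_indicator[OF S2]])
  then show "?f \<in> borel_measurable borel"
    by (intro borel_measurable_times borel_measurable_diff borel_measurable_coordinates)
qed measurable

text \<open>Compactness bounds the coordinates and so makes them integrable, as the characterization
  of the conditional means requires.\<close>

lemma martingale_couplings_iff:
  assumes X: "compact X" and Y: "compact Y" and Z: "compact Z"
    and \<mu>: "\<mu>X \<in> borel_probs X" "\<mu>Y \<in> borel_probs Y" "\<mu>Z \<in> borel_probs Z"
  shows "\<pi> \<in> martingale_couplings X Y Z \<mu>X \<mu>Y \<mu>Z \<longleftrightarrow>
    prob_space \<pi> \<and> sets \<pi> = sets (restrict_space borel (X \<times> Y \<times> Z)) \<and>
    (\<forall>(k, v)\<in>coupling_constraints X Y Z \<mu>X \<mu>Y \<mu>Z. (\<integral>\<omega>. k \<omega> \<partial>\<pi>) = v)"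
proof (cases "prob_space \<pi> \<and> sets \<pi> = sets (restrict_space borel (X \<times> Y \<times> Z))")
  case False
  then show ?thesis by (auto simp: martingale_couplings_def borel_probs_def)
next
  case True
  then have \<pi>: "prob_space \<pi>" and s: "sets \<pi> = sets (restrict_space borel (X \<times> Y \<times> Z))" by auto
  interpret \<pi>: prob_space \<pi> by fact
  have sp: "space \<pi> = X \<times> Y \<times> Z"
    using sets_eq_imp_space_eq[OF s] by (simp add: space_restrict_space)
  have meas: "f \<in> measurable \<pi> N" if "f \<in> measurable borel N" for f and N :: "'b measure"
    using measurable_restrict_space1[OF that, of "X \<times> Y \<times> Z"] s by (simp cong: measurable_cong_sets)
  have m[measurable]: "(\<lambda>\<omega>. fst \<omega>) \<in> borel_measurable \<pi>" "(\<lambda>\<omega>. fst (snd \<omega>)) \<in> borel_measurable \<pi>"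
    "(\<lambda>\<omega>. snd (snd \<omega>)) \<in> borel_measurable \<pi>" "(\<lambda>\<omega>. (fst \<omega>, fst (snd \<omega>))) \<in> borel_measurable \<pi>"
    by (intro meas; measurable)+
  obtain C where C: "\<And>x. x \<in> X \<union> Y \<union> Z \<Longrightarrow> \<bar>x\<bar> \<le> C"
    using compact_imp_bounded[OF compact_Un[OF compact_Un[OF X Y] Z]] by (auto simp: bounded_iff)
  have i: "integrable \<pi> (\<lambda>\<omega>. fst \<omega>)" "integrable \<pi> (\<lambda>\<omega>. fst (snd \<omega>))" "integrable \<pi> (\<lambda>\<omega>. snd (snd \<omega>))"
    by (intro \<pi>.integrable_const_bound[of _ C] AE_I2; use C in \<open>auto simp: sp\<close>)+
  have 1: "distr \<pi> (restrict_space borel X) (\<lambda>(x, y, z). x) = \<mu>X \<longleftrightarrow>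
      (\<forall>S\<in>sets borel. (\<integral>\<omega>. indicator S (fst \<omega>) \<partial>\<pi>) = measure \<mu>X (S \<inter> X))"
    using measure_eq_iff_integral_indicator[OF \<pi> \<mu>(1) m(1)] by (auto simp: sp case_prod_unfold)
  have 2: "distr \<pi> (restrict_space borel Y) (\<lambda>(x, y, z). y) = \<mu>Y \<longleftrightarrow>
      (\<forall>S\<in>sets borel. (\<integral>\<omega>. indicator S (fst (snd \<omega>)) \<partial>\<pi>) = measure \<mu>Y (S \<inter> Y))"
    using measure_eq_iff_integral_indicator[OF \<pi> \<mu>(2) m(2)] by (auto simp: sp case_prod_unfold)
  have 3: "distr \<pi> (restrict_space borel Z) (\<lambda>(x, y, z). z) = \<mu>Z \<longleftrightarrow>
      (\<forall>S\<in>sets borel. (\<integral>\<omega>. indicator S (snd (snd \<omega>)) \<partial>\<pi>) = measure \<mu>Z (S \<inter> Z))"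
    using measure_eq_iff_integral_indicator[OF \<pi> \<mu>(3) m(3)] by (auto simp: sp case_prod_unfold)
  have 4: "(AE (x, y, z) in \<pi>. real_cond_exp \<pi> (vimage_algebra (X \<times> Y \<times> Z) (\<lambda>(x, y, z). x) borel)
        (\<lambda>(x, y, z). y) (x, y, z) = x) \<longleftrightarrow>
      (\<forall>S\<in>sets borel. (\<integral>\<omega>. indicator S (fst \<omega>) * (fst (snd \<omega>) - fst \<omega>) \<partial>\<pi>) = 0)"
    using real_cond_exp_generated_iff[OF \<pi> m(1) i(2), of "\<lambda>x. x"] i(1) by (simp add: sp case_prod_unfold)
  have 5: "(AE (x, y, z) in \<pi>. real_cond_exp \<pi> (vimage_algebra (X \<times> Y \<times> Z) (\<lambda>(x, y, z). (x, y)) borel)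
        (\<lambda>(x, y, z). z) (x, y, z) = y) \<longleftrightarrow>
      (\<forall>S\<in>sets borel. (\<integral>\<omega>. indicator S (fst \<omega>, fst (snd \<omega>)) * (snd (snd \<omega>) - fst (snd \<omega>)) \<partial>\<pi>) = 0)"
    using real_cond_exp_generated_iff[OF \<pi> m(4) i(3), of snd] i(2)
    by (simp add: sp case_prod_unfold borel_measurable_snd_real)
  show ?thesis
    unfolding martingale_couplings_def mem_Collect_eq 1 2 3 4 5
    by (simp add: True borel_probs_def coupling_constraints_def ball_Un conj_assoc)
qed

section \<open>Existence of martingale couplings\<close>

lemma borel_probsD:
  assumes "\<mu> \<in> borel_probs S"
  shows "prob_space \<mu>" "sets \<mu> = sets (restrict_space borel S)" "space \<mu> = S"
  using assms sets_eq_imp_space_eq[of \<mu> "restrict_space borel S"]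
  by (auto simp: borel_probs_def space_restrict_space)

lemma borel_probs_measurable:
  assumes "\<mu> \<in> borel_probs S" and "f \<in> measurable borel N"
  shows "f \<in> measurable \<mu> N"
  using measurable_restrict_space1[OF assms(2), of S] borel_probsD(2)[OF assms(1)]
  by (simp cong: measurable_cong_sets)

text \<open>Members of \<open>borel_probs S\<close> live on the trace \<sigma>-algebra with space
  \<open>S\<close>. Distribution functions and the extraction of intervals need the same law on the
  full Borel \<sigma>-algebra.\<close>

definition borel_ext :: "'a::topological_space measure \<Rightarrow> 'a measure" where
  "borel_ext \<mu> = distr \<mu> borel (\<lambda>x. x)"

lemma borel_ext:
  assumes \<mu>: "\<mu> \<in> borel_probs S"
  shows "prob_space (borel_ext \<mu>)" and "sets (borel_ext \<mu>) = sets borel"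
    and "\<And>f. f \<in> borel_measurable borel \<Longrightarrow> (\<integral>x. f x \<partial>borel_ext \<mu>) = (\<integral>x. f x \<partial>\<mu> :: real)"
    and "\<And>A. A \<in> sets borel \<Longrightarrow> measure (borel_ext \<mu>) A = measure \<mu> (A \<inter> S)"
    and "\<And>P. Measurable.pred borel P \<Longrightarrow> (AE x in borel_ext \<mu>. P x) \<longleftrightarrow> (AE x in \<mu>. P x)"
proof -
  have id: "(\<lambda>x. x) \<in> measurable \<mu> borel" by (rule borel_probs_measurable[OF \<mu>]) simp
  interpret prob_space \<mu> by (rule borel_probsD(1)[OF \<mu>])
  show "prob_space (borel_ext \<mu>)" unfolding borel_ext_def by (rule prob_space_distr[OF id])
  show "sets (borel_ext \<mu>) = sets borel" by (simp add: borel_ext_def)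
  show "(\<integral>x. f x \<partial>borel_ext \<mu>) = (\<integral>x. f x \<partial>\<mu> :: real)" if "f \<in> borel_measurable borel" for f
    unfolding borel_ext_def using id that by (rule integral_distr)
  show "measure (borel_ext \<mu>) A = measure \<mu> (A \<inter> S)" if "A \<in> sets borel" for A
    unfolding borel_ext_def using measure_distr[OF id that] borel_probsD(3)[OF \<mu>] by simp
  show "(AE x in borel_ext \<mu>. P x) \<longleftrightarrow> (AE x in \<mu>. P x)" if "Measurable.pred borel P" for P
    unfolding borel_ext_def using id that by (subst AE_distr_iff) (auto simp: pred_def)
qed

text \<open>A numbering of the atoms that is defined everywhere, so that it is a measurable map on
  the whole space. The default 0 also numbers a point of a nonempty \<open>A\<close>, but it is
  taken outside \<open>A\<close>, where the law in question has no mass.\<close>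

definition enum_code :: "'a set \<Rightarrow> 'a \<Rightarrow> nat" where
  "enum_code A x = (if x \<in> A then to_nat_on A x else 0)"

lemma from_nat_into_enum_code: "countable A \<Longrightarrow> x \<in> A \<Longrightarrow> from_nat_into A (enum_code A x) = x"
  by (simp add: enum_code_def)

lemma countable_borel: "countable A \<Longrightarrow> A \<in> sets (borel :: 'a::t1_space measure)"
  by (rule sets.countable) auto

lemma measurable_enum_code:
  fixes A :: "'a::t1_space set"
  assumes A: "countable A"
  shows "enum_code A \<in> measurable borel (count_space UNIV)"
proof (subst measurable_count_space_eq2_countable, intro conjI ballI)
  fix n
  have "enum_code A -` {n} \<inter> space borel = {x \<in> A. to_nat_on A x = n} \<union> (if n = 0 then - A else {})"
    by (auto simp: enum_code_def split: if_splits)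
  moreover have "{x \<in> A. to_nat_on A x = n} \<in> sets borel"
    by (rule countable_borel) (use A in \<open>simp add: countable_Collect\<close>)
  moreover have "- A \<in> sets borel" by (rule borel_comp[OF countable_borel[OF A]])
  ultimately show "enum_code A -` {n} \<inter> space borel \<in> sets borel"
    by (cases "n = 0") (simp_all add: sets.Un)
qed simp

text \<open>The atomless model \<open>N\<close> is the uniform law on the unit interval and
  \<open>Q\<close> is the quantile function. Atoms of \<open>\<mu>\<close> become intervals on which
  \<open>Q\<close> is constant, and these can be cut at any mass.\<close>

lemma quantile_representation:
  fixes \<mu> :: "real measure"
  assumes \<mu>: "prob_space \<mu>" "sets \<mu> = sets borel" and C: "AE x in \<mu>. \<bar>x\<bar> \<le> C"
  obtains N :: "real measure" and Q :: "real \<Rightarrow> real" where "prob_space N" "sets N = sets borel" "\<And>x. measure N {x} = 0"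
    "measure N (- {0..1}) = 0" "mono Q" "\<And>u. \<bar>Q u\<bar> \<le> C" "distr N borel Q = \<mu>"
proof -
  interpret \<mu>: prob_space \<mu> by fact
  have rd: "real_distribution \<mu>"
    using \<mu> by (auto simp: real_distribution_def real_distribution_axioms_def)
  interpret cdf_distribution \<mu> unfolding cdf_distribution_def by (rule rd)
  have C0: "0 \<le> C"
  proof (rule ccontr)
    assume "\<not> 0 \<le> C"
    then have "AE x in \<mu>. False" by (intro eventually_mono[OF C]) auto
    then show False by simp
  qed
  define R where "R = restrict_space lborel {0<..<1::real}"
  have spR: "space R = {0<..<1}" by (simp add: R_def space_restrict_space)
  interpret R: prob_space R
    by (auto simp add: R_def emeasure_restrict_space space_restrict_space intro!: prob_spaceI)
  have idR: "(\<lambda>x. x) \<in> measurable R borel"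
    unfolding R_def by (rule measurable_restrict_space1) simp
  define N where "N = distr R borel (\<lambda>x. x)"
  have mN: "measure N A = measure lborel (A \<inter> {0<..<1})" if "A \<in> sets borel" for A
    unfolding N_def measure_distr[OF idR that] spR unfolding R_def
    using that by (subst measure_restrict_space) auto
  define cl where "cl x = max (- C) (min C x)" for x
  \<comment> \<open>The quantile function \<open>I\<close> is monotone on the open unit interval
    only. Clipping it to \<open>[-C, C]\<close> and using the extreme values beyond the ends makes
    \<open>Q\<close> monotone and bounded on the whole line; this alters \<open>I\<close> on a null
    set only.\<close>
  define Q where "Q u = (if u \<le> 0 then - C else if 1 \<le> u then C else cl (I u))" for u
  have clb: "- C \<le> cl x" "cl x \<le> C" for x using C0 by (auto simp: cl_def)
  have clm: "x \<le> y \<Longrightarrow> cl x \<le> cl y" for x y by (auto simp: cl_def)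
  have Q_b: "- C \<le> Q u" "Q u \<le> C" for u using clb[of "I u"] C0 by (simp_all add: Q_def)
  have Qmono: "mono Q"
  proof (rule monoI)
    fix u v :: real assume "u \<le> v"
    show "Q u \<le> Q v"
    proof (cases "0 < u \<and> v < 1")
      case True
      then have "cl (I u) \<le> cl (I v)"
        using \<open>u \<le> v\<close> by (intro clm mono_onD[OF mono_I]) auto
      then show ?thesis using True \<open>u \<le> v\<close> by (simp add: Q_def)
    next
      case False
      then consider "u \<le> 0" | "1 \<le> v" by linarith
      then show ?thesis
      proof cases
        case 1
        then have "Q u = - C" by (simp add: Q_def)
        then show ?thesis using Q_b(1)[of v] by simp
      next
        case 2
        then have "Q v = C" by (simp add: Q_def)
        then show ?thesis using Q_b(2)[of u] by simp
      qed
    qed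
  qed
  have Qm: "Q \<in> borel_measurable borel" by (rule borel_measurable_mono[OF Qmono])
  have sR: "sets R = sets (restrict_space borel {0<..<1})"
    unfolding R_def by (rule sets_restrict_space_cong) simp
  have IR: "I \<in> borel_measurable R"
    using measurable_CI measurable_cong_sets[OF sR refl, of borel] by blast
  have dI: "distr R borel I = \<mu>" using distr_I_eq_M unfolding R_def .
  have "AE x in distr R borel I. \<bar>x\<bar> \<le> C" unfolding dI by (rule C)
  then have "AE u in R. \<bar>I u\<bar> \<le> C"
    by (subst (asm) AE_distr_iff[OF IR]) auto
  then have QI: "AE u in R. Q u = I u"
    using AE_space by eventually_elim (auto simp: Q_def cl_def spR)
  have "distr N borel Q = distr R borel Q"
    unfolding N_def using Qm idR by (subst distr_distr) (auto simp: comp_def)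
  also have "\<dots> = distr R borel I"
    by (rule distr_cong_AE[OF refl refl QI]) (use measurable_compose[OF idR Qm] IR in auto)
  finally have "distr N borel Q = \<mu>" using dI by simp
  moreover have "measure N {x} = 0" for x
  proof -
    have "measure lborel ({x} \<inter> {0<..<1::real}) = 0"
      by (cases "x \<in> {0<..<1::real}") auto
    then show ?thesis using mN[of "{x}"] by simp
  qed
  moreover have "measure N (- {0..1}) = 0"
  proof -
    have "- {0..1} \<inter> {0<..<1::real} = {}" by auto
    then show ?thesis using mN[of "- {0..1}"] by simp
  qed
  moreover have "prob_space N" unfolding N_def by (rule R.prob_space_distr[OF idR])
  moreover have "sets N = sets borel" by (simp add: N_def)
  moreover have "\<bar>Q u\<bar> \<le> C" for u using Q_b[of u] by (simp add: abs_le_iff)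
  ultimately show thesis using Qmono that by blast
qed

text \<open>\<open>atomic_conditional_mean\<close> is applied twice. First \<open>\<mu>X\<close> is
  embedded below the quantile model of \<open>\<mu>Y\<close>, which yields a joint law of
  \<open>(x, y)\<close> carried by the countable set \<open>A \<times> B\<close>. Then this joint
  law, with \<open>y\<close> as the point attached to a pair, is embedded below
  \<open>\<mu>Z\<close>. The coupling is the image of \<open>\<mu>Z\<close> under a map that assigns
  a pair to each \<open>z\<close>.\<close>

proposition martingale_couplings_nonempty:
  assumes X: "compact X" and Y: "compact Y" and Z: "compact Z"
    and \<mu>X: "\<mu>X \<in> borel_probs X" and \<mu>Y: "\<mu>Y \<in> borel_probs Y" and \<mu>Z: "\<mu>Z \<in> borel_probs Z"
    and XY: "\<mu>X \<preceq>\<^sub>c \<mu>Y" and YZ: "\<mu>Y \<preceq>\<^sub>c \<mu>Z"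
    and A: "A \<subseteq> X" "countable A" "AE x in \<mu>X. x \<in> A"
    and B: "B \<subseteq> Y" "countable B" "AE y in \<mu>Y. y \<in> B"
    and atomless: "\<And>z. measure \<mu>Z ({z} \<inter> Z) = 0"
  shows "martingale_couplings X Y Z \<mu>X \<mu>Y \<mu>Z \<noteq> {}"
proof -
  interpret \<mu>X: prob_space \<mu>X by (rule borel_probsD(1)[OF \<mu>X])
  interpret \<mu>Y: prob_space \<mu>Y by (rule borel_probsD(1)[OF \<mu>Y])
  interpret \<mu>Z: prob_space \<mu>Z by (rule borel_probsD(1)[OF \<mu>Z])
  have Ane: "A \<noteq> {}" and Bne: "B \<noteq> {}" using A(3) B(3) by auto
  obtain C where C: "\<And>x. x \<in> X \<union> Y \<union> Z \<Longrightarrow> \<bar>x\<bar> \<le> C"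
    using compact_imp_bounded[OF compact_Un[OF compact_Un[OF X Y] Z]] by (auto simp: bounded_iff)
  obtain a where "a \<in> X" using A(1) Ane by blast
  then have C0: "0 \<le> C" using C[of a] by simp
  have cvm: "\<phi> \<in> borel_measurable borel" if "convex_on UNIV \<phi>" for \<phi> :: "real \<Rightarrow> real"
    by (rule borel_measurable_continuous_onI[OF convex_on_UNIV_continuous[OF that]])
  have YC: "AE y in borel_ext \<mu>Y. \<bar>y\<bar> \<le> C"
    by (subst borel_ext(5)[OF \<mu>Y]) (use C borel_probsD(3)[OF \<mu>Y] in auto)
  obtain N :: "real measure" and Q :: "real \<Rightarrow> real" where N: "prob_space N" "sets N = sets borel" "\<And>x. measure N {x} = 0"
    "measure N (- {0..1}) = 0" and Q: "mono Q" "\<And>u. \<bar>Q u\<bar> \<le> C" and dQ: "distr N borel Q = borel_ext \<mu>Y"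
    using quantile_representation[OF borel_ext(1,2)[OF \<mu>Y] YC] by metis
  interpret N: prob_space N by fact
  have Qm[measurable]: "Q \<in> borel_measurable borel" by (rule borel_measurable_mono[OF Q(1)])
  note N(2)[measurable_cong]
  have intQ: "(\<integral>u. f (Q u) \<partial>N) = (\<integral>y. f y \<partial>\<mu>Y)" if f: "f \<in> borel_measurable borel" for f :: "real \<Rightarrow> real"
  proof -
    have "(\<integral>u. f (Q u) \<partial>N) = (\<integral>y. f y \<partial>distr N borel Q)" using f by (intro integral_distr[symmetric]) auto
    then show ?thesis using borel_ext(3)[OF \<mu>Y f] dQ by simp
  qed
  have QB: "AE u in N. Q u \<in> B"
  proof -
    have "Measurable.pred borel (\<lambda>y. y \<in> B)" using countable_borel[OF B(2)] by simp
    then have "AE y in distr N borel Q. y \<in> B" unfolding dQ using borel_ext(5)[OF \<mu>Y] B(3) by blast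
    then show ?thesis using countable_borel[OF B(2)] by (subst (asm) AE_distr_iff) auto
  qed
  define fA where "fA = from_nat_into A"
  have fA: "fA n \<in> A" for n using from_nat_into[OF Ane] by (simp add: fA_def)
  have fAC: "\<bar>fA n\<bar> \<le> C" for n using fA A(1) C by blast
  have codeX: "enum_code A \<in> measurable \<mu>X (count_space UNIV)"
    by (rule borel_probs_measurable[OF \<mu>X measurable_enum_code[OF A(2)]])
  have decX: "AE x in \<mu>X. fA (enum_code A x) = x"
    using A(3) by eventually_elim (simp add: fA_def from_nat_into_enum_code[OF A(2)])
  have intX: "(\<integral>x. f (fA (enum_code A x)) \<partial>\<mu>X) = (\<integral>x. f x \<partial>\<mu>X)" if f: "f \<in> borel_measurable borel" for f :: "real \<Rightarrow> real"
  proof (rule integral_cong_AE)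
    show "(\<lambda>x. f (fA (enum_code A x))) \<in> borel_measurable \<mu>X" by (rule measurable_compose[OF codeX]) simp
    show "f \<in> borel_measurable \<mu>X" by (rule borel_probs_measurable[OF \<mu>X f])
    show "AE x in \<mu>X. f (fA (enum_code A x)) = f x" using decX by eventually_elim simp
  qed
  have ordX: "(\<integral>x. \<phi> (fA (enum_code A x)) \<partial>\<mu>X) \<le> (\<integral>u. \<phi> (Q u) \<partial>N)" if "convex_on UNIV \<phi>" for \<phi>
    using XY that intX[OF cvm[OF that]] intQ[OF cvm[OF that]] by (simp add: convex_order_def)
  obtain T where T[measurable]: "T \<in> measurable borel (count_space UNIV)"
    and dT: "distr N (count_space UNIV) T = distr \<mu>X (count_space UNIV) (enum_code A)"
    and mT: "\<And>g B. (\<forall>n::nat. \<bar>g n\<bar> \<le> B) \<Longrightarrow> (\<integral>u. g (T u) * (Q u - fA (T u)) \<partial>N) = 0"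
    using atomic_conditional_mean[where y = fA, OF N.finite_measure_axioms N(2-4) zero_le_one Q
        \<mu>X.finite_measure_axioms codeX fAC ordX] by blast
  have TN[measurable]: "T \<in> measurable N (count_space UNIV)" by simp
  have fT[measurable]: "(\<lambda>u. f (T u)) \<in> borel_measurable N" for f :: "nat \<Rightarrow> real"
    by (rule measurable_compose[OF TN]) simp
  have intT: "(\<integral>u. f (fA (T u)) \<partial>N) = (\<integral>x. f x \<partial>\<mu>X)" if f: "f \<in> borel_measurable borel" for f :: "real \<Rightarrow> real"
  proof -
    have "(\<integral>u. f (fA (T u)) \<partial>N) = (\<integral>n. f (fA n) \<partial>distr N (count_space UNIV) T)"
      by (intro integral_distr[symmetric]) auto
    also have "\<dots> = (\<integral>x. f (fA (enum_code A x)) \<partial>\<mu>X)"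
      unfolding dT using codeX by (intro integral_distr) auto
    finally show ?thesis using intX[OF f] by simp
  qed
  define P where "P = A \<times> B"
  have P: "countable P" "P \<noteq> {}" using A(2) B(2) Ane Bne by (auto simp: P_def)
  define fP where "fP = from_nat_into P"
  have fP: "fP n \<in> P" for n using from_nat_into[OF P(2)] by (simp add: fP_def)
  have sfPC: "\<bar>snd (fP n)\<bar> \<le> C" for n using fP[of n] B(1) C by (auto simp: P_def mem_Times_iff)
  \<comment> \<open>The index numbers pairs rather than values of \<open>y\<close>: in the second
    step the mean of \<open>z\<close> must be \<open>y\<close> given both \<open>x\<close> and
    \<open>y\<close>.\<close>
  define \<xi> where "\<xi> u = enum_code P (fA (T u), Q u)" for u
  have pairm[measurable]: "(\<lambda>u. (fA (T u), Q u)) \<in> borel_measurable N"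
    by (intro borel_measurable_Pair fT) auto
  have \<xi>m: "\<xi> \<in> measurable N (count_space UNIV)"
    unfolding \<xi>_def by (rule measurable_compose[OF pairm measurable_enum_code[OF P(1)]])
  have dec: "AE u in N. fP (\<xi> u) = (fA (T u), Q u)"
    using QB by eventually_elim (use fA in \<open>auto simp: fP_def \<xi>_def P_def intro!: from_nat_into_enum_code A(2) B(2)\<close>)
  have int\<xi>: "(\<integral>u. h (fP (\<xi> u)) \<partial>N) = (\<integral>u. h (fA (T u), Q u) \<partial>N)"
    if h: "h \<in> borel_measurable borel" for h :: "real \<times> real \<Rightarrow> real"
  proof (rule integral_cong_AE)
    show "(\<lambda>u. h (fP (\<xi> u))) \<in> borel_measurable N" by (rule measurable_compose[OF \<xi>m]) simp
    show "(\<lambda>u. h (fA (T u), Q u)) \<in> borel_measurable N" by (rule measurable_compose[OF pairm h])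
    show "AE u in N. h (fP (\<xi> u)) = h (fA (T u), Q u)" using dec by eventually_elim simp
  qed
  let ?N2 = "borel_ext \<mu>Z"
  note sN2 = borel_ext(2)[OF \<mu>Z]
  note sN2[measurable_cong]
  interpret N2: prob_space ?N2 by (rule borel_ext(1)[OF \<mu>Z])
  \<comment> \<open>Here \<open>\<mu>Z\<close> has no atoms and is its own model. The identity would
    be unbounded on the line, so the clamp takes the role of \<open>Q\<close>; it is the identity on
    \<open>Z\<close>.\<close>
  define cl where "cl x = max (- C) (min C x)" for x
  have clm: "mono cl" by (auto simp: cl_def mono_def)
  have clC: "\<bar>cl x\<bar> \<le> C" for x using C0 by (auto simp: cl_def abs_le_iff)
  have clZ: "cl z = z" if "z \<in> Z" for z using C[of z] that by (auto simp: cl_def abs_le_iff)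
  have [measurable]: "cl \<in> borel_measurable borel" by (rule borel_measurable_mono[OF clm])
  have ordZ: "(\<integral>u. \<phi> (snd (fP (\<xi> u))) \<partial>N) \<le> (\<integral>z. \<phi> (cl z) \<partial>?N2)" if cv: "convex_on UNIV \<phi>" for \<phi>
  proof -
    have [measurable]: "\<phi> \<in> borel_measurable borel" by (rule cvm[OF cv])
    have "(\<integral>u. \<phi> (snd (fP (\<xi> u))) \<partial>N) = (\<integral>u. \<phi> (Q u) \<partial>N)"
      using int\<xi>[OF measurable_compose[OF borel_measurable_snd_real cvm[OF cv]]] by simp
    also have "\<dots> = (\<integral>y. \<phi> y \<partial>\<mu>Y)" by (rule intQ) simp
    also have "\<dots> \<le> (\<integral>z. \<phi> z \<partial>\<mu>Z)" using YZ cv by (simp add: convex_order_def)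
    also have "\<dots> = (\<integral>z. \<phi> (cl z) \<partial>\<mu>Z)"
      using clZ borel_probsD(3)[OF \<mu>Z] by (intro lebesgue_cong) auto
    also have "\<dots> = (\<integral>z. \<phi> (cl z) \<partial>?N2)" by (rule borel_ext(3)[OF \<mu>Z, symmetric]) simp
    finally show ?thesis .
  qed
  have N2at: "measure ?N2 {z} = 0" for z using borel_ext(4)[OF \<mu>Z, of "{z}"] atomless[of z] by simp
  have N2supp: "measure ?N2 (- {-C..C}) = 0"
  proof -
    have "- {-C..C} \<inter> Z = {}" using C by (force simp: abs_le_iff)
    then show ?thesis using borel_ext(4)[OF \<mu>Z, of "- {-C..C}"] by simp
  qed
  have CC: "- C \<le> C" using C0 by simp
  obtain T' where T'[measurable]: "T' \<in> measurable borel (count_space UNIV)"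
    and dT': "distr ?N2 (count_space UNIV) T' = distr N (count_space UNIV) \<xi>"
    and mT': "\<And>g B. (\<forall>n::nat. \<bar>g n\<bar> \<le> B) \<Longrightarrow> (\<integral>u. g (T' u) * (cl u - snd (fP (T' u))) \<partial>?N2) = 0"
    using atomic_conditional_mean[where y = "\<lambda>n. snd (fP n)", OF N2.finite_measure_axioms sN2 N2at N2supp CC clm clC
        N.finite_measure_axioms \<xi>m sfPC ordZ] by blast
  have T'N[measurable]: "T' \<in> measurable ?N2 (count_space UNIV)" by simp
  define W where "W z = fP (T' z)" for z
  have WP: "fst (W z) \<in> X" "snd (W z) \<in> Y" for z
    using fP[of "T' z"] A(1) B(1) by (auto simp: W_def P_def mem_Times_iff)
  have hW: "(\<lambda>z. h (W z)) \<in> borel_measurable borel" for h :: "real \<times> real \<Rightarrow> real"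
    unfolding W_def by (rule measurable_compose[OF T']) simp
  have intW: "(\<integral>z. h (W z) \<partial>\<mu>Z) = (\<integral>u. h (fA (T u), Q u) \<partial>N)"
    if h: "h \<in> borel_measurable borel" for h :: "real \<times> real \<Rightarrow> real"
  proof -
    have "(\<integral>z. h (W z) \<partial>\<mu>Z) = (\<integral>z. h (fP (T' z)) \<partial>?N2)"
      using borel_ext(3)[OF \<mu>Z hW[of h]] by (simp only: W_def)
    also have "\<dots> = (\<integral>n. h (fP n) \<partial>distr ?N2 (count_space UNIV) T')"
      by (intro integral_distr[symmetric]) auto
    also have "\<dots> = (\<integral>u. h (fP (\<xi> u)) \<partial>N)"
      unfolding dT' using \<xi>m by (intro integral_distr) auto
    finally show ?thesis using int\<xi>[OF h] by simp
  qed
  define F where "F z = (fst (W z), snd (W z), z)" for z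
  let ?M = "restrict_space borel (X \<times> Y \<times> Z)"
  have Fb: "F \<in> borel_measurable borel"
    unfolding F_def by (intro borel_measurable_Pair hW) auto
  have F: "F \<in> measurable \<mu>Z ?M"
    using borel_probs_measurable[OF \<mu>Z Fb] WP borel_probsD(3)[OF \<mu>Z]
    by (intro measurable_restrict_space2) (auto simp: F_def)
  define \<pi> where "\<pi> = distr \<mu>Z ?M F"
  have int\<pi>: "(\<integral>\<omega>. k \<omega> \<partial>\<pi>) = (\<integral>z. k (F z) \<partial>\<mu>Z)" if "k \<in> borel_measurable borel" for k :: "real \<times> real \<times> real \<Rightarrow> real"
    unfolding \<pi>_def by (intro integral_distr F measurable_restrict_space1 that)
  have "\<pi> \<in> martingale_couplings X Y Z \<mu>X \<mu>Y \<mu>Z"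
    unfolding martingale_couplings_iff[OF X Y Z \<mu>X \<mu>Y \<mu>Z]
  proof (intro conjI)
    show "prob_space \<pi>" unfolding \<pi>_def by (rule \<mu>Z.prob_space_distr[OF F])
    show "sets \<pi> = sets ?M" by (simp add: \<pi>_def)
    note cm = constraint_functions_measurable[of _ UNIV]
    have fm: "(\<lambda>p. indicator S (fst p) :: real) \<in> borel_measurable (borel :: (real \<times> real) measure)"
      and sm: "(\<lambda>p. indicator S (snd p) :: real) \<in> borel_measurable (borel :: (real \<times> real) measure)"
      if "S \<in> sets borel" for S
      using that by measurable
    have c1: "(\<integral>\<omega>. indicator S (fst \<omega>) \<partial>\<pi>) = measure \<mu>X (S \<inter> X)" if S: "S \<in> sets borel" for S
    proof -
      have "(\<integral>\<omega>. indicat_real S (fst \<omega>) \<partial>\<pi>) = (\<integral>z. indicator S (fst (W z)) \<partial>\<mu>Z)"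
        using int\<pi>[OF cm(1)[OF S]] by (simp add: F_def)
      also have "\<dots> = (\<integral>u. indicator S (fA (T u)) \<partial>N)"
        using intW[OF fm[OF S]] by simp
      also have "\<dots> = (\<integral>x. indicator S x \<partial>\<mu>X)" by (rule intT) (use S in simp)
      finally show ?thesis using borel_probsD(3)[OF \<mu>X] by simp
    qed
    have c2: "(\<integral>\<omega>. indicator S (fst (snd \<omega>)) \<partial>\<pi>) = measure \<mu>Y (S \<inter> Y)" if S: "S \<in> sets borel" for S
    proof -
      have "(\<integral>\<omega>. indicat_real S (fst (snd \<omega>)) \<partial>\<pi>) = (\<integral>z. indicator S (snd (W z)) \<partial>\<mu>Z)"
        using int\<pi>[OF cm(2)[OF S]] by (simp add: F_def)
      also have "\<dots> = (\<integral>u. indicator S (Q u) \<partial>N)"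
        using intW[OF sm[OF S]] by simp
      also have "\<dots> = (\<integral>x. indicator S x \<partial>\<mu>Y)" by (rule intQ) (use S in simp)
      finally show ?thesis using borel_probsD(3)[OF \<mu>Y] by simp
    qed
    have c3: "(\<integral>\<omega>. indicator S (snd (snd \<omega>)) \<partial>\<pi>) = measure \<mu>Z (S \<inter> Z)" if S: "S \<in> sets borel" for S
    proof -
      have "(\<integral>\<omega>. indicat_real S (snd (snd \<omega>)) \<partial>\<pi>) = (\<integral>z. indicator S z \<partial>\<mu>Z)"
        using int\<pi>[OF cm(3)[OF S]] by (simp add: F_def)
      then show ?thesis using borel_probsD(3)[OF \<mu>Z] by simp
    qed
    have c4: "(\<integral>\<omega>. indicator S (fst \<omega>) * (fst (snd \<omega>) - fst \<omega>) \<partial>\<pi>) = 0" if S: "S \<in> sets borel" for S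
    proof -
      have m: "(\<lambda>p. indicator S (fst p) * (snd p - fst p)) \<in> borel_measurable (borel :: (real \<times> real) measure)"
        using fm[OF S] by measurable
      have "(\<integral>\<omega>. indicator S (fst \<omega>) * (fst (snd \<omega>) - fst \<omega>) \<partial>\<pi>)
          = (\<integral>z. indicator S (fst (W z)) * (snd (W z) - fst (W z)) \<partial>\<mu>Z)"
        using int\<pi>[OF cm(4)[OF S]] by (simp add: F_def)
      also have "\<dots> = (\<integral>u. indicator S (fA (T u)) * (Q u - fA (T u)) \<partial>N)"
        using intW[OF m] by simp
      also have "\<dots> = 0" by (rule mT[of "\<lambda>n. indicator S (fA n)" 1]) (auto simp: indicator_def)
      finally show ?thesis .
    qed
    have c5: "(\<integral>\<omega>. indicator S (fst \<omega>, fst (snd \<omega>)) * (snd (snd \<omega>) - fst (snd \<omega>)) \<partial>\<pi>) = 0" if S: "S \<in> sets borel" for S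
    proof -
      have m: "(\<lambda>z. indicator S (fP (T' z)) * (cl z - snd (fP (T' z)))) \<in> borel_measurable borel"
        using hW[of "indicator S"] hW[of snd] unfolding W_def by measurable
      have "(\<integral>\<omega>. indicator S (fst \<omega>, fst (snd \<omega>)) * (snd (snd \<omega>) - fst (snd \<omega>)) \<partial>\<pi>)
          = (\<integral>z. indicator S (W z) * (z - snd (W z)) \<partial>\<mu>Z)"
        using int\<pi>[OF constraint_functions_measurable(5)[of "{}", OF _ S]] by (simp add: F_def)
      also have "\<dots> = (\<integral>z. indicator S (fP (T' z)) * (cl z - snd (fP (T' z))) \<partial>\<mu>Z)"
        using clZ borel_probsD(3)[OF \<mu>Z] by (intro lebesgue_cong) (auto simp: W_def)
      also have "\<dots> = (\<integral>z. indicator S (fP (T' z)) * (cl z - snd (fP (T' z))) \<partial>?N2)"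
        by (rule borel_ext(3)[OF \<mu>Z m, symmetric])
      also have "\<dots> = 0" by (rule mT'[of "\<lambda>n. indicator S (fP n)" 1]) (auto simp: indicator_def)
      finally show ?thesis .
    qed
    show "\<forall>(k, v)\<in>coupling_constraints X Y Z \<mu>X \<mu>Y \<mu>Z. (\<integral>\<omega>. k \<omega> \<partial>\<pi>) = v"
      using c1 c2 c3 c4 c5 by (simp add: coupling_constraints_def ball_Un)
  qed
  then show ?thesis by blast
qed

section \<open>Existence of an optimal coupling\<close>

text \<open>The identity is measurable in both directions. This identifies the \<sigma>-algebra of
  the product measure with the one that \<open>borel_probs\<close> prescribes on
  \<open>X \<times> Y \<times> Z\<close>.\<close>

lemma sets_pair_restrict_borel:
  fixes X :: "'a::second_countable_topology set" and Y :: "'b::second_countable_topology set"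
  shows "sets (restrict_space borel X \<Otimes>\<^sub>M restrict_space borel Y) = sets (restrict_space borel (X \<times> Y))"
    (is "sets ?P = sets ?R")
proof -
  have sp: "space ?P = X \<times> Y" "space ?R = X \<times> Y" by (simp_all add: space_pair_measure space_restrict_space)
  have f: "fst \<in> measurable (borel \<Otimes>\<^sub>M borel :: ('a \<times> 'b) measure) borel"
    "snd \<in> measurable (borel \<Otimes>\<^sub>M borel :: ('a \<times> 'b) measure) borel" by auto
  have "(\<lambda>p. (fst p, snd p)) \<in> measurable ?R ?P"
    using f[unfolded borel_prod]
    by (intro measurable_Pair measurable_restrict_space2 measurable_restrict_space1) (auto simp: space_restrict_space)
  then have 1: "(\<lambda>p. p) \<in> measurable ?R ?P" by simp
  have "(\<lambda>p. (fst p, snd p)) \<in> measurable ?P (borel \<Otimes>\<^sub>M borel)"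
    by (intro measurable_Pair measurable_compose[OF measurable_fst] measurable_compose[OF measurable_snd]
        measurable_restrict_space1) auto
  then have 2: "(\<lambda>p. p) \<in> measurable ?P ?R"
    by (intro measurable_restrict_space2) (auto simp: borel_prod sp)
  show ?thesis
  proof (intro equalityI subsetI)
    fix S assume S: "S \<in> sets ?P"
    have "(\<lambda>p. p) -` S \<inter> space ?R \<in> sets ?R" by (rule measurable_sets[OF 1 S])
    then show "S \<in> sets ?R" using sets.sets_into_space[OF S] sp by (simp add: Int_absorb2)
  next
    fix S assume S: "S \<in> sets ?R"
    have "(\<lambda>p. p) -` S \<inter> space ?P \<in> sets ?P" by (rule measurable_sets[OF 2 S])
    then show "S \<in> sets ?P" using sets.sets_into_space[OF S] sp by (simp add: Int_absorb2)
  qed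
qed

text \<open>Continuity from above along finite initial segments of an enumeration of
  \<open>A\<close>.\<close>

lemma finite_set_of_large_measure:
  fixes \<mu> :: "'a::t1_space measure"
  assumes \<mu>: "\<mu> \<in> borel_probs S" and A: "A \<subseteq> S" "countable A" "AE x in \<mu>. x \<in> A" and \<epsilon>: "0 < \<epsilon>"
  obtains F where "finite F" "F \<subseteq> A" "measure \<mu> (S - F) < \<epsilon>"
proof -
  interpret prob_space \<mu> by (rule borel_probsD(1)[OF \<mu>])
  have sp: "space \<mu> = S" by (rule borel_probsD(3)[OF \<mu>])
  have ne: "A \<noteq> {}" using A(3) by auto
  have cs: "F \<in> sets \<mu>" if "F \<subseteq> S" "countable F" for F
    unfolding borel_probsD(2)[OF \<mu>] sets_restrict_space
    using countable_borel[OF that(2)] that(1) by (auto intro!: image_eqI[of _ _ F])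
  define F where "F n = from_nat_into A ` {..<n}" for n
  have FA: "F n \<subseteq> A" for n using from_nat_into[OF ne] by (auto simp: F_def)
  have Fs: "F n \<in> sets \<mu>" for n by (intro cs) (use FA A(1) in \<open>auto simp: F_def\<close>)
  have "(\<lambda>n. measure \<mu> (S - F n)) \<longlonglongrightarrow> measure \<mu> (\<Inter>n. S - F n)"
  proof (rule finite_Lim_measure_decseq)
    show "range (\<lambda>n. S - F n) \<subseteq> sets \<mu>" using Fs sp by (auto intro: sets.compl_sets)
    show "decseq (\<lambda>n. S - F n)" by (intro decseq_SucI) (auto simp: F_def)
  qed
  moreover have "(\<Inter>n. S - F n) = S - A"
  proof -
    have "(\<Union>n. F n) = A"
    proof (intro equalityI subsetI)
      fix x assume "x \<in> A"
      then obtain n where "from_nat_into A n = x" using from_nat_into_surj[OF A(2)] by blast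
      then have "x \<in> F (Suc n)" unfolding F_def by blast
      then show "x \<in> (\<Union>n. F n)" by blast
    qed (use FA in blast)
    then show ?thesis by auto
  qed
  moreover have "measure \<mu> (S - A) = 0"
  proof -
    have "AE x in \<mu>. x \<notin> S - A" using A(3) by eventually_elim auto
    moreover have "S - A \<in> sets \<mu>" using cs[OF A(1,2)] sp by (auto intro: sets.compl_sets)
    ultimately show ?thesis by (simp add: AE_iff_measurable prob_eq_0)
  qed
  ultimately have "(\<lambda>n. measure \<mu> (S - F n)) \<longlonglongrightarrow> 0" by simp
  then have "eventually (\<lambda>n. measure \<mu> (S - F n) < \<epsilon>) sequentially"
    using \<epsilon> by (rule order_tendstoD)
  then obtain n where "measure \<mu> (S - F n) < \<epsilon>" by (auto simp: eventually_sequentially)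
  then show thesis using that[of "F n"] FA by (auto simp: F_def)
qed

locale discrete_mot =
  fixes X Y Z A B :: "real set" and \<mu>X \<mu>Y \<mu>Z :: "real measure"
  assumes X: "compact X" and Y: "compact Y" and Z: "compact Z"
    and \<mu>X: "\<mu>X \<in> borel_probs X" and \<mu>Y: "\<mu>Y \<in> borel_probs Y" and \<mu>Z: "\<mu>Z \<in> borel_probs Z"
    and A: "A \<subseteq> X" "countable A" "AE x in \<mu>X. x \<in> A"
    and B: "B \<subseteq> Y" "countable B" "AE y in \<mu>Y. y \<in> B"
begin

sublocale \<mu>X: prob_space \<mu>X by (rule borel_probsD(1)[OF \<mu>X])
sublocale \<mu>Y: prob_space \<mu>Y by (rule borel_probsD(1)[OF \<mu>Y])
sublocale \<mu>Z: prob_space \<mu>Z by (rule borel_probsD(1)[OF \<mu>Z])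
sublocale YZ: pair_prob_space \<mu>Y \<mu>Z ..
sublocale XYZ: pair_prob_space \<mu>X "\<mu>Y \<Otimes>\<^sub>M \<mu>Z" ..

text \<open>The reference measure for densities. It dominates every coupling, because
  \<open>\<mu>X\<close> and \<open>\<mu>Y\<close> are carried by countable sets.\<close>

definition \<kappa> :: "(real \<times> real \<times> real) measure" where
  "\<kappa> = \<mu>X \<Otimes>\<^sub>M \<mu>Y \<Otimes>\<^sub>M \<mu>Z"

abbreviation couplings where "couplings \<equiv> martingale_couplings X Y Z \<mu>X \<mu>Y \<mu>Z"
abbreviation constraints where "constraints \<equiv> coupling_constraints X Y Z \<mu>X \<mu>Y \<mu>Z"

lemma space_\<mu>: "space \<mu>X = X" "space \<mu>Y = Y" "space \<mu>Z = Z"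
  using borel_probsD(3) \<mu>X \<mu>Y \<mu>Z by auto

sublocale \<kappa>: prob_space \<kappa>
  unfolding \<kappa>_def by unfold_locales

lemma sets_\<kappa>: "sets \<kappa> = sets (restrict_space borel (X \<times> Y \<times> Z))"
proof -
  have "sets \<kappa> = sets (restrict_space borel X \<Otimes>\<^sub>M restrict_space borel Y \<Otimes>\<^sub>M restrict_space borel Z)"
    unfolding \<kappa>_def by (intro sets_pair_measure_cong borel_probsD(2) \<mu>X \<mu>Y \<mu>Z)
  also have "\<dots> = sets (restrict_space borel X \<Otimes>\<^sub>M restrict_space borel (Y \<times> Z))"
    by (intro sets_pair_measure_cong refl sets_pair_restrict_borel)
  also have "\<dots> = sets (restrict_space borel (X \<times> Y \<times> Z))" by (rule sets_pair_restrict_borel)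
  finally show ?thesis .
qed

lemma space_\<kappa>: "space \<kappa> = X \<times> Y \<times> Z"
  by (simp add: \<kappa>_def space_pair_measure space_\<mu>)

lemma measurable_\<kappa>: "f \<in> measurable borel M \<Longrightarrow> f \<in> measurable \<kappa> M"
  using measurable_restrict_space1[of f borel M "X \<times> Y \<times> Z"] measurable_cong_sets[OF sets_\<kappa> refl, of M] by blast

lemma measurable_\<mu>: 
  assumes "f \<in> measurable borel M"
  shows "f \<in> measurable \<mu>X M" "f \<in> measurable \<mu>Y M" "f \<in> measurable \<mu>Z M"
  using borel_probs_measurable assms \<mu>X \<mu>Y \<mu>Z by blast+

lemma coordinate_bound: obtains C where "0 \<le> C" "\<And>x. x \<in> X \<union> Y \<union> Z \<Longrightarrow> \<bar>x\<bar> \<le> C"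
proof -
  obtain C where "\<And>x. x \<in> X \<union> Y \<union> Z \<Longrightarrow> \<bar>x\<bar> \<le> C"
    using compact_imp_bounded[OF compact_Un[OF compact_Un[OF X Y] Z]] by (auto simp: bounded_iff)
  then show thesis by (intro that[of "\<bar>C\<bar>"]) fastforce+
qed

lemma constraints_bounded:
  assumes "(k, v) \<in> constraints"
  shows "k \<in> borel_measurable borel" and "\<exists>C. \<forall>\<omega>\<in>X \<times> Y \<times> Z. \<bar>k \<omega>\<bar> \<le> C"
proof -
  show "k \<in> borel_measurable borel"
    using assms unfolding coupling_constraints_def
    by (auto intro!: constraint_functions_measurable(1-4)[OF _ sets.empty_sets] constraint_functions_measurable(5)[OF sets.empty_sets])
  obtain C where C: "0 \<le> C" "\<And>x. x \<in> X \<union> Y \<union> Z \<Longrightarrow> \<bar>x\<bar> \<le> C"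
    using coordinate_bound by blast
  have d: "\<bar>b - a\<bar> \<le> 2 * C + 1" if "a \<in> X \<union> Y \<union> Z" "b \<in> X \<union> Y \<union> Z" for a b
    using C(2)[OF that(1)] C(2)[OF that(2)] by linarith
  have "\<forall>\<omega>\<in>X \<times> Y \<times> Z. \<bar>k \<omega>\<bar> \<le> 2 * C + 1"
    using assms d C(1) unfolding coupling_constraints_def by (auto simp: indicator_def)
  then show "\<exists>C. \<forall>\<omega>\<in>X \<times> Y \<times> Z. \<bar>k \<omega>\<bar> \<le> C" by blast
qed

lemma countable_sets_\<mu>: "countable S \<Longrightarrow> S \<subseteq> X \<Longrightarrow> S \<in> sets \<mu>X" "countable S \<Longrightarrow> S \<subseteq> Y \<Longrightarrow> S \<in> sets \<mu>Y"
  using countable_borel[of S] borel_probsD(2)[OF \<mu>X] borel_probsD(2)[OF \<mu>Y]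
  by (auto simp: sets_restrict_space intro!: image_eqI[of _ _ S])

section \<open>Marginals of couplings and their absolute continuity\<close>

lemma coupling_distr:
  assumes \<pi>: "\<pi> \<in> couplings"
  shows "prob_space \<pi>" and "sets \<pi> = sets \<kappa>"
    and "fst \<in> measurable \<pi> \<mu>X" and "distr \<pi> \<mu>X fst = \<mu>X"
    and "(\<lambda>\<omega>. fst (snd \<omega>)) \<in> measurable \<pi> \<mu>Y" and "distr \<pi> \<mu>Y (\<lambda>\<omega>. fst (snd \<omega>)) = \<mu>Y"
    and "(\<lambda>\<omega>. snd (snd \<omega>)) \<in> measurable \<pi> \<mu>Z" and "distr \<pi> \<mu>Z (\<lambda>\<omega>. snd (snd \<omega>)) = \<mu>Z"
proof -
  show "prob_space \<pi>" and s: "sets \<pi> = sets \<kappa>"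
    using \<pi> unfolding martingale_couplings_iff[OF X Y Z \<mu>X \<mu>Y \<mu>Z] sets_\<kappa> by blast+
  show "fst \<in> measurable \<pi> \<mu>X" "(\<lambda>\<omega>. fst (snd \<omega>)) \<in> measurable \<pi> \<mu>Y"
    "(\<lambda>\<omega>. snd (snd \<omega>)) \<in> measurable \<pi> \<mu>Z"
    unfolding measurable_cong_sets[OF s refl] \<kappa>_def
    by (rule measurable_fst measurable_compose[OF measurable_snd measurable_fst]
        measurable_compose[OF measurable_snd measurable_snd])+
  have "distr \<pi> (restrict_space borel X) fst = \<mu>X"
    "distr \<pi> (restrict_space borel Y) (\<lambda>\<omega>. fst (snd \<omega>)) = \<mu>Y"
    "distr \<pi> (restrict_space borel Z) (\<lambda>\<omega>. snd (snd \<omega>)) = \<mu>Z"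
    using \<pi> unfolding martingale_couplings_def mem_Collect_eq case_prod_unfold by blast+
  then show "distr \<pi> \<mu>X fst = \<mu>X" "distr \<pi> \<mu>Y (\<lambda>\<omega>. fst (snd \<omega>)) = \<mu>Y"
    "distr \<pi> \<mu>Z (\<lambda>\<omega>. snd (snd \<omega>)) = \<mu>Z"
    using distr_cong[OF refl borel_probsD(2)[OF \<mu>X], of \<pi>] distr_cong[OF refl borel_probsD(2)[OF \<mu>Y], of \<pi>]
      distr_cong[OF refl borel_probsD(2)[OF \<mu>Z], of \<pi>] by metis+
qed

lemma coupling_marginals:
  assumes \<pi>: "\<pi> \<in> couplings"
  shows "S \<in> sets \<mu>X \<Longrightarrow> measure \<pi> (S \<times> Y \<times> Z) = measure \<mu>X S"
    and "S \<in> sets \<mu>Y \<Longrightarrow> measure \<pi> (X \<times> S \<times> Z) = measure \<mu>Y S"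
    and "S \<in> sets \<mu>Z \<Longrightarrow> measure \<pi> (X \<times> Y \<times> S) = measure \<mu>Z S"
proof -
  note d = coupling_distr[OF \<pi>]
  have sp: "space \<pi> = X \<times> Y \<times> Z" using sets_eq_imp_space_eq[OF d(2)] space_\<kappa> by simp
  { assume S: "S \<in> sets \<mu>X"
    have "fst -` S \<inter> space \<pi> = S \<times> Y \<times> Z" using sets.sets_into_space[OF S] by (auto simp: sp space_\<mu>)
    then show "measure \<pi> (S \<times> Y \<times> Z) = measure \<mu>X S" using measure_distr[OF d(3) S] d(4) by simp }
  { assume S: "S \<in> sets \<mu>Y"
    have "(\<lambda>\<omega>. fst (snd \<omega>)) -` S \<inter> space \<pi> = X \<times> S \<times> Z"
      using sets.sets_into_space[OF S] by (auto simp: sp space_\<mu>)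
    then show "measure \<pi> (X \<times> S \<times> Z) = measure \<mu>Y S" using measure_distr[OF d(5) S] d(6) by simp }
  { assume S: "S \<in> sets \<mu>Z"
    have "(\<lambda>\<omega>. snd (snd \<omega>)) -` S \<inter> space \<pi> = X \<times> Y \<times> S"
      using sets.sets_into_space[OF S] by (auto simp: sp space_\<mu>)
    then show "measure \<pi> (X \<times> Y \<times> S) = measure \<mu>Z S" using measure_distr[OF d(7) S] d(8) by simp }
qed

lemma AE_coupling_marginals:
  assumes \<pi>: "\<pi> \<in> couplings"
  shows "(AE x in \<mu>X. R x) \<Longrightarrow> AE \<omega> in \<pi>. R (fst \<omega>)"
    and "(AE y in \<mu>Y. R y) \<Longrightarrow> AE \<omega> in \<pi>. R (fst (snd \<omega>))"
    and "(AE z in \<mu>Z. R z) \<Longrightarrow> AE \<omega> in \<pi>. R (snd (snd \<omega>))"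
  by (rule AE_distrD[OF coupling_distr(3)[OF \<pi>], unfolded coupling_distr(4)[OF \<pi>]]
      AE_distrD[OF coupling_distr(5)[OF \<pi>], unfolded coupling_distr(6)[OF \<pi>]]
      AE_distrD[OF coupling_distr(7)[OF \<pi>], unfolded coupling_distr(8)[OF \<pi>]]; assumption)+

definition fibre :: "(real \<times> real \<times> real) set \<Rightarrow> real \<Rightarrow> real \<Rightarrow> real set" where
  "fibre S x y = {z. (x, y, z) \<in> S}"

lemma fibre_sets: "S \<in> sets \<kappa> \<Longrightarrow> fibre S x y \<in> sets \<mu>Z"
  unfolding \<kappa>_def fibre_def using sets_Pair1[OF sets_Pair1, of S \<mu>X \<mu>Y \<mu>Z y x] by (simp add: vimage_def)

lemma times_in_sets_\<kappa>: "P \<in> sets \<mu>X \<Longrightarrow> Q \<in> sets \<mu>Y \<Longrightarrow> R \<in> sets \<mu>Z \<Longrightarrow> P \<times> Q \<times> R \<in> sets \<kappa>"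
  unfolding \<kappa>_def by (intro pair_measureI)

lemma measure_\<kappa>_times:
  assumes "P \<in> sets \<mu>X" "Q \<in> sets \<mu>Y" "R \<in> sets \<mu>Z"
  shows "measure \<kappa> (P \<times> Q \<times> R) = measure \<mu>X P * (measure \<mu>Y Q * measure \<mu>Z R)"
  using assms unfolding \<kappa>_def by (simp add: measure_def \<mu>Z.emeasure_pair_measure_Times YZ.P.emeasure_pair_measure_Times enn2real_mult)

text \<open>All but 2/3 of \<open>\<epsilon>\<close> of the mass lies over finitely many pairs of
  atoms. Over one pair, the part of \<open>S\<close> projects to its section in \<open>Z\<close>;
  the \<open>\<mu>Z\<close>-mass of the section bounds the \<open>\<pi>\<close>-mass by the third
  marginal, and equals the \<open>\<kappa>\<close>-measure of that part divided by the weight of the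
  pair. Only the marginals enter, so \<open>\<delta>\<close> serves all couplings.\<close>

lemma couplings_uniformly_continuous:
  assumes \<epsilon>: "0 < \<epsilon>"
  shows "\<exists>\<delta>>0. \<forall>\<pi>\<in>couplings. \<forall>S\<in>sets \<kappa>. measure \<kappa> S < \<delta> \<longrightarrow> measure \<pi> S \<le> \<epsilon>"
proof -
  have e3: "0 < \<epsilon> / 3" using \<epsilon> by simp
  obtain F where F: "finite F" "F \<subseteq> A" "measure \<mu>X (X - F) < \<epsilon> / 3"
    by (rule finite_set_of_large_measure[OF \<mu>X A e3])
  obtain G where G: "finite G" "G \<subseteq> B" "measure \<mu>Y (Y - G) < \<epsilon> / 3"
    by (rule finite_set_of_large_measure[OF \<mu>Y B e3])
  define w where "w p = measure \<mu>X {fst p} * measure \<mu>Y {snd p}" for p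
  \<comment> \<open>The share of one pair in the remaining third of \<open>\<epsilon>\<close>; the
    added 1 keeps the denominator positive when there are no pairs.\<close>
  define \<eta> where "\<eta> = \<epsilon> / (3 * (real (card (F \<times> G)) + 1))"
  have \<eta>: "0 < \<eta>" "real (card (F \<times> G)) * \<eta> \<le> \<epsilon> / 3"
    using \<epsilon> by (auto simp: \<eta>_def field_simps)
  \<comment> \<open>Only pairs of positive weight impose a condition, since a pair of weight zero
    lies on a null line of one marginal and carries no \<open>\<pi>\<close>-mass. The inserted 1
    keeps the set nonempty.\<close>
  define \<delta> where "\<delta> = Min (insert 1 ((\<lambda>p. w p * \<eta>) ` {p \<in> F \<times> G. 0 < w p}))"
  have fin: "finite (insert 1 ((\<lambda>p. w p * \<eta>) ` {p \<in> F \<times> G. 0 < w p}))"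
    using F(1) G(1) by (auto intro: finite_subset[OF _ finite_cartesian_product])
  have \<delta>0: "0 < \<delta>" unfolding \<delta>_def using fin \<eta>(1) by (subst Min_gr_iff) auto
  have \<delta>w: "\<delta> \<le> w p * \<eta>" if "p \<in> F \<times> G" "0 < w p" for p
    unfolding \<delta>_def using fin that by (intro Min_le) auto
  have FX: "F \<subseteq> X" and GY: "G \<subseteq> Y" using F G A B by auto
  have mF: "F \<in> sets \<mu>X" "G \<in> sets \<mu>Y" using F(1) G(1) FX GY by (auto intro!: countable_sets_\<mu> countable_finite)
  have "measure \<pi> S \<le> \<epsilon>" if \<pi>: "\<pi> \<in> couplings" and S: "S \<in> sets \<kappa>" and small: "measure \<kappa> S < \<delta>" for \<pi> S
  proof -
    note M = coupling_marginals[OF \<pi>] coupling_distr(1,2)[OF \<pi>]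
    interpret \<pi>: prob_space \<pi> by (rule M(4))
    have sp: "space \<pi> = X \<times> Y \<times> Z" using sets_eq_imp_space_eq[OF M(5)] space_\<kappa> by simp
    have atom: "measure \<pi> (S \<inter> {x} \<times> {y} \<times> Z) \<le> \<eta>" if p: "(x, y) \<in> F \<times> G" for x y
    proof -
      have xs: "{x} \<in> sets \<mu>X" "{y} \<in> sets \<mu>Y" using p FX GY by (auto intro!: countable_sets_\<mu>)
      have ZZ: "Z \<in> sets \<mu>Z" "X \<in> sets \<mu>X" "Y \<in> sets \<mu>Y" using sets.top[of \<mu>Z] sets.top[of \<mu>X] sets.top[of \<mu>Y] by (simp_all add: space_\<mu>)
      have Ssub: "S \<subseteq> X \<times> Y \<times> Z" using sets.sets_into_space[OF S] space_\<kappa> by simp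
      note fs = fibre_sets[OF S, of x y]
      show ?thesis
      proof (cases "0 < w (x, y)")
        case False
        then have "measure \<mu>X {x} = 0 \<or> measure \<mu>Y {y} = 0"
          by (simp add: w_def zero_less_mult_iff) (meson measure_nonneg order_antisym_conv not_less)
        moreover have "measure \<pi> (S \<inter> {x} \<times> {y} \<times> Z) \<le> measure \<pi> ({x} \<times> Y \<times> Z)"
          using p GY by (intro \<pi>.finite_measure_mono) (auto simp: M(5) intro!: times_in_sets_\<kappa> xs ZZ)
        moreover have "measure \<pi> (S \<inter> {x} \<times> {y} \<times> Z) \<le> measure \<pi> (X \<times> {y} \<times> Z)"
          using p FX by (intro \<pi>.finite_measure_mono) (auto simp: M(5) intro!: times_in_sets_\<kappa> xs ZZ)
        ultimately show ?thesis using M(1)[OF xs(1)] M(2)[OF xs(2)] \<eta>(1) by auto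
      next
        case True
        have "w (x, y) * measure \<mu>Z (fibre S x y) = measure \<kappa> ({x} \<times> {y} \<times> fibre S x y)"
          by (simp add: measure_\<kappa>_times[OF xs fs] w_def)
        also have "\<dots> \<le> measure \<kappa> S"
          by (intro \<kappa>.finite_measure_mono S) (auto simp: fibre_def)
        also have "\<dots> \<le> w (x, y) * \<eta>" using small \<delta>w[OF p True] by simp
        finally have "measure \<mu>Z (fibre S x y) \<le> \<eta>" using True by simp
        moreover have "measure \<pi> (S \<inter> {x} \<times> {y} \<times> Z) \<le> measure \<pi> (X \<times> Y \<times> fibre S x y)"
          using Ssub by (intro \<pi>.finite_measure_mono) (auto simp: M(5) fibre_def[symmetric] intro!: times_in_sets_\<kappa> fs ZZ, auto simp: fibre_def)
        ultimately show ?thesis using M(3)[OF fs] by simp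
      qed
    qed
    have Zs: "Z \<in> sets \<mu>Z" "X \<in> sets \<mu>X" "Y \<in> sets \<mu>Y" using sets.top[of \<mu>Z] sets.top[of \<mu>X] sets.top[of \<mu>Y] by (simp_all add: space_\<mu>)
    have d: "X - F \<in> sets \<mu>X" "Y - G \<in> sets \<mu>Y" using mF Zs by auto
    let ?U = "\<Union>p\<in>F \<times> G. S \<inter> {fst p} \<times> {snd p} \<times> Z"
    have Us: "S \<inter> {fst p} \<times> {snd p} \<times> Z \<in> sets \<pi>" if "p \<in> F \<times> G" for p
      using that FX GY S Zs unfolding M(5) by (intro sets.Int times_in_sets_\<kappa> countable_sets_\<mu>) auto
    have "measure \<pi> S \<le> measure \<pi> (((X - F) \<times> Y \<times> Z \<union> X \<times> (Y - G) \<times> Z) \<union> ?U)"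
    proof (rule \<pi>.finite_measure_mono)
      show "S \<subseteq> ((X - F) \<times> Y \<times> Z \<union> X \<times> (Y - G) \<times> Z) \<union> ?U"
        using sets.sets_into_space[OF S] space_\<kappa> by force
      show "((X - F) \<times> Y \<times> Z \<union> X \<times> (Y - G) \<times> Z) \<union> ?U \<in> sets \<pi>"
        using F(1) G(1) Us d Zs by (intro sets.Un sets.finite_UN) (auto simp: M(5) intro!: times_in_sets_\<kappa>)
    qed
    also have "\<dots> \<le> measure \<pi> ((X - F) \<times> Y \<times> Z \<union> X \<times> (Y - G) \<times> Z) + measure \<pi> ?U"
      using F(1) G(1) Us d Zs by (intro measure_Un_le sets.Un sets.finite_UN) (auto simp: M(5) intro!: times_in_sets_\<kappa>)
    also have "\<dots> \<le> (measure \<pi> ((X - F) \<times> Y \<times> Z) + measure \<pi> (X \<times> (Y - G) \<times> Z)) + measure \<pi> ?U"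
      using d Zs by (intro add_right_mono measure_Un_le) (auto simp: M(5) intro!: times_in_sets_\<kappa>)
    also have "measure \<pi> ((X - F) \<times> Y \<times> Z) = measure \<mu>X (X - F)" by (rule M(1)[OF d(1)])
    also have "measure \<pi> (X \<times> (Y - G) \<times> Z) = measure \<mu>Y (Y - G)" by (rule M(2)[OF d(2)])
    also have "measure \<pi> ?U \<le> (\<Sum>p\<in>F \<times> G. measure \<pi> (S \<inter> {fst p} \<times> {snd p} \<times> Z))"
      using F(1) G(1) Us by (intro \<pi>.finite_measure_subadditive_finite) auto
    also have "\<dots> \<le> (\<Sum>p\<in>F \<times> G. \<eta>)" using atom by (intro sum_mono) auto
    also have "\<dots> \<le> \<epsilon> / 3" using \<eta>(2) by simp
    finally show ?thesis using F(3) G(3) by simp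
  qed
  then show ?thesis using \<delta>0 by blast
qed

definition densities :: "(real \<times> real \<times> real \<Rightarrow> real) set" where
  "densities = {g. integrable \<kappa> g \<and> (\<forall>x. 0 \<le> g x) \<and> (\<integral>x. g x \<partial>\<kappa>) = 1 \<and>
      (\<forall>(k, v)\<in>constraints. (\<integral>x. g x * k x \<partial>\<kappa>) = v)}"

lemma integral_density_\<kappa>:
  assumes "g \<in> borel_measurable \<kappa>" "\<And>x. 0 \<le> g x" "k \<in> borel_measurable \<kappa>"
  shows "(\<integral>x. k x \<partial>density \<kappa> (\<lambda>x. ennreal (g x))) = (\<integral>x. g x * k x \<partial>\<kappa> :: real)"
  using assms by (intro integral_real_density) auto

lemma density_in_couplings:
  assumes g: "g \<in> densities"
  shows "density \<kappa> g \<in> couplings"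
proof -
  have gi: "integrable \<kappa> g" and g0: "\<And>x. 0 \<le> g x" and g1: "(\<integral>x. g x \<partial>\<kappa>) = 1"
    and gk: "\<And>k v. (k, v) \<in> constraints \<Longrightarrow> (\<integral>x. g x * k x \<partial>\<kappa>) = v"
    using g by (auto simp: densities_def)
  have gm: "g \<in> borel_measurable \<kappa>" using gi by auto
  have "emeasure (density \<kappa> g) (space (density \<kappa> g)) = (\<integral>\<^sup>+x. g x \<partial>\<kappa>)"
    using gm by (simp add: emeasure_density cong: nn_integral_cong)
  also have "\<dots> = 1" using nn_integral_eq_integral[OF gi] g0 g1 by simp
  finally have "prob_space (density \<kappa> g)" by (rule prob_spaceI)
  moreover have "(\<integral>\<omega>. k \<omega> \<partial>density \<kappa> g) = v" if "(k, v) \<in> constraints" for k v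
    using gk[OF that] integral_density_\<kappa>[OF gm g0 measurable_\<kappa>[OF constraints_bounded(1)[OF that]]] by simp
  ultimately show ?thesis
    unfolding martingale_couplings_iff[OF X Y Z \<mu>X \<mu>Y \<mu>Z] by (auto simp: sets_\<kappa>)
qed

text \<open>Absolute continuity is the case of \<open>\<kappa>\<close>-null sets in
  \<open>couplings_uniformly_continuous\<close>; the rest is the Radon-Nikodym theorem. With
  \<open>density_in_couplings\<close> the transport problem becomes one over
  \<open>densities\<close>.\<close>

lemma coupling_has_density:
  assumes \<pi>: "\<pi> \<in> couplings"
  obtains g where "g \<in> densities" "\<pi> = density \<kappa> g"
proof -
  note M = coupling_marginals[OF \<pi>] coupling_distr(1,2)[OF \<pi>]
  interpret \<pi>: prob_space \<pi> by (rule M(4))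
  have ac: "absolutely_continuous \<kappa> \<pi>"
    unfolding absolutely_continuous_def
  proof
    fix S assume S: "S \<in> null_sets \<kappa>"
    then have S': "S \<in> sets \<kappa>" "measure \<kappa> S = 0" by (auto simp: null_sets_def measure_def)
    have "measure \<pi> S \<le> \<epsilon>" if "0 < \<epsilon>" for \<epsilon>
      using couplings_uniformly_continuous[OF that] \<pi> S' by metis
    then have "measure \<pi> S \<le> 0" by (rule field_le_epsilon[of _ 0, simplified])
    then show "S \<in> null_sets \<pi>"
      using S'(1) M(5) by (auto simp: null_sets_def \<pi>.emeasure_eq_measure measure_le_0_iff)
  qed
  obtain g where gm: "g \<in> borel_measurable \<kappa>" and RN: "AE x in \<kappa>. RN_deriv \<kappa> \<pi> x = ennreal (g x)" and g0: "\<And>x. 0 \<le> g x"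
    using \<kappa>.real_RN_deriv[OF \<pi>.finite_measure_axioms ac M(5)] by metis
  have eq: "\<pi> = density \<kappa> g"
  proof -
    have "\<pi> = density \<kappa> (RN_deriv \<kappa> \<pi>)" using \<kappa>.density_RN_deriv[OF ac M(5)] by simp
    also have "\<dots> = density \<kappa> g" using RN gm by (intro density_cong) auto
    finally show ?thesis .
  qed
  have n1: "(\<integral>\<^sup>+x. g x \<partial>\<kappa>) = 1"
  proof -
    have "(\<integral>\<^sup>+x. g x \<partial>\<kappa>) = emeasure \<pi> (space \<pi>)"
      unfolding eq using gm by (simp add: emeasure_density cong: nn_integral_cong)
    then show ?thesis using \<pi>.emeasure_space_1 by simp
  qed
  have gi: "integrable \<kappa> g" using gm g0 n1 by (intro integrableI_nonneg) auto
  have "g \<in> densities"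
    unfolding densities_def mem_Collect_eq
  proof (intro conjI allI gi g0)
    show "(\<integral>x. g x \<partial>\<kappa>) = 1" using integral_eq_nn_integral[of g \<kappa>] gm g0 n1 by simp
    have all: "\<forall>(k, v)\<in>constraints. (\<integral>\<omega>. k \<omega> \<partial>\<pi>) = v"
      by (rule conjunct2[OF conjunct2[OF \<pi>[unfolded martingale_couplings_iff[OF X Y Z \<mu>X \<mu>Y \<mu>Z]]]])
    show "\<forall>(k, v)\<in>constraints. (\<integral>x. g x * k x \<partial>\<kappa>) = v"
    proof clarify
      fix k v assume kv: "(k, v) \<in> constraints"
      have "(\<integral>\<omega>. k \<omega> \<partial>\<pi>) = v" using bspec[OF all kv] by simp
      then show "(\<integral>x. g x * k x \<partial>\<kappa>) = v"
        using integral_density_\<kappa>[OF gm g0 measurable_\<kappa>[OF constraints_bounded(1)[OF kv]]] eq by simp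
    qed
  qed
  then show thesis using that[of g] eq by simp
qed

lemma optimal_density_exists:
  assumes ne: "couplings \<noteq> {}" and c: "c \<in> borel_measurable \<kappa>" and cb: "\<And>x. x \<in> space \<kappa> \<Longrightarrow> \<bar>c x\<bar> \<le> C"
  shows "\<exists>g\<in>densities. \<forall>g'\<in>densities. (\<integral>x. g x * c x \<partial>\<kappa>) \<le> (\<integral>x. g' x * c x \<partial>\<kappa>)"
proof (rule density_minimizer_exists[OF \<kappa>.finite_measure_axioms _ c cb])
  show "g \<in> densities \<longleftrightarrow> integrable \<kappa> g \<and> (\<forall>x. 0 \<le> g x) \<and> (\<integral>x. g x \<partial>\<kappa>) = 1 \<and>
      (\<forall>(k, v)\<in>constraints. (\<integral>x. g x * k x \<partial>\<kappa>) = v)" for g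
    by (simp add: densities_def)
  show "k \<in> borel_measurable \<kappa> \<and> (\<exists>C. \<forall>x\<in>space \<kappa>. \<bar>k x\<bar> \<le> C)" if "(k, v) \<in> constraints" for k v
    using constraints_bounded[OF that] measurable_\<kappa> space_\<kappa> by simp
  show "densities \<noteq> {}" using ne coupling_has_density by blast
  fix \<epsilon> :: real assume "0 < \<epsilon>"
  then obtain \<delta> where \<delta>: "0 < \<delta>" "\<And>\<pi> S. \<pi> \<in> couplings \<Longrightarrow> S \<in> sets \<kappa> \<Longrightarrow> measure \<kappa> S < \<delta> \<Longrightarrow> measure \<pi> S \<le> \<epsilon>"
    using couplings_uniformly_continuous by metis
  have "(\<integral>x. indicator S x * g x \<partial>\<kappa>) \<le> \<epsilon>" if g: "g \<in> densities" and S: "S \<in> sets \<kappa>" "measure \<kappa> S < \<delta>" for g S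
  proof -
    have gm: "g \<in> borel_measurable \<kappa>" and g0: "\<And>x. 0 \<le> g x" using g by (auto simp: densities_def)
    have "measure (density \<kappa> g) S = (\<integral>x. indicator S x \<partial>density \<kappa> g)" using S sets.sets_into_space[OF S(1)] by (simp add: Int_absorb2)
    also have "\<dots> = (\<integral>x. g x * indicator S x \<partial>\<kappa>)" using S by (intro integral_density_\<kappa> gm g0) auto
    finally show ?thesis using \<delta>(2)[OF density_in_couplings[OF g] S] by (simp add: mult.commute)
  qed
  then show "\<exists>\<delta>>0. \<forall>g\<in>densities. \<forall>S\<in>sets \<kappa>. measure \<kappa> S < \<delta> \<longrightarrow> (\<integral>x. indicator S x * g x \<partial>\<kappa>) \<le> \<epsilon>"
    using \<delta>(1) by blast
qed

end

section \<open>Uniqueness\<close>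

lemma AE_at_atom:
  assumes ae: "AE x in M. P x" and a: "measure M {a} > 0"
  shows "P a"
proof (rule ccontr)
  assume n: "\<not> P a"
  obtain N where N: "{x \<in> space M. \<not> P x} \<subseteq> N" "emeasure M N = 0" "N \<in> sets M"
    using ae by (rule AE_E)
  have as: "{a} \<in> sets M" using a by (metis measure_notin_sets order_less_irrefl)
  then have "a \<in> N" using N(1) n sets.sets_into_space by blast
  then have "emeasure M {a} \<le> emeasure M N" using N(3) by (intro emeasure_mono) auto
  then show False using N(2) a by (simp add: measure_def)
qed

lemma (in pair_sigma_finite) integral_on_atom:
  fixes f :: "'a \<times> 'b \<Rightarrow> real"
  assumes f: "integrable (M1 \<Otimes>\<^sub>M M2) f" and a: "measure M1 {a} > 0"
  shows "integrable M2 (\<lambda>y. f (a, y))"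
    and "(\<integral>p. indicator {a} (fst p) * f p \<partial>(M1 \<Otimes>\<^sub>M M2)) = measure M1 {a} * (\<integral>y. f (a, y) \<partial>M2)"
proof -
  show "integrable M2 (\<lambda>y. f (a, y))" by (rule AE_at_atom[OF AE_integrable_fst'[OF f] a])
  have as: "{a} \<in> sets M1" using a by (metis measure_notin_sets order_less_irrefl)
  have [measurable]: "f \<in> borel_measurable (M1 \<Otimes>\<^sub>M M2)" using f by auto
  have im: "(\<lambda>p. indicator {a} (fst p) :: real) \<in> borel_measurable (M1 \<Otimes>\<^sub>M M2)"
    by (rule measurable_compose[OF measurable_fst borel_measurable_indicator[OF as]])
  have "integrable (M1 \<Otimes>\<^sub>M M2) (\<lambda>p. indicator {a} (fst p) * f p)"
    by (rule Bochner_Integration.integrable_bound[OF f]) (use im in \<open>auto simp: indicator_def\<close>)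
  from integral_fst'[OF this]
  have "(\<integral>p. indicator {a} (fst p) * f p \<partial>(M1 \<Otimes>\<^sub>M M2)) = (\<integral>x. (\<integral>y. indicator {a} x * f (x, y) \<partial>M2) \<partial>M1)"
    by simp
  also have "\<dots> = (\<integral>x. indicator {a} x * (\<integral>y. f (a, y) \<partial>M2) \<partial>M1)"
    by (intro lebesgue_cong refl) (auto simp: indicator_def)
  also have "\<dots> = measure M1 {a} * (\<integral>y. f (a, y) \<partial>M2)"
    using as sets.sets_into_space[OF as] by (simp add: Int_absorb2)
  finally show "(\<integral>p. indicator {a} (fst p) * f p \<partial>(M1 \<Otimes>\<^sub>M M2)) = measure M1 {a} * (\<integral>y. f (a, y) \<partial>M2)" .
qed

text \<open>The normal equations of least squares in L2(\<open>\<rho>\<close>). They are solvable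
  also in the degenerate cases, where \<open>\<rho>\<close> vanishes almost everywhere or
  \<open>t\<close> is constant with respect to \<open>\<rho>\<close>.\<close>

lemma affine_regression:
  fixes \<rho> d t :: "'a \<Rightarrow> real"
  assumes \<rho>: "integrable M \<rho>" "\<And>x. 0 \<le> \<rho> x"
    and d: "d \<in> borel_measurable M" "\<And>x. x \<in> space M \<Longrightarrow> \<bar>d x\<bar> \<le> C"
    and t: "t \<in> borel_measurable M" "\<And>x. x \<in> space M \<Longrightarrow> \<bar>t x\<bar> \<le> C"
  obtains a b where "(\<integral>x. \<rho> x * (d x - a * t x - b) \<partial>M) = 0"
    and "(\<integral>x. \<rho> x * (d x - a * t x - b) * t x \<partial>M) = 0"
proof -
  have [measurable]: "\<rho> \<in> borel_measurable M" "d \<in> borel_measurable M" "t \<in> borel_measurable M" using \<rho> d t by auto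
  have I: "integrable M (\<lambda>x. f x * d x)" "integrable M (\<lambda>x. f x * t x)" if "integrable M f" for f
    using integrable_mult_bounded[OF that d] integrable_mult_bounded[OF that t] by auto
  define m0 where "m0 = (\<integral>x. \<rho> x \<partial>M)"
  show thesis
  proof (cases "m0 = 0")
    case True
    then have "AE x in M. \<rho> x = 0"
      unfolding m0_def using integral_nonneg_eq_0_iff_AE[OF \<rho>(1)] \<rho>(2) by auto
    then have "AE x in M. \<rho> x * (d x - 0 * t x - 0) = 0" "AE x in M. \<rho> x * (d x - 0 * t x - 0) * t x = 0"
      by auto
    then show thesis by (intro that[of 0 0] integral_eq_zero_AE)
  next
    case False
    define m where "m = (\<integral>x. \<rho> x * t x \<partial>M) / m0"
    \<comment> \<open>Centring \<open>t\<close> makes it orthogonal to the constants, so the two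
      normal equations decouple.\<close>
    define e where "e x = t x - m" for x
    have [measurable]: "e \<in> borel_measurable M" unfolding e_def by measurable
    have Ie: "integrable M (\<lambda>x. f x * e x)" if "integrable M f" for f
      using I(2)[OF that] that by (simp add: e_def right_diff_distrib)
    define V where "V = (\<integral>x. \<rho> x * e x * e x \<partial>M)"
    define a where "a = (\<integral>x. \<rho> x * d x * e x \<partial>M) / V"
    define d0 where "d0 = (\<integral>x. \<rho> x * d x \<partial>M) / m0"
    have e0: "(\<integral>x. \<rho> x * e x \<partial>M) = 0"
      using I(2)[OF \<rho>(1)] \<rho>(1) False by (simp add: e_def right_diff_distrib m_def m0_def)
    define s where "s x = d x - a * t x - (d0 - a * m)" for x
    have s_eq: "s x = d x - d0 - a * e x" for x by (simp add: s_def e_def algebra_simps)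
    have s0: "(\<integral>x. \<rho> x * s x \<partial>M) = 0"
    proof -
      have "(\<integral>x. \<rho> x * s x \<partial>M) = (\<integral>x. \<rho> x * d x - d0 * \<rho> x - a * (\<rho> x * e x) \<partial>M)"
        by (intro lebesgue_cong refl) (simp add: s_eq algebra_simps)
      also have "\<dots> = (\<integral>x. \<rho> x * d x \<partial>M) - d0 * m0 - a * 0"
        using I(1)[OF \<rho>(1)] Ie[OF \<rho>(1)] \<rho>(1) e0 by (simp add: m0_def)
      finally show ?thesis using False by (simp add: d0_def)
    qed
    have se: "(\<integral>x. \<rho> x * s x * e x \<partial>M) = 0"
    proof (cases "V = 0")
      case True
      \<comment> \<open>With zero variance the centred variable vanishes on the carrier of
        \<open>\<rho>\<close>, so the equation holds for any slope, in particular for the value 0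
        that division by zero gives to \<open>a\<close>.\<close>
      have "AE x in M. \<rho> x * e x * e x = 0"
        using True integral_nonneg_eq_0_iff_AE[OF Ie[OF Ie[OF \<rho>(1)]]] \<rho>(2) unfolding V_def
        by (simp add: mult.assoc)
      then have "AE x in M. \<rho> x * s x * e x = 0" by eventually_elim auto
      then show ?thesis by (rule integral_eq_zero_AE)
    next
      case False
      have "(\<integral>x. \<rho> x * s x * e x \<partial>M) = (\<integral>x. \<rho> x * d x * e x - d0 * (\<rho> x * e x) - a * (\<rho> x * e x * e x) \<partial>M)"
        by (intro lebesgue_cong refl) (simp add: s_eq algebra_simps)
      also have "\<dots> = (\<integral>x. \<rho> x * d x * e x \<partial>M) - d0 * 0 - a * V"
        using Ie[OF I(1)[OF \<rho>(1)]] Ie[OF \<rho>(1)] Ie[OF Ie[OF \<rho>(1)]] e0 by (simp add: V_def)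
      finally show ?thesis using False by (simp add: a_def)
    qed
    have Is: "integrable M (\<lambda>x. \<rho> x * s x)"
    proof -
      have "(\<lambda>x. \<rho> x * s x) = (\<lambda>x. \<rho> x * d x - d0 * \<rho> x - a * (\<rho> x * e x))"
        by (simp add: s_eq algebra_simps)
      then show ?thesis using I(1)[OF \<rho>(1)] Ie[OF \<rho>(1)] \<rho>(1) by simp
    qed
    have "(\<integral>x. \<rho> x * s x * t x \<partial>M) = (\<integral>x. \<rho> x * s x * e x + m * (\<rho> x * s x) \<partial>M)"
      by (intro lebesgue_cong refl) (simp add: e_def algebra_simps)
    also have "\<dots> = 0" using Ie[OF Is] Is se s0 by simp
    finally show thesis using s0 unfolding s_def by (intro that[of a "d0 - a * m"])
  qed
qed

section \<open>Exchange of mass between two atoms\<close>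

context discrete_mot
begin

definition atom_weight :: "real \<times> real \<Rightarrow> real" where
  "atom_weight p = measure \<mu>X {fst p} * measure \<mu>Y {snd p}"

definition at_atom :: "real \<times> real \<Rightarrow> real \<times> real \<times> real \<Rightarrow> real" where
  "at_atom p \<omega> = indicator {p} (fst \<omega>, fst (snd \<omega>))"

lemma at_atom_measurable: "at_atom p \<in> borel_measurable \<kappa>"
  unfolding at_atom_def
  by (rule measurable_\<kappa>[OF measurable_compose[OF borel_measurable_coordinates(3) borel_measurable_indicator]]) simp

lemma integral_at_atom:
  assumes f: "integrable \<kappa> f" and p: "0 < atom_weight p"
  shows "integrable \<mu>Z (\<lambda>z. f (fst p, snd p, z))"
    and "(\<integral>\<omega>. at_atom p \<omega> * f \<omega> \<partial>\<kappa>) = atom_weight p * (\<integral>z. f (fst p, snd p, z) \<partial>\<mu>Z)"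
proof -
  obtain x y where xy: "p = (x, y)" by force
  have wx: "0 < measure \<mu>X {x}" and wy: "0 < measure \<mu>Y {y}"
    using p measure_nonneg[of \<mu>X "{x}"] measure_nonneg[of \<mu>Y "{y}"]
    by (auto simp: atom_weight_def xy zero_less_mult_iff)
  have f': "integrable (\<mu>X \<Otimes>\<^sub>M \<mu>Y \<Otimes>\<^sub>M \<mu>Z) f" using f by (simp add: \<kappa>_def)
  have eq: "at_atom p \<omega> = indicator {x} (fst \<omega>) * indicator {y} (fst (snd \<omega>))" for \<omega>
    by (auto simp: at_atom_def xy indicator_def)
  have g: "integrable (\<mu>X \<Otimes>\<^sub>M \<mu>Y \<Otimes>\<^sub>M \<mu>Z) (\<lambda>\<omega>. at_atom p \<omega> * f \<omega>)"
  proof (rule Bochner_Integration.integrable_bound[OF f'])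
    show "(\<lambda>\<omega>. at_atom p \<omega> * f \<omega>) \<in> borel_measurable (\<mu>X \<Otimes>\<^sub>M \<mu>Y \<Otimes>\<^sub>M \<mu>Z)"
      using at_atom_measurable[of p] f' unfolding \<kappa>_def by (intro borel_measurable_times) auto
  qed (auto simp: at_atom_def indicator_def)
  have f2: "integrable (\<mu>Y \<Otimes>\<^sub>M \<mu>Z) (\<lambda>q. f (x, q))" by (rule XYZ.integral_on_atom(1)[OF f' wx])
  show "integrable \<mu>Z (\<lambda>z. f (fst p, snd p, z))" using YZ.integral_on_atom(1)[OF f2 wy] by (simp add: xy)
  have "(\<integral>\<omega>. at_atom p \<omega> * f \<omega> \<partial>\<kappa>) = (\<integral>\<omega>. indicator {x} (fst \<omega>) * (at_atom p \<omega> * f \<omega>) \<partial>(\<mu>X \<Otimes>\<^sub>M \<mu>Y \<Otimes>\<^sub>M \<mu>Z))"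
    unfolding \<kappa>_def by (intro lebesgue_cong refl) (auto simp: eq indicator_def)
  also have "\<dots> = measure \<mu>X {x} * (\<integral>q. at_atom p (x, q) * f (x, q) \<partial>(\<mu>Y \<Otimes>\<^sub>M \<mu>Z))"
    by (rule XYZ.integral_on_atom(2)[OF g wx])
  also have "(\<integral>q. at_atom p (x, q) * f (x, q) \<partial>(\<mu>Y \<Otimes>\<^sub>M \<mu>Z)) = (\<integral>q. indicator {y} (fst q) * f (x, q) \<partial>(\<mu>Y \<Otimes>\<^sub>M \<mu>Z))"
    by (simp add: eq)
  also have "\<dots> = measure \<mu>Y {y} * (\<integral>z. f (x, y, z) \<partial>\<mu>Z)" by (rule YZ.integral_on_atom(2)[OF f2 wy])
  finally show "(\<integral>\<omega>. at_atom p \<omega> * f \<omega> \<partial>\<kappa>) = atom_weight p * (\<integral>z. f (fst p, snd p, z) \<partial>\<mu>Z)"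
    by (simp add: atom_weight_def xy)
qed

text \<open>Moving mass between two atoms changes every constraint by an affine moment of the moved mass.\<close>

lemma constraints_differ_affinely:
  assumes "(k, v) \<in> constraints"
  obtains \<alpha> \<beta> where "\<And>z. k (x', y', z) - k (x, y, z) = \<alpha> + \<beta> * z"
proof -
  have "\<exists>\<alpha> \<beta>. \<forall>z. k (x', y', z) - k (x, y, z) = \<alpha> + \<beta> * z"
    using assms unfolding coupling_constraints_def
  proof (elim UnE imageE)
    fix S assume "(k, v) = (\<lambda>\<omega>. indicator S (fst \<omega>), measure \<mu>X (S \<inter> X))"
    then show ?thesis by (intro exI[of _ "indicator S x' - indicator S x"] exI[of _ 0]) simp
  next
    fix S assume "(k, v) = (\<lambda>\<omega>. indicator S (fst (snd \<omega>)), measure \<mu>Y (S \<inter> Y))"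
    then show ?thesis by (intro exI[of _ "indicator S y' - indicator S y"] exI[of _ 0]) simp
  next
    fix S assume "(k, v) = (\<lambda>\<omega>. indicator S (snd (snd \<omega>)), measure \<mu>Z (S \<inter> Z))"
    then show ?thesis by (intro exI[of _ 0]) simp
  next
    fix S assume "(k, v) = (\<lambda>\<omega>. indicator S (fst \<omega>) * (fst (snd \<omega>) - fst \<omega>), 0)"
    then show ?thesis
      by (intro exI[of _ "indicator S x' * (y' - x') - indicator S x * (y - x)"] exI[of _ 0]) simp
  next
    fix S assume "(k, v) = (\<lambda>\<omega>. indicator S (fst \<omega>, fst (snd \<omega>)) * (snd (snd \<omega>) - fst (snd \<omega>)), 0)"
    then show ?thesis
      by (intro exI[of _ "- indicator S (x', y') * y' + indicator S (x, y) * y"]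
          exI[of _ "indicator S (x', y') - indicator S (x, y)"]) (simp add: algebra_simps)
  qed
  then show thesis using that by blast
qed

lemma densities_midpoint:
  assumes g: "g \<in> densities" and h: "h \<in> densities"
  shows "(\<lambda>\<omega>. (g \<omega> + h \<omega>) / 2) \<in> densities"
    and "k \<in> borel_measurable \<kappa> \<Longrightarrow> (\<And>\<omega>. \<omega> \<in> space \<kappa> \<Longrightarrow> \<bar>k \<omega>\<bar> \<le> C) \<Longrightarrow>
      (\<integral>\<omega>. (g \<omega> + h \<omega>) / 2 * k \<omega> \<partial>\<kappa>) = ((\<integral>\<omega>. g \<omega> * k \<omega> \<partial>\<kappa>) + (\<integral>\<omega>. h \<omega> * k \<omega> \<partial>\<kappa>)) / 2"
proof -
  have gi: "integrable \<kappa> g" "integrable \<kappa> h" and nn: "\<And>\<omega>. 0 \<le> g \<omega>" "\<And>\<omega>. 0 \<le> h \<omega>"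
    and one: "(\<integral>\<omega>. g \<omega> \<partial>\<kappa>) = 1" "(\<integral>\<omega>. h \<omega> \<partial>\<kappa>) = 1"
    and gk: "\<And>k v. (k, v) \<in> constraints \<Longrightarrow> (\<integral>\<omega>. g \<omega> * k \<omega> \<partial>\<kappa>) = v"
    and hk: "\<And>k v. (k, v) \<in> constraints \<Longrightarrow> (\<integral>\<omega>. h \<omega> * k \<omega> \<partial>\<kappa>) = v"
    using g h by (auto simp: densities_def)
  show lin: "(\<integral>\<omega>. (g \<omega> + h \<omega>) / 2 * k \<omega> \<partial>\<kappa>) = ((\<integral>\<omega>. g \<omega> * k \<omega> \<partial>\<kappa>) + (\<integral>\<omega>. h \<omega> * k \<omega> \<partial>\<kappa>)) / 2"
    if "k \<in> borel_measurable \<kappa>" "\<And>\<omega>. \<omega> \<in> space \<kappa> \<Longrightarrow> \<bar>k \<omega>\<bar> \<le> C" for k C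
    using integrable_mult_bounded[OF gi(1) that] integrable_mult_bounded[OF gi(2) that]
    by (simp add: add_divide_distrib distrib_right)
  show "(\<lambda>\<omega>. (g \<omega> + h \<omega>) / 2) \<in> densities"
    unfolding densities_def mem_Collect_eq
  proof (intro conjI allI)
    show "integrable \<kappa> (\<lambda>\<omega>. (g \<omega> + h \<omega>) / 2)" using gi by simp
    show "0 \<le> (g \<omega> + h \<omega>) / 2" for \<omega> using nn by simp
    show "(\<integral>\<omega>. (g \<omega> + h \<omega>) / 2 \<partial>\<kappa>) = 1" using gi one by simp
    show "\<forall>(k, v)\<in>constraints. (\<integral>\<omega>. (g \<omega> + h \<omega>) / 2 * k \<omega> \<partial>\<kappa>) = v"
    proof clarify
      fix k v assume kv: "(k, v) \<in> constraints"
      obtain C where C: "\<And>\<omega>. \<omega> \<in> space \<kappa> \<Longrightarrow> \<bar>k \<omega>\<bar> \<le> C"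
        using constraints_bounded(2)[OF kv] unfolding space_\<kappa> by blast
      show "(\<integral>\<omega>. (g \<omega> + h \<omega>) / 2 * k \<omega> \<partial>\<kappa>) = v"
        using lin[OF measurable_\<kappa>[OF constraints_bounded(1)[OF kv]] C] gk[OF kv] hk[OF kv] by simp
    qed
  qed
qed

text \<open>The competitor is \<open>g' = g + r / S\<close>, where \<open>r\<close> moves the
  residual-weighted common mass between the two atoms and \<open>S\<close> bounds the residual, so
  that nowhere more mass is taken than is present. Optimality against \<open>g'\<close> forces the
  integral of \<open>\<rho> z * s z * s z\<close> to vanish, while \<open>twist\<close> keeps
  \<open>s\<close> away from 0 almost everywhere; hence the common part is null.\<close>

lemma optimal_density_overlap:
  fixes c :: "real \<times> real \<times> real \<Rightarrow> real"
  assumes g: "g \<in> densities" and opt: "\<And>g'. g' \<in> densities \<Longrightarrow> (\<integral>\<omega>. g \<omega> * c \<omega> \<partial>\<kappa>) \<le> (\<integral>\<omega>. g' \<omega> * c \<omega> \<partial>\<kappa>)"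
    and c: "c \<in> borel_measurable \<kappa>" and cb: "\<And>\<omega>. \<omega> \<in> space \<kappa> \<Longrightarrow> \<bar>c \<omega>\<bar> \<le> C"
    and pos: "0 < atom_weight p" "0 < atom_weight q" and pq: "p \<noteq> q"
    and pXY: "p \<in> X \<times> Y" "q \<in> X \<times> Y"
    and twist: "\<And>a b. AE z in \<mu>Z. c (fst p, snd p, z) - c (fst q, snd q, z) \<noteq> a * z + b"
  shows "AE z in \<mu>Z. min (g (fst p, snd p, z)) (g (fst q, snd q, z)) = 0"
proof -
  have gi: "integrable \<kappa> g" and g0: "\<And>\<omega>. 0 \<le> g \<omega>" and g1: "(\<integral>\<omega>. g \<omega> \<partial>\<kappa>) = 1"
    and gk: "\<And>k v. (k, v) \<in> constraints \<Longrightarrow> (\<integral>\<omega>. g \<omega> * k \<omega> \<partial>\<kappa>) = v"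
    using g by (auto simp: densities_def)
  \<comment> \<open>The mass over \<open>p\<close> as a density with respect to
    \<open>\<mu>Z\<close>. Equal amounts of mass are exchanged, so the common part is formed from
    these weighted densities and not from the values of \<open>g\<close>.\<close>
  define h where "h p z = atom_weight p * g (fst p, snd p, z)" for p z
  define \<rho> where "\<rho> z = min (h p z) (h q z)" for z
  have hi: "integrable \<mu>Z (h p)" "integrable \<mu>Z (h q)"
    unfolding h_def using integral_at_atom(1)[OF gi pos(1)] integral_at_atom(1)[OF gi pos(2)] by auto
  have \<rho>0: "0 \<le> \<rho> z" for z using g0 pos by (simp add: \<rho>_def h_def)
  have \<rho>i: "integrable \<mu>Z \<rho>" unfolding \<rho>_def using hi by (rule integrable_min)
  have \<rho>m[measurable]: "\<rho> \<in> borel_measurable \<mu>Z" using \<rho>i by auto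
  define d where "d z = c (fst p, snd p, z) - c (fst q, snd q, z)" for z
  have ci: "integrable \<kappa> c" using c cb by (intro \<kappa>.integrable_const_bound[of _ C]) auto
  have dm[measurable]: "d \<in> borel_measurable \<mu>Z"
    unfolding d_def using integral_at_atom(1)[OF ci pos(1)] integral_at_atom(1)[OF ci pos(2)] by measurable
  obtain K where K: "0 \<le> K" "\<And>x. x \<in> X \<union> Y \<union> Z \<Longrightarrow> \<bar>x\<bar> \<le> K" using coordinate_bound by blast
  define D where "D = 2 * \<bar>C\<bar> + K"
  have tm: "(\<lambda>z. z) \<in> borel_measurable \<mu>Z" by (rule measurable_\<mu>(3)) simp
  have tb: "\<bar>z\<bar> \<le> D" if "z \<in> space \<mu>Z" for z using K(2)[of z] that space_\<mu> by (simp add: D_def)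
  have db: "\<bar>d z\<bar> \<le> D" if "z \<in> space \<mu>Z" for z
  proof -
    have "(fst p, snd p, z) \<in> space \<kappa>" "(fst q, snd q, z) \<in> space \<kappa>"
      using that pXY by (auto simp: space_\<kappa> space_\<mu>)
    from cb[OF this(1)] cb[OF this(2)] show ?thesis using K(1) by (simp add: d_def D_def)
  qed
  obtain a b where ab0: "(\<integral>z. \<rho> z * (d z - a * z - b) \<partial>\<mu>Z) = 0"
    and ab1: "(\<integral>z. \<rho> z * (d z - a * z - b) * z \<partial>\<mu>Z) = 0"
    using affine_regression[OF \<rho>i \<rho>0 dm db tm tb] by blast
  \<comment> \<open>The residual is cut off outside \<open>Z\<close> to be bounded on the whole
    line: \<open>densities\<close> asks for nonnegativity at every point.\<close>
  define s where "s z = indicator Z z * (d z - a * z - b)" for z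
  have Zs: "Z \<in> sets \<mu>Z" using sets.top[of \<mu>Z] by (simp add: space_\<mu>)
  have sm[measurable]: "s \<in> borel_measurable \<mu>Z"
    unfolding s_def using Zs tm by measurable
  \<comment> \<open>A bound for the residual, from the bounds for \<open>d\<close> and
    \<open>z\<close>. The 1 keeps it positive as a divisor.\<close>
  define S where "S = D + \<bar>a\<bar> * D + \<bar>b\<bar> + 1"
  have D0: "0 \<le> D" using K(1) by (simp add: D_def)
  then have S0: "0 < S" by (simp add: S_def add_nonneg_pos)
  have sb: "\<bar>s z\<bar> \<le> S" for z
  proof (cases "z \<in> Z")
    case True
    then have z: "z \<in> space \<mu>Z" by (simp add: space_\<mu>)
    have "\<bar>a * z\<bar> \<le> \<bar>a\<bar> * D" using tb[OF z] by (simp add: abs_mult mult_left_mono)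
    then show ?thesis using db[OF z] True by (simp add: s_def S_def)
  next
    case False then show ?thesis using S0 by (simp add: s_def)
  qed
  have s_eq: "s z = d z - a * z - b" if "z \<in> space \<mu>Z" for z using that by (simp add: s_def space_\<mu>)
  have s0: "(\<integral>z. s z * \<rho> z \<partial>\<mu>Z) = 0"
    using ab0 by (subst lebesgue_cong[OF refl, of _ _ "\<lambda>z. \<rho> z * (d z - a * z - b)"]) (auto simp: s_eq mult.commute)
  have s1: "(\<integral>z. s z * \<rho> z * z \<partial>\<mu>Z) = 0"
    using ab1 by (subst lebesgue_cong[OF refl, of _ _ "\<lambda>z. \<rho> z * (d z - a * z - b) * z"]) (auto simp: s_eq mult.commute)
  have s\<rho>i: "integrable \<mu>Z (\<lambda>z. s z * \<rho> z)"
    using integrable_mult_bounded[OF \<rho>i sm sb] by (simp add: mult.commute)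
  have s\<rho>zi: "integrable \<mu>Z (\<lambda>z. s z * \<rho> z * z)"
    by (rule integrable_mult_bounded[OF s\<rho>i tm tb])
  \<comment> \<open>The \<open>\<kappa>\<close>-density of the signed mass with
    \<open>\<mu>Z\<close>-density \<open>s z * \<rho> z\<close>, placed over the atom
    \<open>p'\<close>. The division cancels the weight that \<open>integral_at_atom\<close>
    produces.\<close>
  define u where "u p' \<omega> = at_atom p' \<omega> * (s (snd (snd \<omega>)) * \<rho> (snd (snd \<omega>)) / atom_weight p')" for p' \<omega>
  have zm: "(\<lambda>\<omega>. snd (snd \<omega>)) \<in> measurable \<kappa> \<mu>Z"
    unfolding \<kappa>_def by (rule measurable_compose[OF measurable_snd measurable_snd])
  have um[measurable]: "u p' \<in> borel_measurable \<kappa>" for p'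
    unfolding u_def using at_atom_measurable[of p'] measurable_compose[OF zm sm] measurable_compose[OF zm \<rho>m] by measurable
  have ub: "\<bar>u p' \<omega>\<bar> \<le> S * (at_atom p' \<omega> * g \<omega>)" if "p' = p \<or> p' = q" for p' \<omega>
  proof (cases "(fst \<omega>, fst (snd \<omega>)) = p'")
    case False then show ?thesis by (simp add: u_def at_atom_def)
  next
    case True
    then have \<omega>: "\<omega> = (fst p', snd p', snd (snd \<omega>))" by (cases \<omega>) auto
    have w: "0 < atom_weight p'" using that pos by auto
    have "\<rho> (snd (snd \<omega>)) \<le> h p' (snd (snd \<omega>))" using that by (auto simp: \<rho>_def)
    also have "\<dots> = atom_weight p' * g \<omega>" unfolding h_def using \<omega> by simp
    finally have "\<rho> (snd (snd \<omega>)) / atom_weight p' \<le> g \<omega>" using w by (simp add: field_simps)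
    then have "\<bar>s (snd (snd \<omega>))\<bar> * (\<rho> (snd (snd \<omega>)) / atom_weight p') \<le> S * g \<omega>"
      using sb[of "snd (snd \<omega>)"] \<rho>0[of "snd (snd \<omega>)"] w S0 by (intro mult_mono) auto
    then show ?thesis using True \<rho>0[of "snd (snd \<omega>)"] w by (simp add: u_def at_atom_def abs_mult)
  qed
  have ui: "integrable \<kappa> (u p')" if "p' = p \<or> p' = q" for p'
  proof (rule Bochner_Integration.integrable_bound[OF integrable_mult_right[OF gi, of S]])
    show "AE \<omega> in \<kappa>. norm (u p' \<omega>) \<le> norm (S * g \<omega>)"
    proof (rule AE_I2)
      fix \<omega>
      have "S * (at_atom p' \<omega> * g \<omega>) \<le> S * g \<omega>" using S0 g0[of \<omega>] by (simp add: at_atom_def indicator_def)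
      with ub[OF that, of \<omega>] have "\<bar>u p' \<omega>\<bar> \<le> S * g \<omega>" by (rule order_trans)
      then show "norm (u p' \<omega>) \<le> norm (S * g \<omega>)" using S0 g0[of \<omega>] by (simp add: abs_mult)
    qed
  qed simp
  have uk: "integrable \<kappa> (\<lambda>\<omega>. u p' \<omega> * k \<omega>)" "(\<integral>\<omega>. u p' \<omega> * k \<omega> \<partial>\<kappa>) = (\<integral>z. s z * \<rho> z * k (fst p', snd p', z) \<partial>\<mu>Z)"
    "integrable \<mu>Z (\<lambda>z. s z * \<rho> z * k (fst p', snd p', z))"
    if p': "p' = p \<or> p' = q" and k: "k \<in> borel_measurable \<kappa>" "\<And>\<omega>. \<omega> \<in> space \<kappa> \<Longrightarrow> \<bar>k \<omega>\<bar> \<le> B" for p' k B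
  proof -
    have w: "0 < atom_weight p'" using p' pos by auto
    show i: "integrable \<kappa> (\<lambda>\<omega>. u p' \<omega> * k \<omega>)" by (rule integrable_mult_bounded[OF ui[OF p'] k])
    have at1: "at_atom p' (fst p', snd p', z) = 1" for z by (simp add: at_atom_def)
    have "(\<integral>\<omega>. u p' \<omega> * k \<omega> \<partial>\<kappa>) = (\<integral>\<omega>. at_atom p' \<omega> * (u p' \<omega> * k \<omega>) \<partial>\<kappa>)"
      by (intro lebesgue_cong refl) (auto simp: u_def at_atom_def indicator_def)
    also have "\<dots> = atom_weight p' * (\<integral>z. s z * \<rho> z / atom_weight p' * k (fst p', snd p', z) \<partial>\<mu>Z)"
      unfolding integral_at_atom(2)[OF i w] by (simp add: u_def at1)
    also have "\<dots> = (\<integral>z. s z * \<rho> z * k (fst p', snd p', z) \<partial>\<mu>Z)"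
      using w by (simp add: field_simps)
    finally show "(\<integral>\<omega>. u p' \<omega> * k \<omega> \<partial>\<kappa>) = (\<integral>z. s z * \<rho> z * k (fst p', snd p', z) \<partial>\<mu>Z)" .
    have "integrable \<mu>Z (\<lambda>z. atom_weight p' * (u p' (fst p', snd p', z) * k (fst p', snd p', z)))"
      by (intro integrable_mult_right integral_at_atom(1)[OF i w])
    then show "integrable \<mu>Z (\<lambda>z. s z * \<rho> z * k (fst p', snd p', z))"
      using w by (simp add: u_def at1)
  qed
  \<comment> \<open>Where the residual is positive, \<open>p\<close> is dearer than the regression
    predicts and mass goes from \<open>p\<close> to \<open>q\<close>; where it is negative, mass
    goes back.\<close>
  define r where "r \<omega> = u q \<omega> - u p \<omega>" for \<omega>
  have rk: "integrable \<kappa> (\<lambda>\<omega>. r \<omega> * k \<omega>)"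
    "(\<integral>\<omega>. r \<omega> * k \<omega> \<partial>\<kappa>) = (\<integral>z. s z * \<rho> z * (k (fst q, snd q, z) - k (fst p, snd p, z)) \<partial>\<mu>Z)"
    if k: "k \<in> borel_measurable \<kappa>" "\<And>\<omega>. \<omega> \<in> space \<kappa> \<Longrightarrow> \<bar>k \<omega>\<bar> \<le> B" for k B
    using uk[OF _ k, of p] uk[OF _ k, of q] by (auto simp: r_def left_diff_distrib right_diff_distrib)
  have affine0: "(\<integral>z. s z * \<rho> z * (\<alpha> + \<beta> * z) \<partial>\<mu>Z) = 0" for \<alpha> \<beta>
  proof -
    have "(\<integral>z. s z * \<rho> z * (\<alpha> + \<beta> * z) \<partial>\<mu>Z) = (\<integral>z. \<alpha> * (s z * \<rho> z) + \<beta> * (s z * \<rho> z * z) \<partial>\<mu>Z)"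
      by (intro lebesgue_cong refl) (simp add: algebra_simps)
    then show ?thesis using s\<rho>i s\<rho>zi s0 s1 by simp
  qed
  define g' where "g' \<omega> = g \<omega> + r \<omega> / S" for \<omega>
  have g'k: "(\<integral>\<omega>. g' \<omega> * k \<omega> \<partial>\<kappa>) = (\<integral>\<omega>. g \<omega> * k \<omega> \<partial>\<kappa>) + (\<integral>\<omega>. r \<omega> * k \<omega> \<partial>\<kappa>) / S"
    if k: "k \<in> borel_measurable \<kappa>" "\<And>\<omega>. \<omega> \<in> space \<kappa> \<Longrightarrow> \<bar>k \<omega>\<bar> \<le> B" for k B
    using integrable_mult_bounded[OF gi k] rk(1)[OF k] by (simp add: g'_def distrib_right)
  have "g' \<in> densities"
    unfolding densities_def mem_Collect_eq
  proof (intro conjI allI)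
    show "integrable \<kappa> g'" unfolding g'_def r_def using gi ui by simp
    show "0 \<le> g' \<omega>" for \<omega>
    proof -
      have "\<bar>r \<omega>\<bar> \<le> S * (at_atom q \<omega> * g \<omega>) + S * (at_atom p \<omega> * g \<omega>)"
        unfolding r_def using ub[of q \<omega>] ub[of p \<omega>] by auto
      also have "\<dots> = S * ((at_atom q \<omega> + at_atom p \<omega>) * g \<omega>)" by (simp add: algebra_simps)
      \<comment> \<open>The atoms are distinct, so at most one of the two indicators is 1 at a given
        point.\<close>
      also have "\<dots> \<le> S * (1 * g \<omega>)"
        using pq S0 g0[of \<omega>] by (intro mult_left_mono mult_right_mono) (auto simp: at_atom_def indicator_def)
      finally have "- (S * g \<omega>) \<le> r \<omega>" by simp
      then show ?thesis unfolding g'_def using S0 by (simp add: field_simps)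
    qed
    have "(\<integral>\<omega>. g' \<omega> * 1 \<partial>\<kappa>) = 1"
      using g'k[of "\<lambda>_. 1" 1] rk(2)[of "\<lambda>_. 1" 1] g1 by simp
    then show "(\<integral>\<omega>. g' \<omega> \<partial>\<kappa>) = 1" by simp
    show "\<forall>(k, v)\<in>constraints. (\<integral>\<omega>. g' \<omega> * k \<omega> \<partial>\<kappa>) = v"
    proof clarify
      fix k v assume kv: "(k, v) \<in> constraints"
      obtain B where B: "\<And>\<omega>. \<omega> \<in> space \<kappa> \<Longrightarrow> \<bar>k \<omega>\<bar> \<le> B"
        using constraints_bounded(2)[OF kv] unfolding space_\<kappa> by blast
      note km = measurable_\<kappa>[OF constraints_bounded(1)[OF kv]]
      obtain \<alpha> \<beta> where "\<And>z. k (fst q, snd q, z) - k (fst p, snd p, z) = \<alpha> + \<beta> * z"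
        using constraints_differ_affinely[OF kv] by blast
      then have "(\<integral>\<omega>. r \<omega> * k \<omega> \<partial>\<kappa>) = 0" using rk(2)[OF km B] affine0 by simp
      then show "(\<integral>\<omega>. g' \<omega> * k \<omega> \<partial>\<kappa>) = v" using g'k[OF km B] gk[OF kv] by simp
    qed
  qed
  from opt[OF this] have "0 \<le> (\<integral>\<omega>. r \<omega> * c \<omega> \<partial>\<kappa>)"
    using g'k[OF c cb] S0 by (simp add: zero_le_divide_iff)
  also have "\<dots> = (\<integral>z. s z * \<rho> z * (- d z) \<partial>\<mu>Z)" using rk(2)[OF c cb] by (simp add: d_def)
  \<comment> \<open>On \<open>Z\<close>, \<open>d z\<close> is \<open>s z + a * z + b\<close>. The
    affine part integrates to 0 by \<open>affine0\<close>, which leaves a negative weighted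
    square.\<close>
  also have "\<dots> = (\<integral>z. s z * \<rho> z * (- b + (- a) * z) - \<rho> z * s z * s z \<partial>\<mu>Z)"
    by (intro lebesgue_cong refl) (auto simp: s_eq algebra_simps)
  also have "\<dots> = 0 - (\<integral>z. \<rho> z * s z * s z \<partial>\<mu>Z)"
  proof -
    have "integrable \<mu>Z (\<lambda>z. s z * \<rho> z * (- b + (- a) * z))"
    proof -
      have "(\<lambda>z. s z * \<rho> z * (- b + (- a) * z)) = (\<lambda>z. (- b) * (s z * \<rho> z) + (- a) * (s z * \<rho> z * z))"
        by (simp add: algebra_simps)
      then show ?thesis using s\<rho>i s\<rho>zi by simp
    qed
    moreover have "integrable \<mu>Z (\<lambda>z. \<rho> z * s z * s z)"
      by (intro integrable_mult_bounded[OF _ sm sb] \<rho>i)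
    ultimately show ?thesis using affine0[of "- b" "- a"] by simp
  qed
  finally have le0: "(\<integral>z. \<rho> z * s z * s z \<partial>\<mu>Z) \<le> 0" by simp
  have nn: "0 \<le> \<rho> z * s z * s z" for z using \<rho>0[of z] by (simp add: mult.assoc)
  have int: "integrable \<mu>Z (\<lambda>z. \<rho> z * s z * s z)"
    by (intro integrable_mult_bounded[OF _ sm sb] \<rho>i)
  have "(\<integral>z. \<rho> z * s z * s z \<partial>\<mu>Z) = 0"
    using le0 nn by (intro antisym integral_nonneg_AE) auto
  then have "AE z in \<mu>Z. \<rho> z * s z * s z = 0"
    using integral_nonneg_eq_0_iff_AE[OF int] nn by auto
  with twist[of a b] AE_space show ?thesis
  proof eventually_elim
    case (elim z)
    then have "s z \<noteq> 0" by (simp add: s_eq d_def)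
    then have "\<rho> z = 0" using elim by simp
    then have "h p z = 0 \<or> h q z = 0" by (auto simp: \<rho>_def min_def split: if_splits)
    then have "g (fst p, snd p, z) = 0 \<or> g (fst q, snd q, z) = 0" using pos by (auto simp: h_def)
    then show ?case using g0[of "(fst p, snd p, z)"] g0[of "(fst q, snd q, z)"] by (auto simp: min_def)
  qed
qed

section \<open>Optimal couplings as graphs over the last coordinate\<close>

lemma AE_positive_atoms:
  assumes \<mu>: "\<mu> \<in> borel_probs S" and A: "A' \<subseteq> S" "countable A'" "AE x in \<mu>. x \<in> A'"
  shows "AE x in (\<mu> :: real measure). x \<in> A' \<and> 0 < measure \<mu> {x}"
proof -
  interpret prob_space \<mu> by (rule borel_probsD(1)[OF \<mu>])
  have "AE x in \<mu>. \<forall>a\<in>{a \<in> A'. measure \<mu> {a} = 0}. x \<noteq> a"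
  proof (subst AE_ball_countable)
    show "countable {a \<in> A'. measure \<mu> {a} = 0}" using A(2) by (rule countable_subset[rotated]) auto
    show "\<forall>a\<in>{a \<in> A'. measure \<mu> {a} = 0}. AE x in \<mu>. x \<noteq> a"
    proof
      fix a assume a: "a \<in> {a \<in> A'. measure \<mu> {a} = 0}"
      then have "{a} \<in> sets \<mu>"
        using A(1) unfolding borel_probsD(2)[OF \<mu>] sets_restrict_space by (auto intro!: image_eqI[of _ _ "{a}"])
      then have "{a} \<in> null_sets \<mu>" using a by (auto simp: null_sets_def emeasure_eq_measure)
      then show "AE x in \<mu>. x \<noteq> a" using AE_not_in by fastforce
    qed
  qed
  with A(3) show ?thesis
    by eventually_elim (auto simp: zero_less_measure_iff less_le)
qed

text \<open>Each of the two densities is at most twice the average \<open>g\<close>, so both are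
  carried where \<open>g\<close> is positive. On that carrier the pair \<open>(x, y)\<close> is
  almost surely a function of \<open>z\<close>, the same for both densities, and the measure of any
  set can be read off from the third marginal.\<close>

lemma optimal_density_unique:
  fixes c :: "real \<times> real \<times> real \<Rightarrow> real"
  assumes g: "g1 \<in> densities" "g2 \<in> densities"
    and opt: "\<And>g'. g' \<in> densities \<Longrightarrow> (\<integral>\<omega>. g1 \<omega> * c \<omega> \<partial>\<kappa>) \<le> (\<integral>\<omega>. g' \<omega> * c \<omega> \<partial>\<kappa>)"
      "\<And>g'. g' \<in> densities \<Longrightarrow> (\<integral>\<omega>. g2 \<omega> * c \<omega> \<partial>\<kappa>) \<le> (\<integral>\<omega>. g' \<omega> * c \<omega> \<partial>\<kappa>)"
    and c: "c \<in> borel_measurable \<kappa>" and cb: "\<And>\<omega>. \<omega> \<in> space \<kappa> \<Longrightarrow> \<bar>c \<omega>\<bar> \<le> C"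
    and twist: "\<And>p q a b. p \<in> A \<times> B \<Longrightarrow> q \<in> A \<times> B \<Longrightarrow> p \<noteq> q \<Longrightarrow>
      AE z in \<mu>Z. c (fst p, snd p, z) - c (fst q, snd q, z) \<noteq> a * z + b"
  shows "density \<kappa> g1 = density \<kappa> g2"
proof -
  define g where "g \<omega> = (g1 \<omega> + g2 \<omega>) / 2" for \<omega>
  have gD: "g \<in> densities" unfolding g_def by (rule densities_midpoint(1)[OF g])
  have gopt: "(\<integral>\<omega>. g \<omega> * c \<omega> \<partial>\<kappa>) \<le> (\<integral>\<omega>. g' \<omega> * c \<omega> \<partial>\<kappa>)" if "g' \<in> densities" for g'
    using densities_midpoint(2)[OF g c cb] opt(1)[OF that] opt(2)[OF that] by (simp add: g_def)
  have gi: "integrable \<kappa> g" using gD by (simp add: densities_def)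
  define P where "P = {p \<in> A \<times> B. 0 < atom_weight p}"
  have P: "countable P" unfolding P_def using A(2) B(2) by (simp add: countable_Collect)
  have "AE z in \<mu>Z. min (g (fst p, snd p, z)) (g (fst q, snd q, z)) = 0"
    if "p \<in> P" "q \<in> P" "p \<noteq> q" for p q
  proof (rule optimal_density_overlap[OF gD gopt c cb])
    show "p \<in> X \<times> Y" "q \<in> X \<times> Y" using that A(1) B(1) by (auto simp: P_def)
  qed (use that in \<open>auto simp: P_def intro!: twist\<close>)
  then have disj: "AE z in \<mu>Z. \<forall>p\<in>P. \<forall>q\<in>P. p \<noteq> q \<longrightarrow> min (g (fst p, snd p, z)) (g (fst q, snd q, z)) = 0"
    using P by (simp add: AE_ball_countable)
  \<comment> \<open>Up to null sets, \<open>S\<close> is the part of the carrier of \<open>g\<close> that lies over \<open>CC S\<close>.\<close>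
  define CC where "CC S = (\<Union>p\<in>P. fibre S (fst p) (snd p) \<inter> {z \<in> space \<mu>Z. 0 < g (fst p, snd p, z)})" for S
  have CCs: "CC S \<in> sets \<mu>Z" if "S \<in> sets \<kappa>" for S
    unfolding CC_def
  proof (rule sets.countable_UN'[OF P])
    show "(\<lambda>p. fibre S (fst p) (snd p) \<inter> {z \<in> space \<mu>Z. 0 < g (fst p, snd p, z)}) ` P \<subseteq> sets \<mu>Z"
    proof (rule image_subsetI)
      fix p assume "p \<in> P"
      then have [measurable]: "(\<lambda>z. g (fst p, snd p, z)) \<in> borel_measurable \<mu>Z"
        using integral_at_atom(1)[OF gi] by (auto simp: P_def)
      have "{z \<in> space \<mu>Z. 0 < g (fst p, snd p, z)} \<in> sets \<mu>Z" by measurable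
      then show "fibre S (fst p) (snd p) \<inter> {z \<in> space \<mu>Z. 0 < g (fst p, snd p, z)} \<in> sets \<mu>Z"
        using fibre_sets[OF that] by blast
    qed
  qed
  \<comment> \<open>The right-hand side depends on \<open>g\<close> but not on \<open>f\<close>, so
    the two densities can be compared through it.\<close>
  have key: "emeasure (density \<kappa> f) S = ennreal (measure \<mu>Z (CC S))"
    if S: "S \<in> sets \<kappa>" and f: "f \<in> densities" and fg: "\<And>\<omega>. f \<omega> \<le> 2 * g \<omega>" for f S
  proof -
    have \<pi>: "density \<kappa> f \<in> couplings" by (rule density_in_couplings[OF f])
    note M = coupling_marginals[OF \<pi>] coupling_distr(1,2)[OF \<pi>]
    interpret \<pi>: prob_space "density \<kappa> f" by (rule M(4))
    have fm: "f \<in> borel_measurable \<kappa>" using f by (auto simp: densities_def)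
    have gpos: "AE \<omega> in density \<kappa> f. 0 < g \<omega>"
    proof (subst AE_density)
      show "AE \<omega> in \<kappa>. 0 < ennreal (f \<omega>) \<longrightarrow> 0 < g \<omega>"
      proof (rule AE_I2, rule impI)
        fix \<omega> assume "0 < ennreal (f \<omega>)"
        then show "0 < g \<omega>" using fg[of \<omega>] by simp
      qed
    qed (use fm in measurable)
    \<comment> \<open>If \<open>z\<close> lies in \<open>CC S\<close> through a pair
      \<open>q\<close>, then \<open>g\<close> is positive both at \<open>q\<close> and at the actual
      pair \<open>(x, y)\<close>; by \<open>disj\<close> the two pairs coincide, so the actual point
      lies in \<open>S\<close>.\<close>
    have "AE \<omega> in density \<kappa> f. \<omega> \<in> S \<longleftrightarrow> \<omega> \<in> X \<times> Y \<times> CC S"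
      using AE_coupling_marginals(1)[OF \<pi> AE_positive_atoms[OF \<mu>X A]]
        AE_coupling_marginals(2)[OF \<pi> AE_positive_atoms[OF \<mu>Y B]]
        AE_coupling_marginals(3)[OF \<pi> disj] gpos AE_space
    proof eventually_elim
      case (elim \<omega>)
      obtain x y z where \<omega>: "\<omega> = (x, y, z)" by (cases \<omega>) auto
      have xyz: "x \<in> X" "y \<in> Y" "z \<in> Z" using elim(5) by (auto simp: space_\<kappa> \<omega>)
      have p: "(x, y) \<in> P" using elim(1,2) by (auto simp: P_def atom_weight_def \<omega>)
      show ?case
      proof
        assume "\<omega> \<in> S"
        then have "z \<in> CC S" unfolding CC_def using p elim(4) xyz
          by (intro UN_I[of "(x, y)"]) (auto simp: fibre_def \<omega> space_\<mu>)
        then show "\<omega> \<in> X \<times> Y \<times> CC S" using xyz by (simp add: \<omega>)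
      next
        assume "\<omega> \<in> X \<times> Y \<times> CC S"
        then have "z \<in> CC S" by (simp add: \<omega>)
        then obtain q where q: "q \<in> P" "z \<in> fibre S (fst q) (snd q)" "0 < g (fst q, snd q, z)"
          unfolding CC_def by blast
        have "q = (x, y)"
        proof (rule ccontr)
          assume "q \<noteq> (x, y)"
          then have "min (g (fst q, snd q, z)) (g (x, y, z)) = 0"
            using bspec[OF bspec[OF elim(3) q(1)] p] by (simp add: \<omega>)
          then show False using q(3) elim(4) by (auto simp: \<omega> min_def split: if_splits)
        qed
        then show "\<omega> \<in> S" using q(2) by (simp add: fibre_def \<omega>)
      qed
    qed
    then have "measure (density \<kappa> f) S = measure (density \<kappa> f) (X \<times> Y \<times> CC S)"
      using S CCs[OF S] sets.top[of \<mu>X] sets.top[of \<mu>Y]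
      by (intro measure_eq_AE) (auto simp: space_\<mu> intro!: times_in_sets_\<kappa>)
    also have "\<dots> = measure \<mu>Z (CC S)" by (rule M(3)[OF CCs[OF S]])
    finally show ?thesis by (simp add: \<pi>.emeasure_eq_measure)
  qed
  have nn: "0 \<le> g1 \<omega>" "0 \<le> g2 \<omega>" for \<omega> using g unfolding densities_def by blast+
  show ?thesis
  proof (rule measure_eqI)
    fix S assume "S \<in> sets (density \<kappa> g1)"
    then have S: "S \<in> sets \<kappa>" by simp
    show "emeasure (density \<kappa> g1) S = emeasure (density \<kappa> g2) S"
      using key[OF S g(1)] key[OF S g(2)] nn by (simp add: g_def)
  qed simp
qed

end

theorem theorem4p8:
  fixes X Y Z A B :: "real set"
    and \<mu>X \<mu>Y \<mu>Z :: "real measure"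
    and c :: "real \<Rightarrow> real \<Rightarrow> real \<Rightarrow> real"
  assumes "compact X" and "compact Y" and "compact Z"
    and "\<mu>X \<in> borel_probs X" and "\<mu>Y \<in> borel_probs Y" and "\<mu>Z \<in> borel_probs Z"
    and "\<mu>X \<preceq>\<^sub>c \<mu>Y" and "\<mu>Y \<preceq>\<^sub>c \<mu>Z"
    and "A \<subseteq> X" and "countable A" and "AE x in \<mu>X. x \<in> A"
    and "B \<subseteq> Y" and "countable B" and "AE y in \<mu>Y. y \<in> B"
    and "absolutely_continuous (restrict_space lborel Z) \<mu>Z"
    and "continuous_on (X \<times> Y \<times> Z) (\<lambda>(x, y, z). c x y z)"
    and "bounded ((\<lambda>(x, y, z). c x y z) ` (X \<times> Y \<times> Z))"
    and "\<And>x y x' y' a b. x \<in> A \<Longrightarrow> y \<in> B \<Longrightarrow> x' \<in> A \<Longrightarrow> y' \<in> B \<Longrightarrow> (x, y) \<noteq> (x', y') \<Longrightarrow>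
           countable {z \<in> Z. c x y z - c x' y' z = a * z + b}"
  shows "\<exists>!\<pi>. optimal_martingale_coupling c X Y Z \<mu>X \<mu>Y \<mu>Z \<pi>"
proof -
  interpret discrete_mot X Y Z A B \<mu>X \<mu>Y \<mu>Z
    using assms(1-6,9-14) by unfold_locales
  define k where "k = (\<lambda>(x, y, z). c x y z)"
  have km: "k \<in> borel_measurable \<kappa>"
    using borel_measurable_continuous_on_restrict[OF assms(16)] measurable_cong_sets[OF sets_\<kappa> refl, of borel]
    unfolding k_def by blast
  obtain K where kb: "\<And>\<omega>. \<omega> \<in> space \<kappa> \<Longrightarrow> \<bar>k \<omega>\<bar> \<le> K"
    using assms(17) unfolding bounded_iff space_\<kappa> k_def by (auto simp: image_iff)
  have Zb: "Z \<in> sets lborel" using compact_imp_closed[OF Z] by simp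
  \<comment> \<open>Countable sets are Lebesgue null, hence null for \<open>\<mu>Z\<close>.
    Singletons give the absence of atoms needed for existence; the contact sets of cost differences
    with lines give \<open>twist\<close>, needed for uniqueness.\<close>
  have null: "N \<in> null_sets \<mu>Z" if "countable N" "N \<subseteq> Z" for N
  proof -
    have "N \<in> null_sets (restrict_space lborel Z)"
      using null_sets_restrict_space[OF Zb, of N] that countable_imp_null_set_lborel by blast
    then show ?thesis using assms(15) unfolding absolutely_continuous_def by blast
  qed
  have "measure \<mu>Z ({z} \<inter> Z) = 0" for z
    using null[of "{z} \<inter> Z"] by (auto simp: null_sets_def measure_def)
  from martingale_couplings_nonempty[OF X Y Z \<mu>X \<mu>Y \<mu>Z assms(7,8) A B this]
  have ne: "couplings \<noteq> {}" .
  have twist: "AE z in \<mu>Z. k (fst p, snd p, z) - k (fst q, snd q, z) \<noteq> a * z + b"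
    if "p \<in> A \<times> B" "q \<in> A \<times> B" "p \<noteq> q" for p q a b
  proof (rule AE_I')
    have "countable {z \<in> Z. c (fst p) (snd p) z - c (fst q) (snd q) z = a * z + b}"
      using that by (intro assms(18)) (auto simp: prod_eq_iff)
    then show "{z \<in> Z. c (fst p) (snd p) z - c (fst q) (snd q) z = a * z + b} \<in> null_sets \<mu>Z"
      by (intro null) auto
  qed (auto simp: k_def space_\<mu>)
  have cost: "(\<integral>(x, y, z). c x y z \<partial>density \<kappa> g) = (\<integral>\<omega>. g \<omega> * k \<omega> \<partial>\<kappa>)" if "g \<in> densities" for g
    using that km unfolding k_def[symmetric] by (intro integral_density_\<kappa>) (auto simp: densities_def)
  \<comment> \<open>Competing couplings can be replaced by competing densities, since every coupling
    has a density in \<open>densities\<close> and every such density defines a coupling.\<close>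
  have opt_iff: "optimal_martingale_coupling c X Y Z \<mu>X \<mu>Y \<mu>Z (density \<kappa> g) \<longleftrightarrow>
      (\<forall>g'\<in>densities. (\<integral>\<omega>. g \<omega> * k \<omega> \<partial>\<kappa>) \<le> (\<integral>\<omega>. g' \<omega> * k \<omega> \<partial>\<kappa>))" if g: "g \<in> densities" for g
  proof
    assume "optimal_martingale_coupling c X Y Z \<mu>X \<mu>Y \<mu>Z (density \<kappa> g)"
    then have "\<not> (\<integral>(x, y, z). c x y z \<partial>\<pi>') < (\<integral>(x, y, z). c x y z \<partial>density \<kappa> g)" if "\<pi>' \<in> couplings" for \<pi>'
      using that unfolding optimal_martingale_coupling_def is_arg_min_def by blast
    from this[OF density_in_couplings]
    show "\<forall>g'\<in>densities. (\<integral>\<omega>. g \<omega> * k \<omega> \<partial>\<kappa>) \<le> (\<integral>\<omega>. g' \<omega> * k \<omega> \<partial>\<kappa>)"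
      using cost g by (simp add: not_less)
  next
    assume *: "\<forall>g'\<in>densities. (\<integral>\<omega>. g \<omega> * k \<omega> \<partial>\<kappa>) \<le> (\<integral>\<omega>. g' \<omega> * k \<omega> \<partial>\<kappa>)"
    have "\<not> (\<integral>(x, y, z). c x y z \<partial>\<pi>') < (\<integral>(x, y, z). c x y z \<partial>density \<kappa> g)" if \<pi>': "\<pi>' \<in> couplings" for \<pi>'
    proof -
      obtain g' where g': "g' \<in> densities" "\<pi>' = density \<kappa> g'" using coupling_has_density[OF \<pi>'] by blast
      then show ?thesis using cost[OF g] cost[OF g'(1)] * by (simp add: not_less)
    qed
    then show "optimal_martingale_coupling c X Y Z \<mu>X \<mu>Y \<mu>Z (density \<kappa> g)"
      unfolding optimal_martingale_coupling_def is_arg_min_def using density_in_couplings[OF g] by blast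
  qed
  obtain g where g: "g \<in> densities" "\<forall>g'\<in>densities. (\<integral>\<omega>. g \<omega> * k \<omega> \<partial>\<kappa>) \<le> (\<integral>\<omega>. g' \<omega> * k \<omega> \<partial>\<kappa>)"
    using optimal_density_exists[OF ne km kb] by blast
  show ?thesis
  proof (rule ex1I[of _ "density \<kappa> g"])
    show "optimal_martingale_coupling c X Y Z \<mu>X \<mu>Y \<mu>Z (density \<kappa> g)" using opt_iff[OF g(1)] g(2) by simp
    fix \<pi> assume opt: "optimal_martingale_coupling c X Y Z \<mu>X \<mu>Y \<mu>Z \<pi>"
    then have "\<pi> \<in> couplings" unfolding optimal_martingale_coupling_def is_arg_min_def by blast
    then obtain h where h: "h \<in> densities" "\<pi> = density \<kappa> h" by (rule coupling_has_density)
    have hopt: "\<forall>g'\<in>densities. (\<integral>\<omega>. h \<omega> * k \<omega> \<partial>\<kappa>) \<le> (\<integral>\<omega>. g' \<omega> * k \<omega> \<partial>\<kappa>)"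
      using opt opt_iff[OF h(1)] h(2) by simp
    show "\<pi> = density \<kappa> g"
      unfolding h(2)
      by (rule optimal_density_unique[OF h(1) g(1) bspec[OF hopt] bspec[OF g(2)] km kb twist])
  qed
qed

end
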